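(* Let $k\ge1$. Every sequence $\{H_i\}_{i=1}^\infty$ of finite $k$-uniform hypergraphs with $|V(H_1)|<|V(H_2)|<\cdots$ has a strongly convergent subsequence.
   Context: For a finite set $V$, a $k$-uniform hypergraph on $V$ is identified with a subset $H\subseteq V^k$ invariant under permutations of coordinates and containing no tuple with two equal coordinates. For a finite set $X$ and $r\ge1$, $K_r(X)\subseteq X^r$ is the set of $r$-tuples with distinct entries; $r([k])$ is the set of nonempty subsets of $[k]=\{1,\dots,k\}$. An $l$-hyperpartition $\mathcal{H}$ of $X$ consists, for each $1\le r\le k$, of a partition $K_r(X)=P^1_r\cup\dots\cup P^l_r$ into $r$-uniform hypergraphs. $\mathcal{H}$ is $\delta$-equitable if $\big||P^i_r|-|P^j_r|\big|/|K_r(X)|<\delta$ for all $r$, $i<j$. A cylinder intersection $L\subseteq K_r(X)$ is given by $(r-1)$-uniform hypergraphs $B_1,\dots,B_r$: an $r$-set $\{a_1,\dots,a_r\}$ is in $L$ iff for some permutation $\sigma$ of $[r]$, $\{a_{\sigma(1)},\dots,a_{\sigma(r)}\}\setminus\{a_{\sigma(i)}\}\in B_i$ for all $i$. $G\subseteq K_r(X)$ is $\delta$-regular if $\big||G|/|K_r(X)|-|G\cap L|/|L|\big|\le\delta$ for all cylinder intersections $L$ with $|L|\ge\delta|K_r(X)|$; $\mathcal{H}$ is $\delta$-regular if all $P^j_r$ are. For $f:r([k])\to[l]$ the directed $\mathcal{H}$-cell with coordinate $f$ is the set of $(x_1,\dots,x_k)\in K_k(X)$ with $\{x_i:i\in S\}\in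 P^{f(S)}_{|S|}$ for all $S\in r([k])$; an $\mathcal{H}$-cell is the union of an $S_k$-orbit of directed cells. A combinatorial structure is a set $\mathcal{C}$ of functions $r([k])\to[l]$ invariant under $(\pi f)(S)=f(\pi^{-1}(S))$, $\pi\in S_k$; a hypergraph $T$ on $X$ has combinatorial structure $\mathcal{C}$ (w.r.t. $\mathcal{H}$) if it is the union of the directed $\mathcal{H}$-cells with coordinates in $\mathcal{C}$. A sequence $\{H_i\}$ with vertex sets $X_i$ and $|X_1|<|X_2|<\cdots$ is strongly convergent if for every $\epsilon>0$ there are a number $l$, a combinatorial structure $\mathcal{C}$ of functions $r([k])\to[l]$, $l$-hyperpartitions $\mathcal{H}_i$ of $X_i$ and numbers $\delta_i\to0$ such that for every $i$, $\mathcal{H}_i$ is $\delta_i$-regular and $\delta_i$-equitable, and the hypergraph $T_i$ with combinatorial structure $\mathcal{C}$ w.r.t. $\mathcal{H}_i$ satisfies $|H_i\triangle T_i|\le\epsilon\binom{|X_i|}{k}$. *)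

theory Defs
  imports
    Complex_Main
    "HOL-Library.FuncSet"
    "HOL-Library.Disjoint_Sets"
    "HOL-Combinatorics.Permutations"
begin

(* r-tuples over X are extensional functions on {1..r}. A permutation of {1..r} is the
   identity outside {1..r}, so for a tuple x and such a permutation p the reindexed tuple
   is just x o p, and {x_i : i in S} is the image x ` S. *)

definition inj_tuples :: "nat \<Rightarrow> 'a set \<Rightarrow> (nat \<Rightarrow> 'a) set" where
  "inj_tuples r X = {x \<in> {1..r} \<rightarrow>\<^sub>E X. inj_on x {1..r}}"

definition uniform_hypergraph :: "nat \<Rightarrow> 'a set \<Rightarrow> (nat \<Rightarrow> 'a) set \<Rightarrow> bool" where
  "uniform_hypergraph r X H \<longleftrightarrow>
     H \<subseteq> inj_tuples r X \<and> (\<forall>x\<in>H. \<forall>\<pi>. \<pi> permutes {1..r} \<longrightarrow> x \<circ> \<pi> \<in> H)"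

(* The r-element vertex sets underlying an r-uniform hypergraph. For r = 0 the only tuple
   is the empty one, so this is {} or {{}}. *)
definition edge_sets :: "nat \<Rightarrow> (nat \<Rightarrow> 'a) set \<Rightarrow> 'a set set" where
  "edge_sets r H = (\<lambda>x. x ` {1..r}) ` H"

(* P r j is the j-th class of the partition of inj_tuples r X; classes may be empty. *)
definition hyperpartition ::
    "nat \<Rightarrow> nat \<Rightarrow> 'a set \<Rightarrow> (nat \<Rightarrow> nat \<Rightarrow> (nat \<Rightarrow> 'a) set) \<Rightarrow> bool" where
  "hyperpartition k l X P \<longleftrightarrow>
     (\<forall>r\<in>{1..k}. (\<forall>j\<in>{1..l}. uniform_hypergraph r X (P r j)) \<and>
        disjoint_family_on (P r) {1..l} \<and> (\<Union>j\<in>{1..l}. P r j) = inj_tuples r X)"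

(* If card X < r then inj_tuples r X is empty and the quotient below is 0 / 0 = 0. *)
definition equitable ::
    "nat \<Rightarrow> nat \<Rightarrow> 'a set \<Rightarrow> real \<Rightarrow> (nat \<Rightarrow> nat \<Rightarrow> (nat \<Rightarrow> 'a) set) \<Rightarrow> bool" where
  "equitable k l X \<delta> P \<longleftrightarrow>
     (\<forall>r\<in>{1..k}. \<forall>i\<in>{1..l}. \<forall>j\<in>{1..l}. i < j \<longrightarrow>
        \<bar>real (card (P r i)) - real (card (P r j))\<bar> / real (card (inj_tuples r X)) < \<delta>)"

definition cylinder_intersection :: "nat \<Rightarrow> 'a set \<Rightarrow> (nat \<Rightarrow> 'a) set \<Rightarrow> bool" where
  "cylinder_intersection r X L \<longleftrightarrow>
     (\<exists>B. (\<forall>i\<in>{1..r}. uniform_hypergraph (r - 1) X (B i)) \<and>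
        L = {a \<in> inj_tuples r X. \<exists>\<sigma>. \<sigma> permutes {1..r} \<and>
               (\<forall>i\<in>{1..r}. a ` {1..r} - {a (\<sigma> i)} \<in> edge_sets (r - 1) (B i))})"

definition regular_hypergraph ::
    "nat \<Rightarrow> 'a set \<Rightarrow> real \<Rightarrow> (nat \<Rightarrow> 'a) set \<Rightarrow> bool" where
  "regular_hypergraph r X \<delta> G \<longleftrightarrow>
     (\<forall>L. cylinder_intersection r X L \<and>
          real (card L) \<ge> \<delta> * real (card (inj_tuples r X)) \<longrightarrow>
        \<bar>real (card G) / real (card (inj_tuples r X)) - real (card (G \<inter> L)) / real (card L)\<bar> \<le> \<delta>)"

definition regular_hyperpartition ::
    "nat \<Rightarrow> nat \<Rightarrow> 'a set \<Rightarrow> real \<Rightarrow> (nat \<Rightarrow> nat \<Rightarrow> (nat \<Rightarrow> 'a) set) \<Rightarrow> bool" where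
  "regular_hyperpartition k l X \<delta> P \<longleftrightarrow>
     (\<forall>r\<in>{1..k}. \<forall>j\<in>{1..l}. regular_hypergraph r X \<delta> (P r j))"

definition nonempty_subsets :: "nat \<Rightarrow> nat set set" where
  "nonempty_subsets k = {S. S \<subseteq> {1..k} \<and> S \<noteq> {}}"

definition directed_cell ::
    "nat \<Rightarrow> 'a set \<Rightarrow> (nat \<Rightarrow> nat \<Rightarrow> (nat \<Rightarrow> 'a) set) \<Rightarrow> (nat set \<Rightarrow> nat) \<Rightarrow> (nat \<Rightarrow> 'a) set" where
  "directed_cell k X P f =
     {x \<in> inj_tuples k X. \<forall>S\<in>nonempty_subsets k. x ` S \<in> edge_sets (card S) (P (card S) (f S))}"

definition perm_action :: "nat \<Rightarrow> (nat \<Rightarrow> nat) \<Rightarrow> (nat set \<Rightarrow> nat) \<Rightarrow> nat set \<Rightarrow> nat" where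
  "perm_action k \<pi> f = (\<lambda>S\<in>nonempty_subsets k. f (inv \<pi> ` S))"

definition combinatorial_structure :: "nat \<Rightarrow> nat \<Rightarrow> (nat set \<Rightarrow> nat) set \<Rightarrow> bool" where
  "combinatorial_structure k l C \<longleftrightarrow>
     C \<subseteq> nonempty_subsets k \<rightarrow>\<^sub>E {1..l} \<and>
     (\<forall>f\<in>C. \<forall>\<pi>. \<pi> permutes {1..k} \<longrightarrow> perm_action k \<pi> f \<in> C)"

definition has_combinatorial_structure ::
    "nat \<Rightarrow> 'a set \<Rightarrow> (nat \<Rightarrow> nat \<Rightarrow> (nat \<Rightarrow> 'a) set) \<Rightarrow> (nat set \<Rightarrow> nat) set \<Rightarrow>
     (nat \<Rightarrow> 'a) set \<Rightarrow> bool" where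
  "has_combinatorial_structure k X P C T \<longleftrightarrow> T = (\<Union>f\<in>C. directed_cell k X P f)"

definition increasing_hypergraph_seq ::
    "nat \<Rightarrow> (nat \<Rightarrow> 'a set) \<Rightarrow> (nat \<Rightarrow> (nat \<Rightarrow> 'a) set) \<Rightarrow> bool" where
  "increasing_hypergraph_seq k X H \<longleftrightarrow>
     (\<forall>i. finite (X i) \<and> uniform_hypergraph k (X i) (H i)) \<and>
     (\<forall>i. card (X i) < card (X (Suc i)))"

definition strongly_convergent ::
    "nat \<Rightarrow> (nat \<Rightarrow> 'a set) \<Rightarrow> (nat \<Rightarrow> (nat \<Rightarrow> 'a) set) \<Rightarrow> bool" where
  "strongly_convergent k X H \<longleftrightarrow>
     increasing_hypergraph_seq k X H \<and>
     (\<forall>\<epsilon>>0. \<exists>l C P \<delta>.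
        1 \<le> l \<and> combinatorial_structure k l C \<and>
        (\<forall>i. 0 < \<delta> i) \<and> \<delta> \<longlonglongrightarrow> (0::real) \<and>
        (\<forall>i. hyperpartition k l (X i) (P i) \<and>
             regular_hyperpartition k l (X i) (\<delta> i) (P i) \<and>
             equitable k l (X i) (\<delta> i) (P i) \<and>
             (\<exists>T. has_combinatorial_structure k (X i) (P i) C T \<and>
                  real (card (sym_diff (H i) T)) \<le> \<epsilon> * real (card (X i) choose k))))"

end

theory Submission
  imports Defs "HOL-Library.Multiset" "HOL-Analysis.Convex" "HOL-Library.Diagonal_Subsequence"
begin

text \<open>
  Colour \<open>r\<close>-sets by finitely many colours. An energy increment over cylinder intersections yields
  two colourings of the \<open>(r - 1)\<close>-sets, a coarse one and a refinement of it, whose conditional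
  colour frequencies are close in mean square, while the given colouring, centred by the fine
  frequencies, is nearly orthogonal to all cylinder intersections, with an error as small as we
  please in terms of the number of coarse colours. Recolour the \<open>r\<close>-sets at random by \<open>{1..l}\<close>, with
  the law of the new colour of an edge depending on its old colour through a coupling of the fine
  frequencies with the uniform distribution. The new colour is then uniform relative to every
  cylinder intersection, whereas the old colour of most edges is a function of the new colour and of
  the coarse colours of the facets. The coarse colouring has boundedly many colours, so induction on
  \<open>r\<close> applies to it. A pigeonhole over the finitely many combinatorial structures with boundedly
  many colours and a diagonal argument over \<open>\<epsilon> = 1 / n\<close> give the subsequence.
\<close>


subsection \<open>Conditional frequencies and cylinder intersections\<close>

text \<open>The obstacle is a circle of constants. The tolerance at each level depends on the final
  number \<open>l\<close> of colours, and \<open>l\<close> comes from the induction applied to a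
  colouring of the facets, so it grows with the number of facet colours; but a smaller error at the
  top level costs more facet colours. The two facet colourings break this circle. The fine one only
  shapes the law of the recolouring and is then forgotten, so its size is harmless. The coarse one
  alone is handed to the induction and bounds \<open>l\<close>, and the error of the fine one is
  chosen with that bound already known. Bounded energy makes the two agree in mean square.
  Recolouring uniformly lets all levels share one \<open>l\<close> with classes of nearly equal
  size, because equitability is the case of the full cylinder. A union bound over all cylinder
  intersections suffices: they are described by families of \<open>(r - 1)\<close>-sets, whose
  number is of lower order than the number of \<open>r\<close>-sets coloured at random.\<close>

definition fibre_mean :: "'e set \<Rightarrow> ('e \<Rightarrow> 'k) \<Rightarrow> ('e \<Rightarrow> real) \<Rightarrow> 'k \<Rightarrow> real" where
  "fibre_mean E M f m = (\<Sum>e\<in>{e\<in>E. M e = m}. f e) / real (card {e\<in>E. M e = m})"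

text \<open>\<open>fibre_mean\<close> is the conditional expectation of \<open>f\<close> given
  \<open>M\<close>: summed fibre by fibre, a weight depending on \<open>M\<close> only does not
  distinguish \<open>f\<close> from its mean. Empty fibres give 0 / 0 = 0 and never enter the
  sum.\<close>

lemma fibre_mean_sum_mult:
  assumes "finite E"
  shows "(\<Sum>e\<in>E. fibre_mean E M f (M e) * \<phi> (M e)) = (\<Sum>e\<in>E. f e * \<phi> (M e))"
proof -
  have "(\<Sum>e\<in>E. fibre_mean E M f (M e) * \<phi> (M e))
      = (\<Sum>m\<in>M ` E. \<Sum>e\<in>{e\<in>E. M e = m}. fibre_mean E M f (M e) * \<phi> (M e))"
    by (rule sum.image_gen[OF assms])
  also have "\<dots> = (\<Sum>m\<in>M ` E. \<Sum>e\<in>{e\<in>E. M e = m}. f e * \<phi> (M e))"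
  proof (rule sum.cong[OF refl])
    fix m assume m: "m \<in> M ` E"
    have "card {e\<in>E. M e = m} \<noteq> 0" using m assms by (auto simp: card_eq_0_iff)
    hence "(\<Sum>e\<in>{e\<in>E. M e = m}. fibre_mean E M f m * \<phi> m) = (\<Sum>e\<in>{e\<in>E. M e = m}. f e) * \<phi> m"
      by (simp add: fibre_mean_def)
    also have "\<dots> = (\<Sum>e\<in>{e\<in>E. M e = m}. f e * \<phi> m)" by (simp add: sum_distrib_right)
    finally show "(\<Sum>e\<in>{e\<in>E. M e = m}. fibre_mean E M f (M e) * \<phi> (M e))
        = (\<Sum>e\<in>{e\<in>E. M e = m}. f e * \<phi> (M e))"
      by simp
  qed
  also have "\<dots> = (\<Sum>e\<in>E. f e * \<phi> (M e))"
    by (rule sum.image_gen[OF assms, symmetric])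
  finally show ?thesis .
qed

text \<open>As \<open>M\<close> factors through \<open>M'\<close>, the coarse mean is itself a
  weight depending on \<open>M'\<close>, so the cross term equals the square of the coarse
  mean.\<close>

lemma fibre_mean_pythagoras:
  assumes "finite E" "\<And>e. e \<in> E \<Longrightarrow> M e = \<rho> (M' e)"
  shows "(\<Sum>e\<in>E. (fibre_mean E M' f (M' e) - fibre_mean E M f (M e))\<^sup>2)
    = (\<Sum>e\<in>E. (fibre_mean E M' f (M' e))\<^sup>2) - (\<Sum>e\<in>E. (fibre_mean E M f (M e))\<^sup>2)"
proof -
  let ?w' = "\<lambda>e. fibre_mean E M' f (M' e)" and ?w = "\<lambda>e. fibre_mean E M f (M e)"
  have "(\<Sum>e\<in>E. ?w' e * ?w e) = (\<Sum>e\<in>E. ?w' e * fibre_mean E M f (\<rho> (M' e)))"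
    using assms(2) by (intro sum.cong) auto
  also have "\<dots> = (\<Sum>e\<in>E. f e * fibre_mean E M f (\<rho> (M' e)))"
    by (rule fibre_mean_sum_mult[OF assms(1)])
  also have "\<dots> = (\<Sum>e\<in>E. f e * ?w e)"
    using assms(2) by (intro sum.cong) auto
  also have "\<dots> = (\<Sum>e\<in>E. ?w e * ?w e)"
    by (rule fibre_mean_sum_mult[OF assms(1), symmetric])
  finally have "(\<Sum>e\<in>E. ?w' e * ?w e) = (\<Sum>e\<in>E. ?w e * ?w e)" .
  moreover have "(\<Sum>e\<in>E. (?w' e - ?w e)\<^sup>2)
      = (\<Sum>e\<in>E. (?w' e)\<^sup>2) + (\<Sum>e\<in>E. ?w e * ?w e) - 2 * (\<Sum>e\<in>E. ?w' e * ?w e)"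
    unfolding sum_distrib_left sum.distrib[symmetric] sum_subtractf[symmetric]
    by (intro sum.cong refl) (simp add: power2_eq_square algebra_simps)
  ultimately show ?thesis by (simp add: power2_eq_square)
qed

text \<open>Against a test that is a function of \<open>M'\<close>, \<open>f\<close> may be replaced
  by its fine mean. Cauchy-Schwarz then bounds the distance of the fine and coarse means from below,
  and Pythagoras turns its square into a gain.\<close>

lemma fibre_mean_increment:
  fixes \<eta> :: real
  assumes "finite E" "\<And>e. e \<in> E \<Longrightarrow> M e = \<rho> (M' e)"
    and bnd: "\<And>e. e \<in> E \<Longrightarrow> \<bar>\<psi> (M' e)\<bar> \<le> 1" and "\<eta> \<ge> 0"
    and big: "\<bar>\<Sum>e\<in>E. (f e - fibre_mean E M f (M e)) * \<psi> (M' e)\<bar> > \<eta> * card E"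
  shows "(\<Sum>e\<in>E. (fibre_mean E M' f (M' e))\<^sup>2)
    \<ge> (\<Sum>e\<in>E. (fibre_mean E M f (M e))\<^sup>2) + \<eta>\<^sup>2 * card E"
proof -
  let ?w' = "\<lambda>e. fibre_mean E M' f (M' e)" and ?w = "\<lambda>e. fibre_mean E M f (M e)"
  define D where "D = (\<Sum>e\<in>E. (?w' e - ?w e)\<^sup>2)"
  have ne: "card E > 0" using big \<open>finite E\<close> by (auto simp: card_gt_0_iff)
  have "(\<Sum>e\<in>E. (f e - ?w e) * \<psi> (M' e)) = (\<Sum>e\<in>E. (?w' e - ?w e) * \<psi> (M' e))"
    using fibre_mean_sum_mult[OF assms(1), of M' f \<psi>]
    by (simp add: left_diff_distrib sum_subtractf)
  hence "(\<eta> * card E)\<^sup>2 \<le> (\<Sum>e\<in>E. (?w' e - ?w e) * \<psi> (M' e))\<^sup>2"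
    using big \<open>\<eta> \<ge> 0\<close> by (subst abs_le_square_iff[symmetric]) auto
  also have "\<dots> \<le> D * (\<Sum>e\<in>E. (\<psi> (M' e))\<^sup>2)"
    unfolding D_def by (rule Cauchy_Schwarz_ineq_sum)
  also have "\<dots> \<le> D * card E"
  proof (rule mult_left_mono)
    have "(\<Sum>e\<in>E. (\<psi> (M' e))\<^sup>2) \<le> (\<Sum>e\<in>E. 1)"
      using bnd by (intro sum_mono) (simp add: abs_square_le_1)
    thus "(\<Sum>e\<in>E. (\<psi> (M' e))\<^sup>2) \<le> card E" by simp
    show "0 \<le> D" unfolding D_def by (intro sum_nonneg) simp
  qed
  finally have "(\<eta>\<^sup>2 * card E) * card E \<le> D * card E"
    by (simp only: power2_eq_square ac_simps)
  hence "\<eta>\<^sup>2 * card E \<le> D" using ne by simp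
  thus ?thesis
    unfolding D_def using fibre_mean_pythagoras[where M=M and M'=M' and \<rho>=\<rho> and f=f, OF assms(1,2)] by simp
qed

section \<open>Edges as unordered sets, the colours of their facets, cylinder intersections\<close>

definition ksets :: "nat \<Rightarrow> 'a set \<Rightarrow> 'a set set" where
  "ksets r X = {e. e \<subseteq> X \<and> card e = r}"

lemma finite_ksets [simp]: "finite X \<Longrightarrow> finite (ksets r X)"
  unfolding ksets_def by (rule finite_subset[of _ "Pow X"]) auto

lemma card_ksets: "finite X \<Longrightarrow> card (ksets r X) = card X choose r"
  unfolding ksets_def by (rule n_subsets)

lemma ksets_remove:
  assumes "e \<in> ksets (Suc r) X" "v \<in> e"
  shows "e - {v} \<in> ksets r X"
  using assms by (auto simp: ksets_def)

lemma ksets_remove':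
  assumes "e \<in> ksets r X" "v \<in> e"
  shows "e - {v} \<in> ksets (r - 1) X"
  using assms by (auto simp: ksets_def)

lemma finite_in_ksets: "finite X \<Longrightarrow> e \<in> ksets r X \<Longrightarrow> finite e"
  unfolding ksets_def using finite_subset by blast

text \<open>An unordered edge does not number its facets, so a multiset is all that can be recorded
  symmetrically.\<close>

definition facet_colours :: "('a set \<Rightarrow> 'c) \<Rightarrow> 'a set \<Rightarrow> 'c multiset" where
  "facet_colours Q e = image_mset (\<lambda>v. Q (e - {v})) (mset_set e)"

lemma facet_colours_cong:
  assumes "finite e" "\<And>v. v \<in> e \<Longrightarrow> Q (e - {v}) = Q' (e - {v})"
  shows "facet_colours Q e = facet_colours Q' e"
  unfolding facet_colours_def using assms by (intro image_mset_cong) auto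

lemma facet_colours_comp:
  assumes "finite X" "e \<in> ksets (Suc r) X" "\<And>s. s \<in> ksets r X \<Longrightarrow> Q s = \<rho> (Q' s)"
  shows "facet_colours Q e = image_mset \<rho> (facet_colours Q' e)"
  unfolding facet_colours_def using ksets_remove[OF assms(2)] assms(3) finite_in_ksets[OF assms(1,2)]
  by (auto simp: image_mset.compositionality comp_def intro!: image_mset_cong)

lemma facet_colours_bij:
  assumes "bij_betw \<beta> e e'" "\<And>v. v \<in> e \<Longrightarrow> Q (e - {v}) = Q (e' - {\<beta> v})"
  shows "facet_colours Q e = facet_colours Q e'"
proof (cases "finite e")
  case True
  have "mset_set e' = image_mset \<beta> (mset_set e)"
    using assms(1) by (simp add: image_mset_mset_set bij_betw_def)
  thus ?thesis unfolding facet_colours_def using True assms(2)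
    by (auto simp: image_mset.compositionality comp_def intro!: image_mset_cong)
next
  case False
  hence "infinite e'" using assms(1) bij_betw_finite by blast
  with False show ?thesis by (simp add: facet_colours_def)
qed

lemma facet_colours_eqE:
  assumes "finite e" "finite e'" "card e = card e'" "facet_colours Q e = facet_colours Q e'"
  obtains \<beta> where "bij_betw \<beta> e e'" "\<And>v. v \<in> e \<Longrightarrow> Q (e - {v}) = Q (e' - {\<beta> v})"
proof -
  obtain h where h: "bij_betw h e e'" using finite_same_card_bij[OF assms(1-3)] by blast
  have "mset_set e' = image_mset h (mset_set e)"
    using h by (simp add: image_mset_mset_set bij_betw_def)
  hence "facet_colours Q e' = image_mset (\<lambda>v. Q (e' - {h v})) (mset_set e)"
    by (simp add: facet_colours_def image_mset.compositionality comp_def)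
  hence eq: "image_mset (\<lambda>v. Q (e - {v})) (mset_set e) = image_mset (\<lambda>v. Q (e' - {h v})) (mset_set e)"
    using assms(4) by (simp only: facet_colours_def)
  obtain p where p: "p permutes e" "\<forall>v\<in>e. Q (e - {v}) = Q (e' - {h (p v)})"
    by (rule image_mset_eq_implies_permutes[OF assms(1) eq])
  show ?thesis
  proof
    show "bij_betw (h \<circ> p) e e'" using bij_betw_trans[OF permutes_imp_bij[OF p(1)] h] .
    show "Q (e - {v}) = Q (e' - {(h \<circ> p) v})" if "v \<in> e" for v using p(2) that by simp
  qed
qed

text \<open>The numbering \<tau> of the edge plays the part of the permutation of coordinates. The
  \<open>B i\<close> may be arbitrary families, since only their members of size
  \<open>r - 1\<close> inside \<open>X\<close> can matter.\<close>

definition cyl :: "nat \<Rightarrow> 'a set \<Rightarrow> (nat \<Rightarrow> 'a set set) \<Rightarrow> 'a set set" where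
  "cyl r X B = {e \<in> ksets r X. \<exists>\<tau>. bij_betw \<tau> {1..r} e \<and> (\<forall>i\<in>{1..r}. e - {\<tau> i} \<in> B i)}"

lemma cyl_subset: "cyl r X B \<subseteq> ksets r X"
  by (auto simp: cyl_def)

lemma cyl_UNIV:
  assumes "finite X"
  shows "cyl r X (\<lambda>_. UNIV) = ksets r X"
proof -
  have "\<exists>\<tau>. bij_betw \<tau> {1..r} e" if "e \<in> ksets r X" for e :: "'a set"
    using finite_in_ksets[OF assms that] that by (intro finite_same_card_bij) (auto simp: ksets_def)
  thus ?thesis by (auto simp: cyl_def)
qed

text \<open>If \<open>Q\<close> determines membership in every \<open>B i\<close>, a numbering that
  witnesses membership of \<open>e\<close> is carried to \<open>e'\<close> by a bijection matching
  facets of equal colour. The indicator of the cylinder is then a function of the facet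
  colours.\<close>

lemma cyl_measurable:
  assumes "finite X" "e \<in> cyl r X B" "e' \<in> ksets r X" "facet_colours Q e = facet_colours Q e'"
    and Q: "\<And>s s' i. s \<in> ksets (r - 1) X \<Longrightarrow> s' \<in> ksets (r - 1) X \<Longrightarrow> Q s = Q s' \<Longrightarrow> i \<in> {1..r} \<Longrightarrow>
       s \<in> B i \<Longrightarrow> s' \<in> B i"
  shows "e' \<in> cyl r X B"
proof -
  have e: "e \<in> ksets r X" using assms(2) by (simp add: cyl_def)
  obtain \<tau> where \<tau>: "bij_betw \<tau> {1..r} e" "\<forall>i\<in>{1..r}. e - {\<tau> i} \<in> B i"
    using assms(2) by (auto simp: cyl_def)
  have "card e = card e'" using e assms(3) by (simp add: ksets_def)
  then obtain \<beta> where \<beta>: "bij_betw \<beta> e e'" "\<And>v. v \<in> e \<Longrightarrow> Q (e - {v}) = Q (e' - {\<beta> v})"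
    by (rule facet_colours_eqE[OF finite_in_ksets[OF assms(1) e] finite_in_ksets[OF assms(1,3)] _ assms(4)])
      blast
  have "bij_betw (\<beta> \<circ> \<tau>) {1..r} e'" using bij_betw_trans[OF \<tau>(1) \<beta>(1)] .
  moreover have "e' - {(\<beta> \<circ> \<tau>) i} \<in> B i" if i: "i \<in> {1..r}" for i
  proof (rule Q[of "e - {\<tau> i}"])
    have ti: "\<tau> i \<in> e" using \<tau>(1) i by (rule bij_betwE[THEN bspec])
    have bi: "\<beta> (\<tau> i) \<in> e'" using \<beta>(1) ti by (rule bij_betwE[THEN bspec])
    show "e - {\<tau> i} \<in> ksets (r - 1) X" using ksets_remove'[OF e ti] .
    show "e' - {(\<beta> \<circ> \<tau>) i} \<in> ksets (r - 1) X" using ksets_remove'[OF assms(3) bi] by simp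
    show "Q (e - {\<tau> i}) = Q (e' - {(\<beta> \<circ> \<tau>) i})" using \<beta>(2)[OF ti] by simp
  qed (use i \<tau>(2) in auto)
  ultimately show ?thesis using assms(3) by (auto simp: cyl_def)
qed

lemma cyl_restrict:
  "cyl r X B = cyl r X (restrict (\<lambda>i. B i \<inter> ksets (r - 1) X) {1..r})"
proof -
  have "(\<forall>i\<in>{1..r}. e - {\<tau> i} \<in> B i) \<longleftrightarrow>
      (\<forall>i\<in>{1..r}. e - {\<tau> i} \<in> restrict (\<lambda>i. B i \<inter> ksets (r - 1) X) {1..r} i)"
    if e: "e \<in> ksets r X" and \<tau>: "bij_betw \<tau> {1..r} e" for e \<tau>
  proof (rule ball_cong[OF refl])
    fix i assume i: "i \<in> {1..r}"
    have "\<tau> i \<in> e" using bij_betwE[OF \<tau>] i by blast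
    hence "e - {\<tau> i} \<in> ksets (r - 1) X" by (rule ksets_remove'[OF e])
    thus "e - {\<tau> i} \<in> B i \<longleftrightarrow> e - {\<tau> i} \<in> restrict (\<lambda>i. B i \<inter> ksets (r - 1) X) {1..r} i"
      using i by simp
  qed
  thus ?thesis unfolding cyl_def by blast
qed

text \<open>A cylinder is determined by \<open>r\<close> families of \<open>(r - 1)\<close>-sets of
  \<open>X\<close>. This count is what the union bound has to pay.\<close>

lemma card_range_cyl:
  assumes "finite X"
  shows "finite (range (cyl r X))" "card (range (cyl r X)) \<le> 2 ^ (r * (card X choose (r - 1)))"
proof -
  define S where "S = ({1..r} \<rightarrow>\<^sub>E Pow (ksets (r - 1) X))"
  have sub: "range (cyl r X) \<subseteq> cyl r X ` S"
  proof (rule image_subsetI)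
    fix B
    have "restrict (\<lambda>i. B i \<inter> ksets (r - 1) X) {1..r} \<in> S"
      unfolding S_def by (rule restrict_PiE_iff[THEN iffD2]) blast
    thus "cyl r X B \<in> cyl r X ` S" by (subst cyl_restrict) (rule imageI)
  qed
  have fin: "finite S" unfolding S_def by (rule finite_PiE) (simp_all add: assms)
  show "finite (range (cyl r X))" using sub fin finite_surj by blast
  have "card (range (cyl r X)) \<le> card S" using surj_card_le[OF fin sub] .
  also have "card S = (2 ^ (card X choose (r - 1))) ^ r"
    unfolding S_def by (subst card_funcsetE) (simp_all add: card_Pow card_ksets assms)
  also have "\<dots> = 2 ^ (r * (card X choose (r - 1)))"
    unfolding power_mult[symmetric] by (simp only: mult.commute)
  finally show "card (range (cyl r X)) \<le> 2 ^ (r * (card X choose (r - 1)))" .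
qed

subsection \<open>Regularisation by energy increments\<close>

definition colour_mean :: "'e set \<Rightarrow> ('e \<Rightarrow> 'k) \<Rightarrow> ('e \<Rightarrow> nat) \<Rightarrow> nat \<Rightarrow> 'k \<Rightarrow> real" where
  "colour_mean E M q a = fibre_mean E M (\<lambda>e. of_bool (q e = a))"

lemma colour_mean_eq:
  "colour_mean E M q a m = real (card {e\<in>E. M e = m \<and> q e = a}) / real (card {e\<in>E. M e = m})"
proof (cases "finite {e\<in>E. M e = m}")
  case True
  have "{e\<in>E. M e = m} \<inter> {e. q e = a} = {e\<in>E. M e = m \<and> q e = a}" by auto
  thus ?thesis using True by (simp add: colour_mean_def fibre_mean_def)
next
  case False
  thus ?thesis by (simp only: colour_mean_def fibre_mean_def card.infinite) simp
qed

lemma colour_mean_nonneg: "colour_mean E M q a m \<ge> 0"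
  by (simp add: colour_mean_eq)

lemma colour_mean_pos:
  assumes "finite E" "e \<in> E"
  shows "colour_mean E M q (q e) (M e) > 0"
proof -
  have "card {e'\<in>E. M e' = M e \<and> q e' = q e} > 0" "card {e'\<in>E. M e' = M e} > 0"
    using assms by (auto simp: card_gt_0_iff)
  thus ?thesis by (simp add: colour_mean_eq)
qed

lemma sum_colour_mean:
  assumes "finite E" "\<And>e. e \<in> E \<Longrightarrow> q e < c" "m \<in> M ` E"
  shows "(\<Sum>a<c. colour_mean E M q a m) = 1"
proof -
  have "card {e\<in>E. M e = m} \<noteq> 0" using assms(1,3) by (auto simp: card_eq_0_iff)
  moreover have "(\<Sum>a<c. card {e\<in>E. M e = m \<and> q e = a}) = card (\<Union>a<c. {e\<in>E. M e = m \<and> q e = a})"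
    using assms(1) by (intro card_UN_disjoint[symmetric]) auto
  moreover have "(\<Union>a<c. {e\<in>E. M e = m \<and> q e = a}) = {e\<in>E. M e = m}"
    using assms(2) by auto
  ultimately show ?thesis
    by (simp add: colour_mean_eq sum_divide_distrib[symmetric] flip: of_nat_sum)
qed

section \<open>Energy of a colouring and its growth under refinement\<close>

definition energy :: "'e set \<Rightarrow> ('e \<Rightarrow> 'k) \<Rightarrow> ('e \<Rightarrow> nat) \<Rightarrow> nat \<Rightarrow> real" where
  "energy E M q c = (\<Sum>a<c. \<Sum>e\<in>E. (colour_mean E M q a (M e))\<^sup>2)"

lemma energy_nonneg: "energy E M q c \<ge> 0"
  unfolding energy_def by (intro sum_nonneg) simp

text \<open>At each edge the frequencies are at most 1 and sum to 1, so their squares sum to at most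
  1. This ceiling limits the number of increments.\<close>

lemma energy_le:
  assumes "finite E" "\<And>e. e \<in> E \<Longrightarrow> q e < c"
  shows "energy E M q c \<le> card E"
proof -
  have "energy E M q c = (\<Sum>e\<in>E. \<Sum>a<c. (colour_mean E M q a (M e))\<^sup>2)"
    unfolding energy_def by (rule sum.swap)
  also have "\<dots> \<le> (\<Sum>e\<in>E. \<Sum>a<c. colour_mean E M q a (M e))"
  proof (intro sum_mono)
    fix e a assume "e \<in> E" "a \<in> {..<c}"
    have "colour_mean E M q a (M e) \<le> 1"
      using assms(1) by (auto simp: colour_mean_eq divide_le_eq_1 card_gt_0_iff intro!: card_mono)
    thus "(colour_mean E M q a (M e))\<^sup>2 \<le> colour_mean E M q a (M e)"
      using colour_mean_nonneg[of E M q a "M e"]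
      by (simp add: power2_eq_square mult_left_le_one_le)
  qed
  also have "\<dots> = (\<Sum>e\<in>E. 1)"
    by (intro sum.cong refl sum_colour_mean assms) auto
  finally show ?thesis by simp
qed

lemma energy_diff:
  assumes "finite E" "\<And>e. e \<in> E \<Longrightarrow> M e = \<rho> (M' e)"
  shows "(\<Sum>e\<in>E. \<Sum>a<c. (colour_mean E M' q a (M' e) - colour_mean E M q a (M e))\<^sup>2)
    = energy E M' q c - energy E M q c"
proof -
  have "(\<Sum>e\<in>E. \<Sum>a<c. (colour_mean E M' q a (M' e) - colour_mean E M q a (M e))\<^sup>2)
      = (\<Sum>a<c. \<Sum>e\<in>E. (colour_mean E M' q a (M' e) - colour_mean E M q a (M e))\<^sup>2)"
    by (rule sum.swap)
  also have "\<dots> = (\<Sum>a<c. (\<Sum>e\<in>E. (colour_mean E M' q a (M' e))\<^sup>2) - (\<Sum>e\<in>E. (colour_mean E M q a (M e))\<^sup>2))"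
    unfolding colour_mean_def
    by (intro sum.cong refl fibre_mean_pythagoras[where \<rho>=\<rho>] assms)
  finally show ?thesis by (simp add: energy_def sum_subtractf)
qed

text \<open>The weight \<phi> is tested along with the cylinder because the recolouring
  probabilities will depend on the facet colours. It costs nothing: a cylinder indicator times
  \<phi> is still a function of suitably refined facet colours.\<close>

definition weak_regular ::
    "nat \<Rightarrow> 'a set \<Rightarrow> ('a set \<Rightarrow> nat) \<Rightarrow> nat \<Rightarrow> ('a set \<Rightarrow> nat) \<Rightarrow> real \<Rightarrow> bool" where
  "weak_regular r X q c Q \<eta> \<longleftrightarrow>
     (\<forall>a<c. \<forall>B \<phi>. (\<forall>e\<in>ksets r X. \<bar>\<phi> (facet_colours Q e)\<bar> \<le> 1) \<longrightarrow>
        \<bar>\<Sum>e\<in>cyl r X B. (of_bool (q e = a)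
           - colour_mean (ksets r X) (facet_colours Q) q a (facet_colours Q e))
           * \<phi> (facet_colours Q e)\<bar> \<le> \<eta> * card (ksets r X))"

text \<open>The new colour of a facet records its old colour and which of the \<open>Suc r\<close>
  families contain it, whence the factor \<open>2 ^ Suc r\<close>; a bijection codes these pairs as
  numbers.\<close>

lemma refine_by_cylinder:
  fixes Q :: "'a set \<Rightarrow> nat"
  assumes "finite X" "\<forall>s\<in>ksets r X. Q s < c0"
  obtains Q' :: "'a set \<Rightarrow> nat" and \<rho> \<chi> where
    "\<forall>s\<in>ksets r X. Q' s < c0 * 2 ^ Suc r \<and> Q s = \<rho> (Q' s)"
    "\<forall>e\<in>ksets (Suc r) X. (of_bool (e \<in> cyl (Suc r) X B) :: real) = \<chi> (facet_colours Q' e)"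
proof -
  define F where "F = {..<c0} \<times> Pow {1..Suc r}"
  have finF: "finite F" and cardF: "card F = c0 * 2 ^ Suc r"
    by (simp_all only: F_def card_cartesian_product card_Pow card_lessThan card_atLeastAtMost
        finite_cartesian_product finite_lessThan finite_Pow_iff finite_atLeastAtMost) simp
  obtain h where h: "bij_betw h F {0..<card F}" using ex_bij_betw_finite_nat[OF finF] by blast
  define pair where "pair s = (Q s, {i \<in> {1..Suc r}. s \<in> B i})" for s
  have pairF: "pair s \<in> F" if "s \<in> ksets r X" for s
    using assms(2) that by (auto simp: pair_def F_def)
  define Q' where "Q' = h \<circ> pair"
  have inv: "inv_into F h (Q' s) = pair s" if "s \<in> ksets r X" for s
    using bij_betw_inv_into_left[OF h pairF[OF that]] by (simp add: Q'_def)
  have 1: "Q' s < c0 * 2 ^ Suc r" if "s \<in> ksets r X" for s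
    using bij_betwE[OF h] pairF[OF that] cardF by (simp add: Q'_def)
  have same: "s' \<in> B i" if "s \<in> ksets r X" "s' \<in> ksets r X" "Q' s = Q' s'" "i \<in> {1..Suc r}" "s \<in> B i" for s s' i
  proof -
    have "pair s = pair s'" using inv that(1-3) by metis
    thus ?thesis using that(4,5) by (auto simp: pair_def)
  qed
  define \<chi> :: "nat multiset \<Rightarrow> real" where
    "\<chi> m = of_bool (\<exists>e\<in>cyl (Suc r) X B. facet_colours Q' e = m)" for m
  show ?thesis
  proof
    show "\<forall>s\<in>ksets r X. Q' s < c0 * 2 ^ Suc r \<and> Q s = (fst \<circ> inv_into F h) (Q' s)"
      using 1 inv by (auto simp: pair_def)
    show "\<forall>e\<in>ksets (Suc r) X. of_bool (e \<in> cyl (Suc r) X B) = \<chi> (facet_colours Q' e)"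
    proof
      fix e assume e: "e \<in> ksets (Suc r) X"
      have "e \<in> cyl (Suc r) X B" if "e' \<in> cyl (Suc r) X B" "facet_colours Q' e' = facet_colours Q' e" for e'
      proof (rule cyl_measurable[OF assms(1) that(1) e that(2)])
        fix s s' i assume "s \<in> ksets (Suc r - 1) X" "s' \<in> ksets (Suc r - 1) X" "Q' s = Q' s'"
          "i \<in> {1..Suc r}" "s \<in> B i"
        thus "s' \<in> B i" using same[of s s' i] by simp
      qed
      hence "(\<exists>e'\<in>cyl (Suc r) X B. facet_colours Q' e' = facet_colours Q' e) \<longleftrightarrow> e \<in> cyl (Suc r) X B"
        by blast
      thus "of_bool (e \<in> cyl (Suc r) X B) = \<chi> (facet_colours Q' e)" by (simp add: \<chi>_def)
    qed
  qed
qed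

definition refines :: "nat \<Rightarrow> 'a set \<Rightarrow> ('a set \<Rightarrow> nat) \<Rightarrow> ('a set \<Rightarrow> nat) \<Rightarrow> bool" where
  "refines r X Q' Q \<longleftrightarrow> (\<exists>\<rho>. \<forall>s\<in>ksets r X. Q s = \<rho> (Q' s))"

lemma refines_refl: "refines r X Q Q"
  unfolding refines_def by (rule exI[of _ "\<lambda>x. x"]) simp

lemma refines_trans:
  assumes "refines r X Q'' Q'" "refines r X Q' Q"
  shows "refines r X Q'' Q"
proof -
  obtain \<rho> \<rho>' where "\<forall>s\<in>ksets r X. Q s = \<rho> (Q' s)" "\<forall>s\<in>ksets r X. Q' s = \<rho>' (Q'' s)"
    using assms unfolding refines_def by metis
  thus ?thesis unfolding refines_def by (intro exI[of _ "\<rho> \<circ> \<rho>'"]) simp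
qed

abbreviation facet_energy :: "nat \<Rightarrow> 'a set \<Rightarrow> ('a set \<Rightarrow> nat) \<Rightarrow> nat \<Rightarrow> ('a set \<Rightarrow> nat) \<Rightarrow> real" where
  "facet_energy r X q c Q \<equiv> energy (ksets r X) (facet_colours Q) q c"

text \<open>Refining by the cylinder of a failed test makes this test a function of the new facet
  colours, so the colour \<open>a\<close> concerned gains energy. The other colours cannot lose any,
  again by Pythagoras.\<close>

lemma energy_increment:
  fixes Q :: "'a set \<Rightarrow> nat"
  assumes "finite X" "\<forall>s\<in>ksets r X. Q s < c0" "\<eta> \<ge> 0" "\<not> weak_regular (Suc r) X q c Q \<eta>"
  obtains Q' :: "'a set \<Rightarrow> nat" where
    "\<forall>s\<in>ksets r X. Q' s < c0 * 2 ^ Suc r" "refines r X Q' Q"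
    "facet_energy (Suc r) X q c Q' \<ge> facet_energy (Suc r) X q c Q + \<eta>\<^sup>2 * card (ksets (Suc r) X)"
proof -
  let ?E = "ksets (Suc r) X"
  let ?w = "\<lambda>Q a e. colour_mean ?E (facet_colours Q) q a (facet_colours Q e)"
  obtain a B \<phi> where a: "a < c" and \<phi>: "\<forall>e\<in>?E. \<bar>\<phi> (facet_colours Q e)\<bar> \<le> 1"
    and big: "\<bar>\<Sum>e\<in>cyl (Suc r) X B. (of_bool (q e = a) - ?w Q a e) * \<phi> (facet_colours Q e)\<bar> > \<eta> * card ?E"
    using assms(4) unfolding weak_regular_def not_all not_imp not_le by blast
  obtain Q' :: "'a set \<Rightarrow> nat" and \<rho> \<chi> where
    Q': "\<forall>s\<in>ksets r X. Q' s < c0 * 2 ^ Suc r \<and> Q s = \<rho> (Q' s)"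
    and \<chi>: "\<forall>e\<in>?E. (of_bool (e \<in> cyl (Suc r) X B) :: real) = \<chi> (facet_colours Q' e)"
    using refine_by_cylinder[OF assms(1,2)] by blast
  have fc: "facet_colours Q e = image_mset \<rho> (facet_colours Q' e)" if "e \<in> ?E" for e
    using facet_colours_comp[OF assms(1) that, of Q \<rho> Q'] Q' by simp
  have finE: "finite ?E" using assms(1) by simp
  define \<psi> where "\<psi> m = \<chi> m * \<phi> (image_mset \<rho> m)" for m
  have \<psi>_eq: "\<psi> (facet_colours Q' e) = of_bool (e \<in> cyl (Suc r) X B) * \<phi> (facet_colours Q e)" if "e \<in> ?E" for e
    using \<chi> fc that by (simp add: \<psi>_def)
  have "(\<Sum>e\<in>cyl (Suc r) X B. (of_bool (q e = a) - ?w Q a e) * \<phi> (facet_colours Q e))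
      = (\<Sum>e\<in>?E. (of_bool (q e = a) - ?w Q a e) * \<psi> (facet_colours Q' e))"
    by (rule sum.mono_neutral_cong_left)
      (use finE cyl_subset[of "Suc r" X B] \<psi>_eq in \<open>auto simp: subset_iff\<close>)
  hence big': "\<bar>\<Sum>e\<in>?E. (of_bool (q e = a) - ?w Q a e) * \<psi> (facet_colours Q' e)\<bar> > \<eta> * card ?E"
    using big by simp
  have inc: "(\<Sum>e\<in>?E. (?w Q' a e)\<^sup>2) \<ge> (\<Sum>e\<in>?E. (?w Q a e)\<^sup>2) + \<eta>\<^sup>2 * card ?E"
    unfolding colour_mean_def
  proof (rule fibre_mean_increment[where \<rho>="image_mset \<rho>" and \<psi>=\<psi>, OF finE fc])
    show "\<bar>\<psi> (facet_colours Q' e)\<bar> \<le> 1" if "e \<in> ?E" for e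
      using \<phi> that by (simp add: \<psi>_eq)
  qed (use assms(3) big' in \<open>simp_all add: colour_mean_def\<close>)
  have mono: "(\<Sum>e\<in>?E. (?w Q b e)\<^sup>2) \<le> (\<Sum>e\<in>?E. (?w Q' b e)\<^sup>2)" for b
  proof -
    have "0 \<le> (\<Sum>e\<in>?E. (?w Q' b e - ?w Q b e)\<^sup>2)" by (intro sum_nonneg) simp
    also have "\<dots> = (\<Sum>e\<in>?E. (?w Q' b e)\<^sup>2) - (\<Sum>e\<in>?E. (?w Q b e)\<^sup>2)"
      unfolding colour_mean_def
      by (rule fibre_mean_pythagoras[where \<rho>="image_mset \<rho>"]) (use finE fc in auto)
    finally show ?thesis by simp
  qed
  have "facet_energy (Suc r) X q c Q + \<eta>\<^sup>2 * card ?E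
      = (\<Sum>b\<in>{..<c}-{a}. \<Sum>e\<in>?E. (?w Q b e)\<^sup>2) + ((\<Sum>e\<in>?E. (?w Q a e)\<^sup>2) + \<eta>\<^sup>2 * card ?E)"
    unfolding energy_def using a by (subst sum.remove[of _ a]) simp_all
  also have "\<dots> \<le> (\<Sum>b\<in>{..<c}-{a}. \<Sum>e\<in>?E. (?w Q' b e)\<^sup>2) + (\<Sum>e\<in>?E. (?w Q' a e)\<^sup>2)"
    by (intro add_mono sum_mono mono inc)
  also have "\<dots> = facet_energy (Suc r) X q c Q'"
    unfolding energy_def using a by (subst (2) sum.remove[of _ a]) simp_all
  finally show ?thesis using that[of Q'] Q' by (auto simp: refines_def)
qed

text \<open>\<open>n\<close> counts the increments still possible: the energy is at most
  \<open>n\<close> increments below its ceiling, and every refinement uses one up.\<close>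

lemma weak_regularization_steps:
  fixes Q :: "'a set \<Rightarrow> nat" and \<eta> :: real
  assumes "finite X" "\<forall>e\<in>ksets (Suc r) X. q e < c" "\<eta> > 0"
  shows "\<forall>s\<in>ksets r X. Q s < c0 \<Longrightarrow>
    card (ksets (Suc r) X) \<le> facet_energy (Suc r) X q c Q + real n * (\<eta>\<^sup>2 * card (ksets (Suc r) X)) \<Longrightarrow>
    \<exists>Q'. (\<forall>s\<in>ksets r X. Q' s < c0 * (2 ^ Suc r) ^ n) \<and> refines r X Q' Q \<and> weak_regular (Suc r) X q c Q' \<eta>"
proof (induction n arbitrary: Q c0)
  case (0 Q c0)
  let ?E = "ksets (Suc r) X"
  have "weak_regular (Suc r) X q c Q \<eta>"
  proof (rule ccontr)
    assume nr: "\<not> ?thesis"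
    obtain Q' :: "'a set \<Rightarrow> nat" where
      "facet_energy (Suc r) X q c Q' \<ge> facet_energy (Suc r) X q c Q + \<eta>\<^sup>2 * card ?E"
      using energy_increment[OF assms(1) "0"(1) less_imp_le[OF assms(3)] nr] by blast
    moreover have "facet_energy (Suc r) X q c Q' \<le> card ?E"
      using assms(1,2) by (intro energy_le) auto
    \<comment> \<open>A gain at the ceiling is possible only if there are no edges; but then all
      cylinders are empty and no test can fail.\<close>
    ultimately have "\<eta>\<^sup>2 * card ?E \<le> 0" using "0"(2) by simp
    hence "\<not> card ?E > 0" using assms(3) by (simp add: mult_le_0_iff)
    hence "?E = {}" using assms(1) by (simp add: card_gt_0_iff)
    moreover have "cyl (Suc r) X B = {}" for B using cyl_subset[of "Suc r" X B] calculation by simp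
    ultimately show False using nr by (simp add: weak_regular_def)
  qed
  thus ?case using "0"(1) refines_refl[of r X Q] by auto
next
  case (Suc n Q c0)
  let ?E = "ksets (Suc r) X"
  show ?case
  proof (cases "weak_regular (Suc r) X q c Q \<eta>")
    case True
    have "c0 * 1 \<le> c0 * (2 ^ Suc r) ^ Suc n" by (intro mult_left_mono) simp_all
    thus ?thesis using True Suc.prems(1) refines_refl by (metis less_le_trans mult.right_neutral)
  next
    case False
    obtain Q' :: "'a set \<Rightarrow> nat" where
      Q': "\<forall>s\<in>ksets r X. Q' s < c0 * 2 ^ Suc r" "refines r X Q' Q"
      and en: "facet_energy (Suc r) X q c Q' \<ge> facet_energy (Suc r) X q c Q + \<eta>\<^sup>2 * card ?E"
      using energy_increment[OF assms(1) Suc.prems(1) less_imp_le[OF assms(3)] False] by blast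
    have "card ?E \<le> facet_energy (Suc r) X q c Q' + real n * (\<eta>\<^sup>2 * card ?E)"
      using en Suc.prems(2) by (simp add: algebra_simps)
    from Suc.IH[OF Q'(1) this] obtain Q'' where
      Q'': "\<forall>s\<in>ksets r X. Q'' s < c0 * 2 ^ Suc r * (2 ^ Suc r) ^ n" "refines r X Q'' Q'"
        "weak_regular (Suc r) X q c Q'' \<eta>" by blast
    show ?thesis
      using Q'' refines_trans[OF Q''(2) Q'(2)]
      by (intro exI[of _ Q'']) (simp only: power_Suc mult.assoc)
  qed
qed

lemma one_le_nat_ceiling_mult:
  fixes x :: real
  assumes "x > 0"
  shows "1 \<le> real (nat \<lceil>1 / x\<rceil>) * x"
  using mult_right_mono[OF real_nat_ceiling_ge[of "1 / x"], of x] assms by simp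

definition refined_colours :: "nat \<Rightarrow> real \<Rightarrow> nat \<Rightarrow> nat" where
  "refined_colours r \<eta> c0 = c0 * (2 ^ Suc r) ^ nat \<lceil>1 / \<eta>\<^sup>2\<rceil>"

lemma weak_regularization:
  fixes Q :: "'a set \<Rightarrow> nat"
  assumes "finite X" "\<forall>e\<in>ksets (Suc r) X. q e < c" "\<eta> > 0" "\<forall>s\<in>ksets r X. Q s < c0"
  obtains Q' :: "'a set \<Rightarrow> nat" where "\<forall>s\<in>ksets r X. Q' s < refined_colours r \<eta> c0"
    "refines r X Q' Q" "weak_regular (Suc r) X q c Q' \<eta>"
proof -
  have "1 \<le> real (nat \<lceil>1 / \<eta>\<^sup>2\<rceil>) * \<eta>\<^sup>2"
    using assms(3) by (intro one_le_nat_ceiling_mult) simp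
  hence "real (card (ksets (Suc r) X)) * 1 \<le> card (ksets (Suc r) X) * (real (nat \<lceil>1 / \<eta>\<^sup>2\<rceil>) * \<eta>\<^sup>2)"
    by (intro mult_left_mono) simp_all
  hence "card (ksets (Suc r) X) \<le> facet_energy (Suc r) X q c Q
      + real (nat \<lceil>1 / \<eta>\<^sup>2\<rceil>) * (\<eta>\<^sup>2 * card (ksets (Suc r) X))"
    using energy_nonneg[of "ksets (Suc r) X" "facet_colours Q" q c] by (simp add: mult_ac)
  from weak_regularization_steps[OF assms(1-4) this] that show ?thesis
    unfolding refined_colours_def by blast
qed

text \<open>Weak regularization is iterated with the error belonging to the current number of
  colours. When the energy jumps by more than \<kappa> times the number of edges, the refinement
  becomes the new coarse colouring; the ceiling allows at most \<open>n\<close> jumps. The coarse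
  bound is always an iterate of \<open>refined_colours\<close>, whatever \<open>X\<close>
  is.\<close>

lemma strong_regularization_steps:
  fixes Q :: "'a set \<Rightarrow> nat" and \<eta> :: "nat \<Rightarrow> real" and \<kappa> :: real
  assumes "finite X" "\<forall>e\<in>ksets (Suc r) X. q e < c" "\<And>c. \<eta> c > 0" "\<kappa> > 0"
  shows "\<forall>s\<in>ksets r X. Q s < c0 \<Longrightarrow>
    card (ksets (Suc r) X) \<le> facet_energy (Suc r) X q c Q + real n * (\<kappa> * card (ksets (Suc r) X)) \<Longrightarrow>
    \<exists>c1 \<in> (\<lambda>j. ((\<lambda>c. refined_colours r (\<eta> c) c) ^^ j) c0) ` {..n}. \<exists>Q1 Q'.
      (\<forall>s\<in>ksets r X. Q1 s < c1) \<and> refines r X Q' Q1 \<and> weak_regular (Suc r) X q c Q' (\<eta> c1) \<and>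
      facet_energy (Suc r) X q c Q' \<le> facet_energy (Suc r) X q c Q1 + \<kappa> * card (ksets (Suc r) X)"
proof (induction n arbitrary: Q c0)
  case (0 Q c0)
  let ?E = "ksets (Suc r) X"
  obtain Q' :: "'a set \<Rightarrow> nat" where "refines r X Q' Q" "weak_regular (Suc r) X q c Q' (\<eta> c0)"
    using weak_regularization[OF assms(1,2) assms(3)[of c0] 0(1)] by blast
  moreover have "facet_energy (Suc r) X q c Q' \<le> card ?E"
    using assms(1,2) by (intro energy_le) auto
  moreover have "0 \<le> \<kappa> * card ?E" using assms(4) by simp
  ultimately show ?case
    using 0 by (intro bexI[of _ c0] exI[of _ Q] exI[of _ Q']) (auto simp: image_iff)
next
  case (Suc n Q c0)
  let ?E = "ksets (Suc r) X"
  let ?G = "\<lambda>c. refined_colours r (\<eta> c) c"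
  obtain Q' :: "'a set \<Rightarrow> nat" where Q': "\<forall>s\<in>ksets r X. Q' s < ?G c0"
    "refines r X Q' Q" "weak_regular (Suc r) X q c Q' (\<eta> c0)"
    using weak_regularization[OF assms(1,2) assms(3)[of c0] Suc.prems(1)] by blast
  show ?case
  proof (cases "facet_energy (Suc r) X q c Q' \<le> facet_energy (Suc r) X q c Q + \<kappa> * card ?E")
    case True
    have "c0 \<in> (\<lambda>j. (?G ^^ j) c0) ` {..Suc n}" by (rule image_eqI[of _ _ 0]) simp_all
    with True Q' Suc.prems(1) show ?thesis by blast
  next
    case False
    hence "card ?E \<le> facet_energy (Suc r) X q c Q' + real n * (\<kappa> * card ?E)"
      using Suc.prems(2) by (simp add: algebra_simps)
    from Suc.IH[OF Q'(1) this] obtain c1 where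
      c1: "c1 \<in> (\<lambda>j. (?G ^^ j) (?G c0)) ` {..n}" and
      ex: "\<exists>Q1 Q'. (\<forall>s\<in>ksets r X. Q1 s < c1) \<and> refines r X Q' Q1 \<and> weak_regular (Suc r) X q c Q' (\<eta> c1) \<and>
        facet_energy (Suc r) X q c Q' \<le> facet_energy (Suc r) X q c Q1 + \<kappa> * card ?E" by blast
    obtain j where "j \<le> n" "c1 = (?G ^^ j) (?G c0)" using c1 by auto
    hence "c1 = (?G ^^ Suc j) c0" "Suc j \<le> Suc n" by (simp_all only: funpow_Suc_right comp_def Suc_le_mono)
    hence "c1 \<in> (\<lambda>j. (?G ^^ j) c0) ` {..Suc n}" by blast
    with ex show ?thesis by blast
  qed
qed

text \<open>The start is the constant colouring. A finite set of possible bounds \<open>c1\<close>,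
  rather than their maximum, lets later constants be chosen separately for each
  \<open>c1\<close>.\<close>

lemma strong_regularization:
  fixes \<eta> :: "nat \<Rightarrow> real" and \<kappa> :: real
  assumes "\<And>c. \<eta> c > 0" "\<kappa> > 0"
  shows "\<exists>S :: nat set. finite S \<and>
    (\<forall>(X::'a set) q. finite X \<longrightarrow> (\<forall>e\<in>ksets (Suc r) X. q e < c) \<longrightarrow>
      (\<exists>c1\<in>S. \<exists>Q1 Q'. (\<forall>s\<in>ksets r X. Q1 s < c1) \<and> refines r X Q' Q1 \<and>
        weak_regular (Suc r) X q c Q' (\<eta> c1) \<and>
        facet_energy (Suc r) X q c Q' \<le> facet_energy (Suc r) X q c Q1 + \<kappa> * card (ksets (Suc r) X)))"
proof -
  let ?n = "nat \<lceil>1 / \<kappa>\<rceil>"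
  show ?thesis
  proof (intro exI[of _ "(\<lambda>j. ((\<lambda>c. refined_colours r (\<eta> c) c) ^^ j) 1) ` {..?n}"] conjI allI impI)
    show "finite ((\<lambda>j. ((\<lambda>c. refined_colours r (\<eta> c) c) ^^ j) 1) ` {..?n})" by simp
    fix X :: "'a set" and q
    assume X: "finite X" "\<forall>e\<in>ksets (Suc r) X. q e < c"
    have "1 \<le> real ?n * \<kappa>"
      by (rule one_le_nat_ceiling_mult[OF assms(2)])
    hence "real (card (ksets (Suc r) X)) * 1 \<le> card (ksets (Suc r) X) * (real ?n * \<kappa>)"
      by (intro mult_left_mono) simp_all
    hence en: "card (ksets (Suc r) X) \<le> facet_energy (Suc r) X q c (\<lambda>_. 0)
        + real ?n * (\<kappa> * card (ksets (Suc r) X))"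
      using energy_nonneg[of "ksets (Suc r) X" "facet_colours (\<lambda>_. 0 :: nat)" q c] by (simp add: mult_ac)
    show "\<exists>c1\<in>(\<lambda>j. ((\<lambda>c. refined_colours r (\<eta> c) c) ^^ j) 1) ` {..?n}. \<exists>Q1 Q'.
        (\<forall>s\<in>ksets r X. Q1 s < c1) \<and> refines r X Q' Q1 \<and>
        weak_regular (Suc r) X q c Q' (\<eta> c1) \<and>
        facet_energy (Suc r) X q c Q' \<le> facet_energy (Suc r) X q c Q1 + \<kappa> * card (ksets (Suc r) X)"
      by (rule strong_regularization_steps[OF X assms _ en]) simp
  qed
qed

subsection \<open>Random recolouring\<close>

text \<open>For negative \<open>x\<close> compare with \<open>1 / (1 - x)\<close>: multiplying the
  right side by \<open>1 - x\<close> gives \<open>1 - x * x\<^sup>2\<close>, which is at least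
  1.\<close>

lemma exp_le_quadratic:
  fixes x :: real
  assumes "\<bar>x\<bar> \<le> 1"
  shows "exp x \<le> 1 + x + x\<^sup>2"
proof (cases "x \<ge> 0")
  case True
  thus ?thesis using assms by (intro exp_bound) auto
next
  case False
  have "(1 - x) * (1 + x + x\<^sup>2) = 1 - x * x\<^sup>2"
    by (simp add: algebra_simps power2_eq_square)
  moreover have "x * x\<^sup>2 \<le> 0" using False by (intro mult_nonpos_nonneg) auto
  ultimately have "1 / (1 - x) \<le> 1 + x + x\<^sup>2"
    using False by (subst pos_divide_le_eq) (simp_all add: mult.commute)
  moreover have "exp x \<le> 1 / (1 - x)"
    using exp_ge_add_one_self[of "- x"] False by (simp add: exp_minus field_simps)
  ultimately show ?thesis by linarith
qed

lemma weighted_pigeonhole: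
  fixes p f :: "'i \<Rightarrow> real"
  assumes "finite I" "\<And>i. i \<in> I \<Longrightarrow> p i \<ge> 0" "sum p I = 1" "(\<Sum>i\<in>I. p i * f i) \<le> y"
  obtains i where "i \<in> I" "f i \<le> y"
proof (rule ccontr)
  assume "\<not> thesis"
  hence gt: "f i > y" if "i \<in> I" for i using that \<open>\<And>i. \<lbrakk>i \<in> I; f i \<le> y\<rbrakk> \<Longrightarrow> thesis\<close> by force
  have pos: "\<exists>i\<in>I. p i > 0"
  proof (rule ccontr)
    assume "\<not> ?thesis"
    hence "sum p I = 0" using assms(2) by (intro sum.neutral) force
    thus False using assms(3) by simp
  qed
  have "(\<Sum>i\<in>I. p i * y) < (\<Sum>i\<in>I. p i * f i)"
  proof (intro sum_strict_mono_ex1[OF assms(1)] ballI)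
    show "p i * y \<le> p i * f i" if "i \<in> I" for i
      using assms(2) gt that by (intro mult_left_mono) (auto intro: less_imp_le)
    show "\<exists>i\<in>I. p i * y < p i * f i" using pos gt by (auto intro: mult_strict_left_mono)
  qed
  thus False using assms(3,4) by (simp add: sum_distrib_right[symmetric])
qed

text \<open>Derandomisation: the average of an exponential potential over the random colour of one
  more point is at most \<open>exp (\<lambda>\<^sup>2)\<close> times the old potential, so the colours can be chosen
  greedily.\<close>

lemma exists_low_potential:
  fixes g :: "'t \<Rightarrow> 'e \<Rightarrow> nat \<Rightarrow> real" and p :: "'e \<Rightarrow> nat \<Rightarrow> real" and \<mu> :: real
  assumes "finite E" "finite T" "finite J" "0 \<le> \<mu>" "\<mu> \<le> 1"
    and p: "\<And>e j. e \<in> E \<Longrightarrow> j \<in> J \<Longrightarrow> p e j \<ge> 0" "\<And>e. e \<in> E \<Longrightarrow> (\<Sum>j\<in>J. p e j) = 1"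
    and g: "\<And>t e j. t \<in> T \<Longrightarrow> e \<in> E \<Longrightarrow> j \<in> J \<Longrightarrow> \<bar>g t e j\<bar> \<le> 1"
    and mean: "\<And>t e. t \<in> T \<Longrightarrow> e \<in> E \<Longrightarrow> (\<Sum>j\<in>J. p e j * g t e j) = 0"
  shows "\<exists>U. (\<forall>e\<in>E. U e \<in> J) \<and>
    (\<Sum>t\<in>T. exp (\<mu> * (\<Sum>e\<in>E. g t e (U e)))) \<le> card T * exp (\<mu>\<^sup>2 * card E)"
  using assms(1) p g mean
proof (induction E)
  case empty
  show ?case by simp
next
  case (insert x E)
  have "\<exists>U. (\<forall>e\<in>E. U e \<in> J) \<and>
    (\<Sum>t\<in>T. exp (\<mu> * (\<Sum>e\<in>E. g t e (U e)))) \<le> card T * exp (\<mu>\<^sup>2 * card E)"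
    by (rule insert.IH) (use insert.prems in auto)
  then obtain U where U: "\<forall>e\<in>E. U e \<in> J"
    "(\<Sum>t\<in>T. exp (\<mu> * (\<Sum>e\<in>E. g t e (U e)))) \<le> card T * exp (\<mu>\<^sup>2 * card E)"
    by blast
  define \<Phi> where "\<Phi> t = exp (\<mu> * (\<Sum>e\<in>E. g t e (U e)))" for t
  have avg: "(\<Sum>j\<in>J. p x j * exp (\<mu> * g t x j)) \<le> exp (\<mu>\<^sup>2)" if t: "t \<in> T" for t
  proof -
    \<comment> \<open>After expansion to second order the linear term averages to 0, as the tests
      have mean 0.\<close>
    have "(\<Sum>j\<in>J. p x j * exp (\<mu> * g t x j)) \<le> (\<Sum>j\<in>J. p x j * (1 + \<mu> * g t x j + \<mu>\<^sup>2))"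
    proof (intro sum_mono mult_left_mono)
      fix j assume j: "j \<in> J"
      have gb: "\<bar>g t x j\<bar> \<le> 1" using insert.prems(3) t j by simp
      have "\<bar>\<mu> * g t x j\<bar> \<le> \<mu> * 1" unfolding abs_mult using gb assms(4) by (intro mult_mono) simp_all
      hence "\<bar>\<mu> * g t x j\<bar> \<le> 1" using assms(5) by simp
      hence "exp (\<mu> * g t x j) \<le> 1 + \<mu> * g t x j + (\<mu> * g t x j)\<^sup>2" by (rule exp_le_quadratic)
      moreover have "(\<mu> * g t x j)\<^sup>2 \<le> \<mu>\<^sup>2 * 1"
        unfolding power_mult_distrib using gb by (intro mult_left_mono) (simp_all add: abs_square_le_1)
      ultimately show "exp (\<mu> * g t x j) \<le> 1 + \<mu> * g t x j + \<mu>\<^sup>2" by simp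
    qed (use insert.prems(1) in auto)
    also have "\<dots> = (\<Sum>j\<in>J. p x j) + \<mu> * (\<Sum>j\<in>J. p x j * g t x j) + \<mu>\<^sup>2 * (\<Sum>j\<in>J. p x j)"
      unfolding sum_distrib_left sum.distrib[symmetric]
      by (intro sum.cong refl) (simp add: algebra_simps)
    also have "\<dots> = 1 + \<mu>\<^sup>2" using insert.prems(2,4) t by simp
    also have "\<dots> \<le> exp (\<mu>\<^sup>2)" by simp
    finally show ?thesis .
  qed
  have "(\<Sum>j\<in>J. p x j * (\<Sum>t\<in>T. \<Phi> t * exp (\<mu> * g t x j)))
      = (\<Sum>t\<in>T. \<Phi> t * (\<Sum>j\<in>J. p x j * exp (\<mu> * g t x j)))"
    unfolding sum_distrib_left by (subst sum.swap) (simp add: mult_ac)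
  also have "\<dots> \<le> (\<Sum>t\<in>T. \<Phi> t * exp (\<mu>\<^sup>2))"
    by (intro sum_mono mult_left_mono avg) (simp_all add: \<Phi>_def)
  also have "\<dots> \<le> (card T * exp (\<mu>\<^sup>2 * card E)) * exp (\<mu>\<^sup>2)"
    unfolding sum_distrib_right[symmetric] using U(2) by (intro mult_right_mono) (simp_all add: \<Phi>_def)
  also have "\<dots> = card T * exp (\<mu>\<^sup>2 * card (insert x E))"
    using insert.hyps by (simp add: exp_add[symmetric] algebra_simps)
  finally have le: "(\<Sum>j\<in>J. p x j * (\<Sum>t\<in>T. \<Phi> t * exp (\<mu> * g t x j)))
      \<le> card T * exp (\<mu>\<^sup>2 * card (insert x E))" .
  have "\<exists>j\<in>J. (\<Sum>t\<in>T. \<Phi> t * exp (\<mu> * g t x j)) \<le> card T * exp (\<mu>\<^sup>2 * card (insert x E))"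
    by (rule weighted_pigeonhole[OF assms(3) _ _ le]) (use insert.prems(1,2) in auto)
  then obtain j where j: "j \<in> J"
    "(\<Sum>t\<in>T. \<Phi> t * exp (\<mu> * g t x j)) \<le> card T * exp (\<mu>\<^sup>2 * card (insert x E))"
    by blast
  have "(\<Sum>e\<in>insert x E. g t e ((U(x := j)) e)) = g t x j + (\<Sum>e\<in>E. g t e (U e))" for t
  proof -
    have "(\<Sum>e\<in>E. g t e ((U(x := j)) e)) = (\<Sum>e\<in>E. g t e (U e))"
      using insert.hyps by (intro sum.cong) auto
    thus ?thesis using insert.hyps by simp
  qed
  hence "(\<Sum>t\<in>T. exp (\<mu> * (\<Sum>e\<in>insert x E. g t e ((U(x := j)) e)))) = (\<Sum>t\<in>T. \<Phi> t * exp (\<mu> * g t x j))"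
    by (simp add: \<Phi>_def exp_add[symmetric] algebra_simps)
  with j U(1) show ?case by (intro exI[of _ "U(x := j)"]) auto
qed

text \<open>Each test is centred and used with both signs, the boolean being the sign, and the
  potential has parameter \<open>\<theta> / 2\<close>. The number \<open>2 * card T\<close> of terms
  and the growth of the potential contribute \<open>\<theta>\<^sup>2 / 4 * card E\<close> each to
  the exponent, which together allow a deviation of exactly
  \<open>\<theta> * card E\<close>.\<close>

lemma exists_typical_colouring:
  fixes g :: "'t \<Rightarrow> 'e \<Rightarrow> nat \<Rightarrow> real" and p :: "'e \<Rightarrow> nat \<Rightarrow> real" and \<theta> :: real
  assumes "finite E" "finite T" "finite J" "0 < \<theta>" "\<theta> \<le> 1"
    and p: "\<And>e j. e \<in> E \<Longrightarrow> j \<in> J \<Longrightarrow> p e j \<ge> 0" "\<And>e. e \<in> E \<Longrightarrow> (\<Sum>j\<in>J. p e j) = 1"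
    and g: "\<And>t e j. t \<in> T \<Longrightarrow> e \<in> E \<Longrightarrow> j \<in> J \<Longrightarrow> 0 \<le> g t e j \<and> g t e j \<le> 1"
    and few: "2 * card T \<le> exp (\<theta>\<^sup>2 / 4 * card E)"
  shows "\<exists>U. (\<forall>e\<in>E. U e \<in> J) \<and>
    (\<forall>t\<in>T. \<bar>(\<Sum>e\<in>E. g t e (U e)) - (\<Sum>e\<in>E. \<Sum>j\<in>J. p e j * g t e j)\<bar> \<le> \<theta> * card E)"
proof -
  define m where "m t e = (\<Sum>j\<in>J. p e j * g t e j)" for t e
  define h where "h s e j = (if snd s then 1 else -1) * (g (fst s) e j - m (fst s) e)" for s :: "'t \<times> bool" and e j
  have m: "0 \<le> m t e \<and> m t e \<le> 1" if "t \<in> T" "e \<in> E" for t e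
  proof
    show "0 \<le> m t e" unfolding m_def using p(1) g that by (intro sum_nonneg mult_nonneg_nonneg) auto
    have "m t e \<le> (\<Sum>j\<in>J. p e j * 1)"
      unfolding m_def using p(1) g that by (intro sum_mono mult_left_mono) auto
    thus "m t e \<le> 1" using p(2) that by simp
  qed
  have "\<exists>U. (\<forall>e\<in>E. U e \<in> J) \<and>
    (\<Sum>s\<in>T \<times> UNIV. exp (\<theta> / 2 * (\<Sum>e\<in>E. h s e (U e)))) \<le> card (T \<times> (UNIV :: bool set)) * exp ((\<theta> / 2)\<^sup>2 * card E)"
  proof (rule exists_low_potential[where p=p, OF assms(1) _ assms(3)])
    show "\<bar>h s e j\<bar> \<le> 1" if "s \<in> T \<times> UNIV" "e \<in> E" "j \<in> J" for s e j
      using m[of "fst s" e] g[of "fst s" e j] that by (auto simp: h_def)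
    show "(\<Sum>j\<in>J. p e j * h s e j) = 0" if "s \<in> T \<times> UNIV" "e \<in> E" for s e
    proof -
      have "(\<Sum>j\<in>J. p e j * (g (fst s) e j - m (fst s) e)) = m (fst s) e - (\<Sum>j\<in>J. p e j) * m (fst s) e"
        by (simp add: m_def[of "fst s"] right_diff_distrib sum_subtractf sum_distrib_right)
      hence "(\<Sum>j\<in>J. p e j * (g (fst s) e j - m (fst s) e)) = 0" using p(2) that by simp
      moreover have "(\<Sum>j\<in>J. p e j * h s e j)
          = (if snd s then 1 else -1) * (\<Sum>j\<in>J. p e j * (g (fst s) e j - m (fst s) e))"
        unfolding h_def sum_distrib_left by (intro sum.cong) auto
      ultimately show ?thesis by simp
    qed
  qed (use assms in auto)
  then obtain U where U: "\<forall>e\<in>E. U e \<in> J"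
    "(\<Sum>s\<in>T \<times> UNIV. exp (\<theta> / 2 * (\<Sum>e\<in>E. h s e (U e)))) \<le> card (T \<times> (UNIV :: bool set)) * exp ((\<theta> / 2)\<^sup>2 * card E)"
    by blast
  have bound: "(\<Sum>e\<in>E. h s e (U e)) \<le> \<theta> * card E" if s: "s \<in> T \<times> UNIV" for s
  proof -
    have "exp (\<theta> / 2 * (\<Sum>e\<in>E. h s e (U e))) \<le> (\<Sum>s\<in>T \<times> UNIV. exp (\<theta> / 2 * (\<Sum>e\<in>E. h s e (U e))))"
      using s assms(2) by (intro member_le_sum) auto
    also have "\<dots> \<le> (2 * card T) * exp ((\<theta> / 2)\<^sup>2 * card E)"
      using U(2) by (simp add: card_cartesian_product mult.commute)
    also have "\<dots> \<le> exp (\<theta>\<^sup>2 / 4 * card E) * exp ((\<theta> / 2)\<^sup>2 * card E)"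
      using few by (intro mult_right_mono) simp_all
    also have "\<dots> = exp (\<theta> / 2 * (\<theta> * card E))"
      by (simp add: exp_add[symmetric] power2_eq_square)
    finally show ?thesis using assms(4) by simp
  qed
  have "\<bar>(\<Sum>e\<in>E. g t e (U e)) - (\<Sum>e\<in>E. m t e)\<bar> \<le> \<theta> * card E" if t: "t \<in> T" for t
    using bound[of "(t, True)"] bound[of "(t, False)"] t
    by (simp add: h_def sum_subtractf abs_le_iff)
  with U(1) show ?thesis unfolding m_def by blast
qed

text \<open>Cut \<open>{1..l}\<close> at the points \<open>l * W a\<close>, with \<open>W\<close>
  the partial sums of \<open>w\<close>, and let \<open>A\<close> number the blocks. Taking floors,
  each block has \<open>l * w a\<close> elements up to an error of 1.\<close>

lemma exists_rounding:
  fixes w :: "nat \<Rightarrow> real" and c l :: nat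
  assumes "\<And>a. w a \<ge> 0" "(\<Sum>a<c. w a) = 1" "l \<ge> 1"
  shows "\<exists>A. (\<forall>j\<in>{1..l}. A j < c) \<and>
    (\<Sum>a<c. \<bar>real (card {j\<in>{1..l}. A j = a}) / l - w a\<bar>) \<le> c / l"
proof -
  define W where "W a = (\<Sum>b<a. w b)" for a
  have W_mono: "W a \<le> W b" if "a \<le> b" for a b
    unfolding W_def using that assms(1) by (intro sum_mono2) auto
  have W0: "W 0 = 0" and Wc: "W c = 1" by (simp_all add: W_def assms(2))
  define A where "A j = (LEAST a. real j \<le> l * W (Suc a))" for j :: nat
  have cpos: "c > 0" using assms(2) by (cases c) auto
  have ex: "real j \<le> l * W (Suc (c - 1))" if "j \<in> {1..l}" for j
    using that cpos Wc by simp
  have A: "A j < c" if "j \<in> {1..l}" for j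
    using Least_le[of "\<lambda>a. real j \<le> l * W (Suc a)", OF ex[OF that]] cpos by (simp add: A_def)
  have fib: "{j\<in>{1..l}. A j = a} = {nat \<lfloor>l * W a\<rfloor><..nat \<lfloor>l * W (Suc a)\<rfloor>}" if a: "a < c" for a
  proof -
    have iff: "A j = a \<longleftrightarrow> l * W a < real j \<and> real j \<le> l * W (Suc a)" if j: "j \<in> {1..l}" for j
    proof
      assume "A j = a"
      have 1: "real j \<le> l * W (Suc a)"
        using LeastI[of "\<lambda>a. real j \<le> l * W (Suc a)", OF ex[OF j]] \<open>A j = a\<close> by (simp add: A_def)
      have "l * W a < real j"
      proof (cases a)
        case 0
        thus ?thesis using j W0 by simp
      next
        case (Suc b)
        have "\<not> real j \<le> l * W (Suc b)"
          using \<open>A j = a\<close> Suc not_less_Least[of b "\<lambda>a. real j \<le> l * W (Suc a)"] by (simp add: A_def)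
        thus ?thesis using Suc by simp
      qed
      with 1 show "l * W a < real j \<and> real j \<le> l * W (Suc a)" by simp
    next
      assume h: "l * W a < real j \<and> real j \<le> l * W (Suc a)"
      show "A j = a" unfolding A_def
      proof (rule Least_equality)
        show "real j \<le> l * W (Suc a)" using h by simp
        fix b assume b: "real j \<le> l * W (Suc b)"
        show "a \<le> b"
        proof (rule ccontr)
          assume "\<not> a \<le> b"
          hence "l * W (Suc b) \<le> l * W a" by (intro mult_left_mono W_mono) auto
          thus False using h b by simp
        qed
      qed
    qed
    have nn: "0 \<le> l * W a" using W_mono[of 0 a] W0 by simp
    have le: "l * W (Suc a) \<le> l" using W_mono[of "Suc a" c] Wc a by (simp add: mult_left_le)
    have "l * W a < real j \<longleftrightarrow> nat \<lfloor>l * W a\<rfloor> < j" for j using nn by linarith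
    moreover have "real j \<le> l * W (Suc a) \<longleftrightarrow> j \<le> nat \<lfloor>l * W (Suc a)\<rfloor>" for j
      using W_mono[of 0 "Suc a"] W0 by (simp add: le_nat_floor le_floor_iff le_nat_iff) 
    moreover have "1 \<le> j \<and> j \<le> l" if "nat \<lfloor>l * W a\<rfloor> < j" "j \<le> nat \<lfloor>l * W (Suc a)\<rfloor>" for j
      using that le by linarith
    ultimately show ?thesis using iff by (auto simp: set_eq_iff)
  qed
  have "\<bar>real (card {j\<in>{1..l}. A j = a}) / l - w a\<bar> \<le> 1 / l" if a: "a \<in> {..<c}" for a
  proof -
    have nn: "0 \<le> l * W a" using W_mono[of 0 a] W0 by simp
    have le: "l * W a \<le> l * W (Suc a)" by (intro mult_left_mono W_mono) auto
    have "card {j\<in>{1..l}. A j = a} = nat \<lfloor>l * W (Suc a)\<rfloor> - nat \<lfloor>l * W a\<rfloor>"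
      using fib a by simp
    hence "real (card {j\<in>{1..l}. A j = a}) = of_int \<lfloor>l * W (Suc a)\<rfloor> - of_int \<lfloor>l * W a\<rfloor>"
      using nn le by (simp add: of_nat_diff nat_mono floor_mono)
    moreover have "l * w a = l * W (Suc a) - l * W a" by (simp add: W_def algebra_simps)
    ultimately have "\<bar>real (card {j\<in>{1..l}. A j = a}) - l * w a\<bar> \<le> 1" by linarith
    thus ?thesis using assms(3) by (simp add: field_simps abs_le_iff)
  qed
  hence "(\<Sum>a<c. \<bar>real (card {j\<in>{1..l}. A j = a}) / l - w a\<bar>) \<le> (\<Sum>a<c. 1 / l)" by (rule sum_mono)
  hence "(\<Sum>a<c. \<bar>real (card {j\<in>{1..l}. A j = a}) / l - w a\<bar>) \<le> c / l" by simp
  with A show ?thesis by blast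
qed

text \<open>A maximal coupling of \<open>w\<close> with the uniform distribution: the common mass
  \<open>m a\<close> is spread evenly over the \<open>j\<close> with \<open>A j = a\<close>, and the
  excess of \<open>w\<close> is coupled independently with the excess \<open>u\<close> of the
  uniform distribution. Only the excess can violate \<open>A j = a\<close>.\<close>

lemma exists_coupling:
  fixes w :: "nat \<Rightarrow> real" and A :: "nat \<Rightarrow> nat" and c l :: nat
  assumes w: "\<And>a. w a \<ge> 0" "(\<Sum>a<c. w a) = 1" and l: "l \<ge> 1" and A: "\<forall>j\<in>{1..l}. A j < c"
  shows "\<exists>p. (\<forall>a j. p a j \<ge> 0) \<and> (\<forall>a<c. (\<Sum>j\<in>{1..l}. p a j) = w a) \<and>
    (\<forall>j\<in>{1..l}. (\<Sum>a<c. p a j) = 1 / real l) \<and>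
    (\<Sum>a<c. \<Sum>j\<in>{j\<in>{1..l}. A j \<noteq> a}. p a j)
      \<le> (\<Sum>a<c. \<bar>real (card {j\<in>{1..l}. A j = a}) / l - w a\<bar>)"
proof -
  define n where "n a = card {j\<in>{1..l}. A j = a}" for a
  define v where "v a = real (n a) / l" for a
  define m where "m a = min (v a) (w a)" for a
  \<comment> \<open>The mass of the excess on either side. If it is 0, all excesses vanish, so the
    division by \<rho> in \<open>p\<close> does no harm.\<close>
  define \<rho> where "\<rho> = (\<Sum>a<c. w a - m a)"
  define u where "u j = 1 / l - m (A j) / n (A j)" for j
  define p where "p a j = (if j \<in> {1..l} then of_bool (A j = a) * (m a / n a) + (w a - m a) * u j / \<rho> else 0)" for a j
  have sum_A: "(\<Sum>j\<in>{1..l}. f (A j)) = (\<Sum>a<c. n a * f a)" for f :: "nat \<Rightarrow> real"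
  proof -
    have "(\<Sum>j\<in>{1..l}. f (A j)) = (\<Sum>a<c. \<Sum>j\<in>{j\<in>{1..l}. A j = a}. f (A j))"
      using A by (intro sum.group[symmetric]) auto
    thus ?thesis by (simp add: n_def)
  qed
  have npos: "n (A j) > 0" if "j \<in> {1..l}" for j using that by (auto simp: n_def card_gt_0_iff)
  have v_sum: "(\<Sum>a<c. v a) = 1"
    using sum_A[of "\<lambda>_. 1 / l"] l by (simp add: v_def)
  have m: "0 \<le> m a" "m a \<le> w a" "m a \<le> v a" for a using w(1) by (simp_all add: m_def v_def)
  have u: "u j \<ge> 0" if "j \<in> {1..l}" for j
    using m(3)[of "A j"] npos[OF that] l by (simp add: u_def v_def field_simps)
  have nm: "n a * (m a / n a) = m a" for a
    using m[of a] by (cases "n a = 0") (auto simp: v_def)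
  have u_sum: "(\<Sum>j\<in>{1..l}. u j) = \<rho>"
  proof -
    have "(\<Sum>j\<in>{1..l}. u j) = (\<Sum>a<c. n a * (1 / l - m a / n a))"
      unfolding u_def by (rule sum_A)
    also have "\<dots> = (\<Sum>a<c. v a - m a)"
      using nm by (intro sum.cong refl) (simp add: v_def right_diff_distrib)
    also have "\<dots> = \<rho>" using v_sum w(2) by (simp add: \<rho>_def sum_subtractf)
    finally show ?thesis .
  qed
  have rho0: "w a - m a = 0" if "\<rho> = 0" "a < c" for a
  proof -
    have "\<forall>a\<in>{..<c}. w a - m a = 0"
      using that(1) m(2) unfolding \<rho>_def by (subst (asm) sum_nonneg_eq_0_iff) auto
    thus ?thesis using that(2) by simp
  qed
  have u0: "u j = 0" if "\<rho> = 0" "j \<in> {1..l}" for j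
    using sum_nonneg_eq_0_iff[of "{1..l}" u] u u_sum that by simp
  have \<rho>_nn: "\<rho> \<ge> 0" unfolding \<rho>_def using m(2) by (intro sum_nonneg) simp
  have "p a j \<ge> 0" for a j
    using m(1)[of a] m(2)[of a] u[of j] \<rho>_nn by (simp add: p_def)
  moreover have "(\<Sum>j\<in>{1..l}. p a j) = w a" if a: "a < c" for a
  proof -
    have "(\<Sum>j\<in>{1..l}. p a j) = (\<Sum>j\<in>{1..l}. of_bool (A j = a) * (m a / n a)) + (w a - m a) * (\<Sum>j\<in>{1..l}. u j) / \<rho>"
      by (simp add: p_def sum.distrib sum_distrib_left sum_divide_distrib)
    also have "(\<Sum>j\<in>{1..l}. of_bool (A j = a) * (m a / n a)) = n a * (m a / n a)"
      unfolding sum_distrib_right[symmetric] by (simp add: n_def Int_def)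
    also have "n a * (m a / n a) + (w a - m a) * (\<Sum>j\<in>{1..l}. u j) / \<rho> = w a"
      unfolding nm u_sum using rho0[OF _ a] by (cases "\<rho> = 0") auto
    finally show ?thesis .
  qed
  moreover have "(\<Sum>a<c. p a j) = 1 / l" if j: "j \<in> {1..l}" for j
  proof -
    have "(\<Sum>a<c. p a j) = (\<Sum>a<c. of_bool (A j = a) * (m a / n a)) + \<rho> * u j / \<rho>"
      using j by (simp add: p_def sum.distrib \<rho>_def sum_distrib_right sum_divide_distrib)
    also have "(\<Sum>a<c. of_bool (A j = a) * (m a / n a)) = (\<Sum>a<c. if A j = a then m a / n a else 0)"
      by (intro sum.cong) auto
    also have "\<dots> = m (A j) / n (A j)" using A j by (subst sum.delta') auto
    also have "m (A j) / n (A j) + \<rho> * u j / \<rho> = 1 / l"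
      using u0[OF _ j] by (cases "\<rho> = 0") (auto simp: u_def)
    finally show ?thesis .
  qed
  moreover have "(\<Sum>a<c. \<Sum>j\<in>{j\<in>{1..l}. A j \<noteq> a}. p a j) \<le> (\<Sum>a<c. \<bar>v a - w a\<bar>)"
  proof (rule sum_mono)
    fix a assume a: "a \<in> {..<c}"
    have "(\<Sum>j\<in>{j\<in>{1..l}. A j \<noteq> a}. p a j) = (\<Sum>j\<in>{j\<in>{1..l}. A j \<noteq> a}. (w a - m a) / \<rho> * u j)"
      by (intro sum.cong) (auto simp: p_def)
    also have "\<dots> \<le> (\<Sum>j\<in>{1..l}. (w a - m a) / \<rho> * u j)"
      using m(2)[of a] u \<rho>_nn by (intro sum_mono2) auto
    also have "\<dots> = (w a - m a) / \<rho> * \<rho>" unfolding sum_distrib_left[symmetric] u_sum ..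
    also have "\<dots> = w a - m a" using rho0 a by (cases "\<rho> = 0") auto
    also have "\<dots> \<le> \<bar>v a - w a\<bar>" by (simp add: m_def)
    finally show "(\<Sum>j\<in>{j\<in>{1..l}. A j \<noteq> a}. p a j) \<le> \<bar>v a - w a\<bar>" .
  qed
  ultimately show ?thesis unfolding v_def n_def by blast
qed

text \<open>Cauchy-Schwarz over the \<open>c * card E\<close> pairs of an edge and a colour.\<close>

lemma l1_distance_of_means:
  fixes w w' :: "nat \<Rightarrow> 'e \<Rightarrow> real" and \<kappa> :: real
  assumes "finite E" "\<kappa> \<ge> 0" "(\<Sum>e\<in>E. \<Sum>a<c. (w' a e - w a e)\<^sup>2) \<le> \<kappa> * card E"
  shows "(\<Sum>e\<in>E. \<Sum>a<c. \<bar>w' a e - w a e\<bar>) \<le> sqrt (c * \<kappa>) * card E"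
proof (rule power2_le_imp_le)
  have "(\<Sum>e\<in>E. \<Sum>a<c. \<bar>w' a e - w a e\<bar>)\<^sup>2
      = (\<Sum>(e, a)\<in>E \<times> {..<c}. \<bar>w' a e - w a e\<bar> * 1)\<^sup>2"
    by (simp add: sum.cartesian_product)
  also have "\<dots> = (\<Sum>z\<in>E \<times> {..<c}. \<bar>w' (snd z) (fst z) - w (snd z) (fst z)\<bar> * 1)\<^sup>2"
    by (simp add: case_prod_unfold)
  also have "\<dots> \<le> (\<Sum>z\<in>E \<times> {..<c}. \<bar>w' (snd z) (fst z) - w (snd z) (fst z)\<bar>\<^sup>2) * (\<Sum>z\<in>E \<times> {..<c}. 1\<^sup>2)"
    by (rule Cauchy_Schwarz_ineq_sum)
  also have "(\<Sum>z\<in>E \<times> {..<c}. \<bar>w' (snd z) (fst z) - w (snd z) (fst z)\<bar>\<^sup>2)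
      = (\<Sum>e\<in>E. \<Sum>a<c. (w' a e - w a e)\<^sup>2)"
    by (simp add: sum.cartesian_product case_prod_unfold)
  also have "(\<Sum>e\<in>E. \<Sum>a<c. (w' a e - w a e)\<^sup>2) * (\<Sum>z\<in>E \<times> {..<c}. 1\<^sup>2)
      \<le> (\<kappa> * card E) * (\<Sum>z\<in>E \<times> {..<c}. 1\<^sup>2 :: real)"
    by (rule mult_right_mono[OF assms(3)]) simp
  also have "\<dots> = (sqrt (c * \<kappa>) * card E)\<^sup>2"
    using assms(2) by (simp add: card_cartesian_product power_mult_distrib power2_eq_square)
  finally show "(\<Sum>e\<in>E. \<Sum>a<c. \<bar>w' a e - w a e\<bar>)\<^sup>2 \<le> (sqrt (c * \<kappa>) * card E)\<^sup>2" .
  show "0 \<le> sqrt (c * \<kappa>) * card E" using assms(2) by simp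
qed

text \<open>Given the colour \<open>a\<close> of an edge, its new colour \<open>j\<close> is drawn with probability
  \<open>p a j / w' a\<close>, where \<open>p\<close> couples the fine colour means \<open>w'\<close> with the uniform distribution.
  The new colour is then uniform relative to all cylinder intersections, while the coarse colour
  means already suffice to recover \<open>a\<close> from \<open>j\<close> for most edges.\<close>

lemma exists_uniform_level:
  fixes X :: "'a set" and q Q1 Q' :: "'a set \<Rightarrow> nat" and \<theta> \<kappa> :: real and c l r :: nat
  defines "E \<equiv> ksets (Suc r) X"
  assumes X: "finite X" and q: "\<forall>e\<in>E. q e < c"
    and ref: "refines r X Q' Q1" and reg: "weak_regular (Suc r) X q c Q' (\<theta> / c)"
    and en: "facet_energy (Suc r) X q c Q' \<le> facet_energy (Suc r) X q c Q1 + \<kappa> * card E"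
    and "0 < \<theta>" "\<theta> \<le> 1" "0 \<le> \<kappa>" "c \<ge> 1" "l \<ge> 1"
    and few: "2 * (real l * 2 ^ (Suc r * (card X choose r)) + 1) \<le> exp (\<theta>\<^sup>2 / 4 * card E)"
  shows "\<exists>A U. (\<forall>e\<in>E. U e \<in> {1..l}) \<and>
    (\<forall>j\<in>{1..l}. \<forall>B. \<bar>real (card {e\<in>cyl (Suc r) X B. U e = j}) - card (cyl (Suc r) X B) / l\<bar>
      \<le> 2 * \<theta> * card E) \<and>
    card {e\<in>E. A (facet_colours Q1 e) (U e) \<noteq> q e} \<le> (c / l + sqrt (c * \<kappa>) + \<theta>) * card E"
proof -
  define M where "M = facet_colours Q1"
  define M' where "M' = facet_colours Q'"
  obtain \<rho>0 where \<rho>0: "\<forall>s\<in>ksets r X. Q1 s = \<rho>0 (Q' s)" using ref by (auto simp: refines_def)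
  define \<rho> where "\<rho> = image_mset \<rho>0"
  have M: "M e = \<rho> (M' e)" if "e \<in> E" for e
    using facet_colours_comp[OF X, of e r Q1 \<rho>0 Q'] \<rho>0 that by (simp add: M_def M'_def \<rho>_def E_def)
  have finE: "finite E" using X by (simp add: E_def)
  define w where "w a m = colour_mean E M q a m" for a m
  define w' where "w' a m = colour_mean E M' q a m" for a m
  have w_nn: "w a m \<ge> 0" "w' a m' \<ge> 0" for a m m' by (simp_all add: w_def w'_def colour_mean_nonneg)
  have w_sum: "(\<Sum>a<c. w a (M e)) = 1" "(\<Sum>a<c. w' a (M' e)) = 1" if "e \<in> E" for e
    unfolding w_def w'_def using finE q that by (intro sum_colour_mean; blast)+
  \<comment> \<open>The rounding is made once per coarse multiset, so that reading off the old
    colour will not involve the fine colouring.\<close>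
  define round_ok where "round_ok A m \<longleftrightarrow> (\<forall>j\<in>{1..l}. A j < c) \<and>
    (\<Sum>a<c. \<bar>real (card {j\<in>{1..l}. A j = a}) / l - w a m\<bar>) \<le> c / l" for A m
  have "\<exists>A. round_ok A (M e)" if "e \<in> E" for e
    unfolding round_ok_def by (rule exists_rounding[OF w_nn(1) w_sum(1)[OF that] \<open>l \<ge> 1\<close>])
  hence "\<forall>m. \<exists>A. m \<in> M ` E \<longrightarrow> round_ok A m" by blast
  from choice[OF this] obtain A where "\<forall>m. m \<in> M ` E \<longrightarrow> round_ok (A m) m" by blast
  hence A: "round_ok (A (M e)) (M e)" if "e \<in> E" for e using that by blast
  define v where "v a m = real (card {j\<in>{1..l}. A m j = a}) / l" for a m
  define cpl where "cpl p m' \<longleftrightarrow> (\<forall>a j. p a j \<ge> 0) \<and> (\<forall>a<c. (\<Sum>j\<in>{1..l}. p a j) = w' a m') \<and>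
    (\<forall>j\<in>{1..l}. (\<Sum>a<c. p a j) = 1 / real l) \<and>
    (\<Sum>a<c. \<Sum>j\<in>{j\<in>{1..l}. A (\<rho> m') j \<noteq> a}. p a j) \<le> (\<Sum>a<c. \<bar>v a (\<rho> m') - w' a m'\<bar>)" for p m'
  have "\<exists>p. cpl p (M' e)" if e: "e \<in> E" for e
  proof -
    have "\<forall>j\<in>{1..l}. A (\<rho> (M' e)) j < c" using A[OF e] M[OF e] by (simp add: round_ok_def)
    thus ?thesis unfolding cpl_def v_def
      by (rule exists_coupling[OF w_nn(2) w_sum(2)[OF e] \<open>l \<ge> 1\<close>])
  qed
  hence "\<forall>m'. \<exists>p. m' \<in> M' ` E \<longrightarrow> cpl p m'" by blast
  from choice[OF this] obtain p where "\<forall>m'. m' \<in> M' ` E \<longrightarrow> cpl (p m') m'" by blast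
  hence p: "cpl (p (M' e)) (M' e)" if "e \<in> E" for e using that by blast
  \<comment> \<open>The conditional probability of the new colour \<open>j\<close> given the old
    colour \<open>a\<close>. Where \<open>w'\<close> is 0 so is \<open>p\<close>, and old colours
    that occur have positive frequency, so division by 0 loses nothing.\<close>
  define \<phi> where "\<phi> a j m' = p m' a j / w' a m'" for a j m'
  have p_nn: "p (M' e) a j \<ge> 0" if "e \<in> E" for e a j using p[OF that] by (simp add: cpl_def)
  have p_le: "p (M' e) a j \<le> w' a (M' e)" if "e \<in> E" "a < c" "j \<in> {1..l}" for e a j
  proof -
    have "p (M' e) a j \<le> (\<Sum>j\<in>{1..l}. p (M' e) a j)"
      using that p_nn by (intro member_le_sum) auto
    thus ?thesis using p[OF that(1)] that(2) by (simp add: cpl_def)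
  qed
  have \<phi>_01: "0 \<le> \<phi> a j (M' e)" "\<phi> a j (M' e) \<le> 1" if "e \<in> E" "a < c" "j \<in> {1..l}" for e a j
    using p_nn[OF that(1)] p_le[OF that] w_nn(2)[of a "M' e"]
    by (auto simp: \<phi>_def divide_le_eq_1)
  have w\<phi>: "w' a (M' e) * \<phi> a j (M' e) = p (M' e) a j" if "e \<in> E" "a < c" "j \<in> {1..l}" for e a j
    using p_nn[OF that(1), of a j] p_le[OF that] by (cases "w' a (M' e) = 0") (auto simp: \<phi>_def)
  define pr where "pr e j = \<phi> (q e) j (M' e)" for e j
  have qc: "q e < c" if "e \<in> E" for e using q that by blast
  have ind: "pr e j = (\<Sum>a<c. of_bool (q e = a) * \<phi> a j (M' e))" if "e \<in> E" for e j
  proof -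
    have "(\<Sum>a<c. of_bool (q e = a) * \<phi> a j (M' e)) = (\<Sum>a<c. if q e = a then \<phi> a j (M' e) else 0)"
      by (intro sum.cong) auto
    thus ?thesis using qc[OF that] by (simp add: pr_def)
  qed
  \<comment> \<open>One test for each cylinder and new colour; \<open>None\<close> tests how many
    old colours are not recovered and accounts for the \<open>+ 1\<close> in
    \<open>few\<close>.\<close>
  define T where "T = insert None (Some ` (range (cyl (Suc r) X) \<times> {1..l}))"
  define g :: "('a set set \<times> nat) option \<Rightarrow> 'a set \<Rightarrow> nat \<Rightarrow> real" where
    "g t e j = (case t of None \<Rightarrow> of_bool (A (M e) j \<noteq> q e) | Some (L, i) \<Rightarrow> of_bool (e \<in> L \<and> j = i))" for t e j
  have finT: "finite T" using card_range_cyl(1)[OF X] by (simp add: T_def)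
  have "card T = 1 + card (range (cyl (Suc r) X) \<times> {1..l})"
    unfolding T_def using card_range_cyl(1)[OF X, of "Suc r"]
    by (subst card_insert_disjoint) (auto simp: card_image)
  also have "\<dots> \<le> 1 + 2 ^ (Suc r * (card X choose r)) * l"
    using card_range_cyl(2)[OF X, of "Suc r"] by (simp only: card_cartesian_product diff_Suc_1) simp
  finally have "real (card T) \<le> real (1 + 2 ^ (Suc r * (card X choose r)) * l)" by (rule of_nat_mono)
  hence cardT: "2 * card T \<le> exp (\<theta>\<^sup>2 / 4 * card E)" using few by (simp add: mult.commute)
  have "\<exists>U. (\<forall>e\<in>E. U e \<in> {1..l}) \<and>
    (\<forall>t\<in>T. \<bar>(\<Sum>e\<in>E. g t e (U e)) - (\<Sum>e\<in>E. \<Sum>j\<in>{1..l}. pr e j * g t e j)\<bar> \<le> \<theta> * card E)"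
  proof (rule exists_typical_colouring[OF finE finT _ \<open>0 < \<theta>\<close> \<open>\<theta> \<le> 1\<close> _ _ _ cardT])
    show "pr e j \<ge> 0" if "e \<in> E" "j \<in> {1..l}" for e j
      using \<phi>_01(1)[OF that(1) qc[OF that(1)] that(2)] by (simp add: pr_def)
    show "(\<Sum>j\<in>{1..l}. pr e j) = 1" if e: "e \<in> E" for e
    proof -
      have "w' (q e) (M' e) > 0" unfolding w'_def by (rule colour_mean_pos[OF finE e])
      moreover have "(\<Sum>j\<in>{1..l}. pr e j) = (\<Sum>j\<in>{1..l}. p (M' e) (q e) j) / w' (q e) (M' e)"
        by (simp add: pr_def \<phi>_def sum_divide_distrib)
      ultimately show ?thesis using p[OF e] qc[OF e] by (simp add: cpl_def)
    qed
    show "0 \<le> g t e j \<and> g t e j \<le> 1" for t e j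
      by (auto simp: g_def split: option.split)
  qed simp
  then obtain U where U: "\<forall>e\<in>E. U e \<in> {1..l}"
    "\<And>t. t \<in> T \<Longrightarrow> \<bar>(\<Sum>e\<in>E. g t e (U e)) - (\<Sum>e\<in>E. \<Sum>j\<in>{1..l}. pr e j * g t e j)\<bar> \<le> \<theta> * card E"
    by blast
  have "\<bar>real (card {e\<in>cyl (Suc r) X B. U e = j}) - card (cyl (Suc r) X B) / l\<bar> \<le> 2 * \<theta> * card E"
    if j: "j \<in> {1..l}" for j B
  proof -
    define L where "L = cyl (Suc r) X B"
    have LE: "L \<subseteq> E" using cyl_subset by (auto simp: L_def E_def)
    have t: "Some (L, j) \<in> T" using j by (auto simp: T_def L_def)
    have "(\<Sum>e\<in>E. g (Some (L, j)) e (U e)) = card (E \<inter> {e. e \<in> L \<and> U e = j})"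
      using finE by (simp add: g_def)
    moreover have "E \<inter> {e. e \<in> L \<and> U e = j} = {e\<in>L. U e = j}" using LE by auto
    ultimately have 1: "(\<Sum>e\<in>E. g (Some (L, j)) e (U e)) = card {e\<in>L. U e = j}" by simp
    have "(\<Sum>e\<in>E. \<Sum>i\<in>{1..l}. pr e i * g (Some (L, j)) e i) = (\<Sum>e\<in>E. if e \<in> L then pr e j else 0)"
    proof (rule sum.cong[OF refl])
      fix e
      have "(\<Sum>i\<in>{1..l}. pr e i * g (Some (L, j)) e i) = (\<Sum>i\<in>{1..l}. if i = j then (if e \<in> L then pr e j else 0) else 0)"
        by (intro sum.cong) (auto simp: g_def)
      thus "(\<Sum>i\<in>{1..l}. pr e i * g (Some (L, j)) e i) = (if e \<in> L then pr e j else 0)"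
        using j by simp
    qed
    also have "\<dots> = (\<Sum>e\<in>L. pr e j)"
      using LE finE by (simp add: sum.inter_restrict[symmetric] Int_absorb1)
    finally have 2: "(\<Sum>e\<in>E. \<Sum>i\<in>{1..l}. pr e i * g (Some (L, j)) e i) = (\<Sum>e\<in>L. pr e j)" .
    \<comment> \<open>The uniform marginal of the coupling produces \<open>1 / l\<close>. What
      remains is the centred old colouring against \<phi>: one weak regularity test of error
      \<open>\<theta> / c\<close> for each \<open>a\<close>. The random choice adds another
      \<theta>, which gives \<open>2 * \<theta>\<close>.\<close>
    have "(\<Sum>e\<in>L. pr e j) - card L / l
        = (\<Sum>e\<in>L. \<Sum>a<c. (of_bool (q e = a) - w' a (M' e)) * \<phi> a j (M' e))"
    proof -
      have "pr e j - 1 / l = (\<Sum>a<c. (of_bool (q e = a) - w' a (M' e)) * \<phi> a j (M' e))" if "e \<in> L" for e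
      proof -
        have e: "e \<in> E" using that LE by blast
        have "(\<Sum>a<c. w' a (M' e) * \<phi> a j (M' e)) = (\<Sum>a<c. p (M' e) a j)"
          using w\<phi>[OF e _ j] by (intro sum.cong) auto
        also have "\<dots> = 1 / l" using p[OF e] j by (simp add: cpl_def)
        finally show ?thesis using ind[OF e, of j] by (simp add: left_diff_distrib sum_subtractf)
      qed
      hence "(\<Sum>e\<in>L. pr e j - 1 / l)
          = (\<Sum>e\<in>L. \<Sum>a<c. (of_bool (q e = a) - w' a (M' e)) * \<phi> a j (M' e))"
        by (rule sum.cong[OF refl])
      thus ?thesis by (simp add: sum_subtractf)
    qed
    also have "\<dots> = (\<Sum>a<c. \<Sum>e\<in>L. (of_bool (q e = a) - w' a (M' e)) * \<phi> a j (M' e))"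
      by (rule sum.swap)
    finally have "\<bar>(\<Sum>e\<in>L. pr e j) - card L / l\<bar>
        = \<bar>\<Sum>a<c. \<Sum>e\<in>L. (of_bool (q e = a) - w' a (M' e)) * \<phi> a j (M' e)\<bar>" by simp
    also have "\<dots> \<le> (\<Sum>a<c. \<bar>\<Sum>e\<in>L. (of_bool (q e = a) - w' a (M' e)) * \<phi> a j (M' e)\<bar>)"
      by (rule sum_abs)
    also have "\<dots> \<le> (\<Sum>a<c. \<theta> / c * card E)"
    proof (rule sum_mono)
      fix a assume a: "a \<in> {..<c}"
      have "\<forall>e\<in>ksets (Suc r) X. \<bar>\<phi> a j (facet_colours Q' e)\<bar> \<le> 1"
        using \<phi>_01 a j by (fold M'_def E_def) (simp add: abs_le_iff)
      thus "\<bar>\<Sum>e\<in>L. (of_bool (q e = a) - w' a (M' e)) * \<phi> a j (M' e)\<bar> \<le> \<theta> / c * card E"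
        using reg a unfolding weak_regular_def by (simp add: w'_def M'_def E_def L_def)
    qed
    also have "\<dots> = \<theta> * card E" using \<open>c \<ge> 1\<close> by simp
    finally have "\<bar>real (card {e\<in>L. U e = j}) - card L / l\<bar> \<le> 2 * \<theta> * card E"
      using U(2)[OF t] unfolding 1 2 by linarith
    thus ?thesis unfolding L_def .
  qed
  moreover have "card {e\<in>E. A (M e) (U e) \<noteq> q e} \<le> (c / l + sqrt (c * \<kappa>) + \<theta>) * card E"
  proof -
    define \<psi> where "\<psi> a m' = (\<Sum>j\<in>{j\<in>{1..l}. A (\<rho> m') j \<noteq> a}. \<phi> a j m')" for a m'
    have "(\<Sum>e\<in>E. g None e (U e)) = card (E \<inter> {e. A (M e) (U e) \<noteq> q e})"
      using finE by (simp add: g_def)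
    hence 1: "(\<Sum>e\<in>E. g None e (U e)) = card {e\<in>E. A (M e) (U e) \<noteq> q e}" by (simp add: Int_def)
    have "(\<Sum>e\<in>E. \<Sum>j\<in>{1..l}. pr e j * g None e j) = (\<Sum>e\<in>E. \<Sum>a<c. of_bool (q e = a) * \<psi> a (M' e))"
    proof (rule sum.cong[OF refl])
      fix e assume e: "e \<in> E"
      have "(\<Sum>a<c. of_bool (q e = a) * \<psi> a (M' e)) = (\<Sum>a<c. if q e = a then \<psi> a (M' e) else 0)"
        by (intro sum.cong) auto
      also have "\<dots> = \<psi> (q e) (M' e)" using qc[OF e] by simp
      also have "\<dots> = (\<Sum>j\<in>{1..l}. if A (\<rho> (M' e)) j \<noteq> q e then pr e j else 0)"
        unfolding \<psi>_def pr_def by (rule sum.inter_filter) simp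
      also have "\<dots> = (\<Sum>j\<in>{1..l}. pr e j * g None e j)"
        using M[OF e] by (intro sum.cong) (auto simp: g_def)
      finally show "(\<Sum>j\<in>{1..l}. pr e j * g None e j) = (\<Sum>a<c. of_bool (q e = a) * \<psi> a (M' e))" ..
    qed
    also have "\<dots> = (\<Sum>a<c. \<Sum>e\<in>E. of_bool (q e = a) * \<psi> a (M' e))" by (rule sum.swap)
    \<comment> \<open>As \<psi> is a function of the fine multiset, the indicator of the old colour
      may be replaced by its fine frequency.\<close>
    also have "\<dots> = (\<Sum>a<c. \<Sum>e\<in>E. w' a (M' e) * \<psi> a (M' e))"
      unfolding w'_def colour_mean_def by (intro sum.cong refl fibre_mean_sum_mult[symmetric] finE)
    also have "\<dots> = (\<Sum>e\<in>E. \<Sum>a<c. w' a (M' e) * \<psi> a (M' e))" by (rule sum.swap)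
    also have "\<dots> \<le> (\<Sum>e\<in>E. c / l + (\<Sum>a<c. \<bar>w' a (M' e) - w a (M e)\<bar>))"
    proof (rule sum_mono)
      fix e assume e: "e \<in> E"
      have "(\<Sum>a<c. w' a (M' e) * \<psi> a (M' e)) = (\<Sum>a<c. \<Sum>j\<in>{j\<in>{1..l}. A (\<rho> (M' e)) j \<noteq> a}. p (M' e) a j)"
        unfolding \<psi>_def sum_distrib_left using w\<phi>[OF e] by (intro sum.cong refl) auto
      also have "\<dots> \<le> (\<Sum>a<c. \<bar>v a (\<rho> (M' e)) - w' a (M' e)\<bar>)" using p[OF e] by (simp add: cpl_def)
      also have "\<dots> \<le> (\<Sum>a<c. \<bar>v a (M e) - w a (M e)\<bar> + \<bar>w' a (M' e) - w a (M e)\<bar>)"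
        unfolding M[OF e, symmetric] by (intro sum_mono) linarith
      also have "\<dots> = (\<Sum>a<c. \<bar>v a (M e) - w a (M e)\<bar>) + (\<Sum>a<c. \<bar>w' a (M' e) - w a (M e)\<bar>)"
        by (rule sum.distrib)
      also have "(\<Sum>a<c. \<bar>v a (M e) - w a (M e)\<bar>) \<le> c / l"
        using A[OF e] by (simp add: round_ok_def v_def)
      finally show "(\<Sum>a<c. w' a (M' e) * \<psi> a (M' e)) \<le> c / l + (\<Sum>a<c. \<bar>w' a (M' e) - w a (M e)\<bar>)" by simp
    qed
    also have "\<dots> = c / l * card E + (\<Sum>e\<in>E. \<Sum>a<c. \<bar>w' a (M' e) - w a (M e)\<bar>)"
      by (simp add: sum.distrib)
    also have "(\<Sum>e\<in>E. \<Sum>a<c. \<bar>w' a (M' e) - w a (M e)\<bar>) \<le> sqrt (c * \<kappa>) * card E"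
    proof (rule l1_distance_of_means[where w'="\<lambda>a e. w' a (M' e)" and w="\<lambda>a e. w a (M e)", OF finE \<open>0 \<le> \<kappa>\<close>])
      show "(\<Sum>e\<in>E. \<Sum>a<c. (w' a (M' e) - w a (M e))\<^sup>2) \<le> \<kappa> * card E"
        unfolding w_def w'_def using energy_diff[where M=M and M'=M' and \<rho>=\<rho> and c=c and q=q, OF finE M] en
        by (simp add: M_def M'_def E_def)
    qed
    finally have "(\<Sum>e\<in>E. \<Sum>j\<in>{1..l}. pr e j * g None e j) \<le> c / l * card E + sqrt (c * \<kappa>) * card E" by simp
    moreover have "None \<in> T" by (simp add: T_def)
    ultimately show ?thesis using U(2)[of None] unfolding 1 by (simp add: algebra_simps)
  qed
  ultimately show ?thesis using U(1) unfolding M_def by blast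
qed

subsection \<open>Induction on the uniformity\<close>

text \<open>The target density is \<open>1 / l\<close> itself, so regularity and equal class sizes
  become one condition. The error is relative to all \<open>s\<close>-sets, so small cylinders need
  no exception.\<close>

definition level_regular :: "nat \<Rightarrow> 'a set \<Rightarrow> nat \<Rightarrow> real \<Rightarrow> ('a set \<Rightarrow> nat) \<Rightarrow> bool" where
  "level_regular s X l \<delta> col \<longleftrightarrow>
     (\<forall>j\<in>{1..l}. \<forall>B. \<bar>real (card {e\<in>cyl s X B. col e = j}) - real (card (cyl s X B)) / real l\<bar>
       \<le> \<delta> * real (card (ksets s X)))"

text \<open>The unordered counterpart of a union of cells: \<open>q\<close> sees an edge only
  through the isomorphism type of the colouring of its nonempty subsets.\<close>

definition isomorphism_invariant ::
    "nat \<Rightarrow> 'a set \<Rightarrow> ('a set \<Rightarrow> nat) \<Rightarrow> ('a set \<Rightarrow> nat) \<Rightarrow> bool" where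
  "isomorphism_invariant r X col q \<longleftrightarrow>
     (\<forall>e\<in>ksets r X. \<forall>e'\<in>ksets r X. \<forall>\<beta>. bij_betw \<beta> e e' \<longrightarrow>
        (\<forall>s\<subseteq>e. s \<noteq> {} \<longrightarrow> col (\<beta> ` s) = col s) \<longrightarrow> q e = q e')"

definition approximable ::
    "nat \<Rightarrow> 'a set \<Rightarrow> ('a set \<Rightarrow> nat) \<Rightarrow> nat \<Rightarrow> real \<Rightarrow> real \<Rightarrow> bool" where
  "approximable r X q l \<delta> \<epsilon> \<longleftrightarrow> (\<exists>col q'. (\<forall>s. col s \<in> {1..l}) \<and>
     (\<forall>s\<in>{1..r}. level_regular s X l \<delta> col) \<and> isomorphism_invariant r X col q' \<and>
     real (card {e\<in>ksets r X. q' e \<noteq> q e}) \<le> \<epsilon> * real (card (ksets r X)))"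

section \<open>Counting estimates and the induction step\<close>

lemma choose_Suc_mult: "(n choose Suc r) * Suc r = (n choose r) * (n - r)"
proof (cases "r < n")
  case True
  then obtain m where m: "n = Suc m" by (cases n) auto
  have "Suc r * (n choose Suc r) = n * (m choose r)" using m Suc_times_binomial by simp
  moreover have "(n - r) * (n choose r) = n * (m choose r)"
    using m binomial_absorb_comp[of n r] by simp
  ultimately show ?thesis by (simp add: mult.commute)
qed simp

text \<open>By \<open>choose_Suc_mult\<close>, \<open>n choose Suc r\<close> exceeds
  \<open>n choose r\<close> by the factor \<open>(n - r) / Suc r\<close>, which beats every
  constant. Uniformity in \<open>l \<le> m\<close> is needed because \<open>l\<close> is known only
  once the vertex set is given.\<close>

lemma exponentially_few_cylinders:
  fixes \<theta> :: real
  assumes "\<theta> > 0"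
  shows "\<exists>N. \<forall>n\<ge>N. \<forall>l\<le>m. 2 * (real l * 2 ^ (Suc r * (n choose r)) + 1) \<le> exp (\<theta>\<^sup>2 / 4 * (n choose Suc r))"
proof (intro exI allI impI)
  \<comment> \<open>Solves \<open>\<theta>\<^sup>2 / 4 * K / (r + 1) = m + r + 2\<close>; the right
    side times \<open>C\<close> bounds the exponent of the left side of the claim.\<close>
  define K where "K = 4 * (real r + 1) * (real m + real r + 2) / \<theta>\<^sup>2"
  fix n l assume n: "r + 1 + nat \<lceil>K\<rceil> \<le> n" and l: "l \<le> m"
  define C where "C = real (n choose r)"
  have C1: "C \<ge> 1"
  proof -
    have "n choose r > 0" using n by (intro zero_less_binomial) simp
    thus ?thesis unfolding C_def by linarith
  qed
  have K: "K \<le> real n - real r" using n real_nat_ceiling_ge[of K] by linarith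
  have two: "(2::real) \<le> exp 1" using exp_ge_add_one_self[of 1] by simp
  have "real l + 1 \<le> exp m" using exp_ge_add_one_self[of "real m"] of_nat_mono[OF l, where 'a=real] by linarith
  have pow: "(2::real) ^ (Suc r * (n choose r)) \<le> exp ((real r + 1) * C)"
  proof -
    have "(2::real) ^ (Suc r * (n choose r)) \<le> exp 1 ^ (Suc r * (n choose r))"
      by (rule power_mono[OF two]) simp
    also have "\<dots> = exp ((real r + 1) * C)"
      by (simp add: exp_of_nat_mult[symmetric] C_def algebra_simps)
    finally show ?thesis .
  qed
  have "2 * (real l * 2 ^ (Suc r * (n choose r)) + 1) \<le> 2 * ((real l + 1) * 2 ^ (Suc r * (n choose r)))"
    by (simp add: distrib_right one_le_power)
  also have "\<dots> \<le> exp 1 * (exp m * exp ((real r + 1) * C))"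
    using two \<open>real l + 1 \<le> exp m\<close> pow by (intro mult_mono) simp_all
  also have "\<dots> = exp (1 + real m + (real r + 1) * C)" by (simp add: exp_add)
  also have "\<dots> \<le> exp (\<theta>\<^sup>2 / 4 * (n choose Suc r))"
  proof -
    have "1 + real m + (real r + 1) * C \<le> (real m + 1) * C + (real r + 1) * C"
    proof -
      have "(real m + 1) * 1 \<le> (real m + 1) * C" by (rule mult_left_mono[OF C1]) simp
      hence "1 + real m \<le> (real m + 1) * C" by (simp only: mult_1_right add.commute)
      thus ?thesis by (rule add_right_mono)
    qed
    also have "\<dots> = (real m + real r + 2) * C" by (simp add: algebra_simps)
    also have "\<dots> = \<theta>\<^sup>2 / 4 * (K * C) / (real r + 1)"
      using assms by (simp add: K_def divide_simps)
    also have "\<dots> \<le> \<theta>\<^sup>2 / 4 * ((real n - real r) * C) / (real r + 1)"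
      using K C1 by (intro divide_right_mono mult_left_mono mult_right_mono) simp_all
    also have "(real n - real r) * C = real (n choose Suc r) * (real r + 1)"
    proof -
      have "real ((n choose Suc r) * Suc r) = real ((n choose r) * (n - r))" by (simp only: choose_Suc_mult)
      thus ?thesis using n by (simp add: C_def of_nat_diff algebra_simps)
    qed
    also have "\<theta>\<^sup>2 / 4 * (real (n choose Suc r) * (real r + 1)) / (real r + 1) = \<theta>\<^sup>2 / 4 * real (n choose Suc r)"
    proof -
      have "real r + 1 \<noteq> 0" by linarith
      thus ?thesis unfolding mult.assoc[symmetric] by (rule nonzero_mult_div_cancel_right)
    qed
    finally show ?thesis by (simp only: exp_le_cancel_iff)
  qed
  finally show "2 * (real l * 2 ^ (Suc r * (n choose r)) + 1) \<le> exp (\<theta>\<^sup>2 / 4 * (n choose Suc r))" .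
qed

lemma card_bad_facets:
  assumes "finite X" "S \<subseteq> ksets r X"
  shows "card {e\<in>ksets (Suc r) X. \<exists>v\<in>e. e - {v} \<in> S} \<le> card S * (card X - r)"
proof -
  have finS: "finite S" using finite_subset[OF assms(2)] assms(1) by simp
  have "{e\<in>ksets (Suc r) X. \<exists>v\<in>e. e - {v} \<in> S} \<subseteq> (\<Union>s\<in>S. (\<lambda>v. insert v s) ` (X - s))"
  proof
    fix e assume "e \<in> {e\<in>ksets (Suc r) X. \<exists>v\<in>e. e - {v} \<in> S}"
    then obtain v where v: "v \<in> e" "e - {v} \<in> S" "e \<subseteq> X" by (auto simp: ksets_def)
    hence "e = insert v (e - {v})" "v \<in> X - (e - {v})" by auto
    thus "e \<in> (\<Union>s\<in>S. (\<lambda>v. insert v s) ` (X - s))" using v(2) by blast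
  qed
  hence "card {e\<in>ksets (Suc r) X. \<exists>v\<in>e. e - {v} \<in> S} \<le> card (\<Union>s\<in>S. (\<lambda>v. insert v s) ` (X - s))"
    using assms(1) finS by (intro card_mono) auto
  also have "\<dots> \<le> (\<Sum>s\<in>S. card ((\<lambda>v. insert v s) ` (X - s)))" by (rule card_UN_le[OF finS])
  also have "\<dots> \<le> (\<Sum>s\<in>S. card X - r)"
  proof (rule sum_mono)
    fix s assume "s \<in> S"
    hence s: "s \<subseteq> X" "card s = r" using assms(2) by (auto simp: ksets_def)
    have "card ((\<lambda>v. insert v s) ` (X - s)) \<le> card (X - s)" using assms(1) by (intro card_image_le) simp
    thus "card ((\<lambda>v. insert v s) ` (X - s)) \<le> card X - r"
      using s assms(1) by (simp add: card_Diff_subset finite_subset)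
  qed
  finally show ?thesis by simp
qed

text \<open>The approximating colour is read by \<open>A\<close> from the new colour and the facet
  colours, with \<open>Q1\<close> replaced by its invariant approximation \<open>Q2\<close>. Four
  errors of \<open>\<epsilon> / 4\<close> add up: the rounding \<open>c / l\<close>, the energy gap
  \<open>sqrt (c * \<kappa>)\<close>, the random error \<theta>, and the edges with a facet where
  \<open>Q1\<close> and \<open>Q2\<close> differ. Counting the last through their facets costs a
  factor \<open>Suc r\<close>, hence \<open>\<epsilon> / (4 * Suc r)\<close>.\<close>

lemma approximable_Suc:
  fixes X :: "'a set" and q Q1 Q' :: "'a set \<Rightarrow> nat" and \<delta> \<epsilon> \<theta> \<kappa> :: real and c l r :: nat
  assumes X: "finite X" "r \<le> card X" and q: "\<forall>e\<in>ksets (Suc r) X. q e < c"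
    and ref: "refines r X Q' Q1" and reg: "weak_regular (Suc r) X q c Q' (\<theta> / c)"
    and en: "facet_energy (Suc r) X q c Q' \<le> facet_energy (Suc r) X q c Q1 + \<kappa> * card (ksets (Suc r) X)"
    and \<theta>: "0 < \<theta>" "\<theta> \<le> 1" "\<theta> \<le> \<epsilon> / 4" "2 * \<theta> \<le> \<delta>" and \<kappa>: "\<kappa> = \<epsilon>\<^sup>2 / (16 * c)"
    and c: "c \<ge> 1" "l \<ge> 1" "4 * c / \<epsilon> \<le> l" and "\<epsilon> > 0"
    and few: "2 * (real l * 2 ^ (Suc r * (card X choose r)) + 1) \<le> exp (\<theta>\<^sup>2 / 4 * card (ksets (Suc r) X))"
    and IH: "approximable r X Q1 l \<delta> (\<epsilon> / (4 * Suc r))"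
  shows "approximable (Suc r) X q l \<delta> \<epsilon>"
proof -
  let ?E = "ksets (Suc r) X"
  obtain col Q2 where col: "\<forall>s. col s \<in> {1..l}" "\<forall>s\<in>{1..r}. level_regular s X l \<delta> col"
    and inv: "isomorphism_invariant r X col Q2"
    and Q2: "card {s\<in>ksets r X. Q2 s \<noteq> Q1 s} \<le> \<epsilon> / (4 * Suc r) * card (ksets r X)"
    using IH unfolding approximable_def by blast
  have "0 \<le> \<kappa>" by (simp add: \<kappa>)
  then obtain A U where U: "\<forall>e\<in>?E. U e \<in> {1..l}"
    "\<forall>j\<in>{1..l}. \<forall>B. \<bar>real (card {e\<in>cyl (Suc r) X B. U e = j}) - card (cyl (Suc r) X B) / l\<bar>
      \<le> 2 * \<theta> * card ?E"
    and A: "card {e\<in>?E. A (facet_colours Q1 e) (U e) \<noteq> q e} \<le> (c / l + sqrt (c * \<kappa>) + \<theta>) * card ?E"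
    using exists_uniform_level[OF X(1) q ref reg en \<theta>(1,2) _ c(1,2) few] by blast
  define col' where "col' s = (if s \<in> ?E then U s else col s)" for s
  define q' where "q' e = A (facet_colours Q2 e) (U e)" for e
  have col'_E: "col' e = U e" if "e \<in> ?E" for e using that by (simp add: col'_def)
  have col'_low: "col' s = col s" if "card s \<noteq> Suc r" for s using that by (simp add: col'_def ksets_def)
  have "\<forall>s. col' s \<in> {1..l}" using U(1) col(1) by (simp add: col'_def)
  moreover have "level_regular s X l \<delta> col'" if s: "s \<in> {1..Suc r}" for s
  proof (cases "s = Suc r")
    case True
    have "2 * \<theta> * card ?E \<le> \<delta> * card ?E" using \<theta>(4) by (intro mult_right_mono) simp_all
    moreover have "{e\<in>cyl (Suc r) X B. col' e = j} = {e\<in>cyl (Suc r) X B. U e = j}" for B j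
      using col'_E cyl_subset[of "Suc r" X B] by auto
    ultimately show ?thesis
      unfolding level_regular_def True using U(2)[rule_format, THEN order_trans] by simp
  next
    case False
    have "{e\<in>cyl s X B. col' e = j} = {e\<in>cyl s X B. col e = j}" for B j
      using col'_low False by (auto simp: cyl_def ksets_def)
    thus ?thesis using col(2) s False by (simp add: level_regular_def)
  qed
  moreover have "isomorphism_invariant (Suc r) X col' q'"
    unfolding isomorphism_invariant_def
  proof (intro ballI allI impI)
    fix e e' \<beta> assume e: "e \<in> ?E" "e' \<in> ?E" and \<beta>: "bij_betw \<beta> e e'"
      and iso: "\<forall>s\<subseteq>e. s \<noteq> {} \<longrightarrow> col' (\<beta> ` s) = col' s"
    have finE: "finite e" using finite_in_ksets[OF X(1) e(1)] .
    have im: "\<beta> ` e = e'" and inj: "inj_on \<beta> e" using \<beta> by (auto simp: bij_betw_def)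
    have "Q2 (e - {v}) = Q2 (e' - {\<beta> v})" if v: "v \<in> e" for v
    proof -
      have im': "\<beta> ` (e - {v}) = e' - {\<beta> v}" using im inj v by (auto simp: inj_on_def)
      have bij': "bij_betw \<beta> (e - {v}) (e' - {\<beta> v})"
        unfolding bij_betw_def using im' inj_on_subset[OF inj, of "e - {v}"] by simp
      have "col (\<beta> ` s) = col s" if s: "s \<subseteq> e - {v}" "s \<noteq> {}" for s
      proof -
        have "card s < card e" using s v finE by (intro psubset_card_mono) auto
        hence cs: "card s < Suc r" using e(1) by (simp add: ksets_def)
        moreover have "card (\<beta> ` s) = card s"
          by (rule card_image[OF inj_on_subset[OF inj]]) (use s in blast)
        moreover have "col' (\<beta> ` s) = col' s"
          by (rule iso[rule_format]) (use s in auto)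
        ultimately show ?thesis using col'_low by simp
      qed
      moreover have "\<beta> v \<in> e'" using im v by blast
      ultimately show ?thesis
        using inv[unfolded isomorphism_invariant_def, rule_format, OF ksets_remove[OF e(1) v] ksets_remove[OF e(2)] bij']
        by blast
    qed
    hence "facet_colours Q2 e = facet_colours Q2 e'" by (rule facet_colours_bij[OF \<beta>])
    moreover have "e \<noteq> {}" using e(1) by (auto simp: ksets_def)
    hence "U e = U e'" using iso[rule_format, of e] col'_E e im by simp
    ultimately show "q' e = q' e'" by (simp add: q'_def)
  qed
  moreover have "card {e\<in>?E. q' e \<noteq> q e} \<le> \<epsilon> * card ?E"
  proof -
    define S where "S = {s\<in>ksets r X. Q2 s \<noteq> Q1 s}"
    let ?F = "{e\<in>?E. A (facet_colours Q1 e) (U e) \<noteq> q e}"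
    let ?G = "{e\<in>?E. \<exists>v\<in>e. e - {v} \<in> S}"
    have "{e\<in>?E. q' e \<noteq> q e} \<subseteq> ?F \<union> ?G"
    proof
      fix e assume e: "e \<in> {e\<in>?E. q' e \<noteq> q e}"
      show "e \<in> ?F \<union> ?G"
      proof (cases "e \<in> ?G")
        case False
        have "facet_colours Q2 e = facet_colours Q1 e"
          using False e ksets_remove[of e r X] finite_in_ksets[OF X(1)]
          by (intro facet_colours_cong) (auto simp: S_def)
        thus ?thesis using e by (simp add: q'_def)
      qed simp
    qed
    hence "card {e\<in>?E. q' e \<noteq> q e} \<le> card (?F \<union> ?G)" using X(1) by (intro card_mono) auto
    also have "\<dots> \<le> card ?F + card ?G" by (rule card_Un_le)
    finally have le: "real (card {e\<in>?E. q' e \<noteq> q e}) \<le> card ?F + card ?G" by linarith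
    have "card ?G \<le> card S * (card X - r)" by (rule card_bad_facets[OF X(1)]) (auto simp: S_def)
    hence "real (card ?G) \<le> real (card S) * (card X - r)" by (simp flip: of_nat_mult)
    also have "\<dots> \<le> \<epsilon> / (4 * Suc r) * card (ksets r X) * (card X - r)"
      using Q2 unfolding S_def by (intro mult_right_mono) simp_all
    also have "\<dots> = \<epsilon> / (4 * Suc r) * (real (card X choose Suc r) * Suc r)"
    proof -
      have "real ((card X choose Suc r) * Suc r) = real ((card X choose r) * (card X - r))"
        by (simp only: choose_Suc_mult)
      hence "real (card X choose Suc r) * Suc r = real (card X choose r) * (card X - r)"
        by (simp only: of_nat_mult)
      thus ?thesis using card_ksets[OF X(1), of r] by (simp add: mult.assoc)
    qed
    also have "\<dots> = \<epsilon> / 4 * card ?E"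
      using card_ksets[OF X(1), of "Suc r"] by (simp add: field_simps)
    finally have G: "real (card ?G) \<le> \<epsilon> / 4 * card ?E" .
    have cl: "c / l \<le> \<epsilon> / 4" using c \<open>\<epsilon> > 0\<close> by (simp add: field_simps)
    have "c * \<kappa> = (\<epsilon> / 4)\<^sup>2" using c(1) by (simp add: \<kappa> power2_eq_square)
    hence "sqrt (c * \<kappa>) = \<epsilon> / 4" using \<open>\<epsilon> > 0\<close> by simp
    hence "c / l + sqrt (c * \<kappa>) + \<theta> \<le> 3 * (\<epsilon> / 4)" using cl \<theta>(3) by linarith
    hence "(c / l + sqrt (c * \<kappa>) + \<theta>) * card ?E \<le> 3 * (\<epsilon> / 4) * card ?E"
      by (rule mult_right_mono) simp
    moreover have "3 * (\<epsilon> / 4) * card ?E + \<epsilon> / 4 * card ?E = \<epsilon> * card ?E" by simp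
    ultimately show ?thesis using le G A by linarith
  qed
  ultimately show ?thesis unfolding approximable_def by blast
qed

text \<open>The order of choices matters: for each coarse number \<open>c1\<close> the induction
  hypothesis bounds \<open>l\<close> by \<open>fst (z c1)\<close>, this fixes the error
  \<open>\<theta> c1\<close>, and only then is strong regularization applied. It leaves finitely
  many \<open>c1\<close>, independent of \<open>X\<close>. The lower bound \<open>l0\<close> is part
  of the statement so that the step can demand \<open>l\<close> at least
  \<open>4 * c / \<epsilon>\<close> from the level below.\<close>

theorem regular_approximation:
  fixes \<epsilon> :: real and \<delta> :: "nat \<Rightarrow> real" and c r l0 :: nat
  assumes "c \<ge> 1" "\<epsilon> > 0" "\<And>l. \<delta> l > 0"
  shows "\<exists>m N. \<forall>(X::'a set) q. finite X \<longrightarrow> N \<le> card X \<longrightarrow> (\<forall>e\<in>ksets r X. q e < c) \<longrightarrow>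
    (\<exists>l. l0 \<le> l \<and> 1 \<le> l \<and> l \<le> m \<and> approximable r X q l (\<delta> l) \<epsilon>)"
  using assms
proof (induction r arbitrary: c \<epsilon> l0)
  case (0 c \<epsilon> l0)
  show ?case
  proof (intro exI allI impI)
    fix X :: "'a set" and q assume X: "finite X"
    have "ksets 0 X = {{}}" using X by (auto simp: ksets_def dest: finite_subset)
    hence "isomorphism_invariant 0 X (\<lambda>_. 1) q" by (simp add: isomorphism_invariant_def)
    thus "l0 \<le> max 1 l0 \<and> 1 \<le> max 1 l0 \<and> max 1 l0 \<le> max 1 l0 \<and>
        approximable 0 X q (max 1 l0) (\<delta> (max 1 l0)) \<epsilon>"
      using \<open>\<epsilon> > 0\<close> unfolding approximable_def
      by (intro conjI exI[of _ "\<lambda>_. 1"] exI[of _ q]) auto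
  qed
next
  case (Suc r c \<epsilon> l0)
  define \<kappa> where "\<kappa> = \<epsilon>\<^sup>2 / (16 * c)"
  define l1 where "l1 = max l0 (nat \<lceil>4 * c / \<epsilon>\<rceil>)"
  have \<kappa>: "\<kappa> > 0" using Suc.prems by (simp add: \<kappa>_def)
  \<comment> \<open>\<open>z\<close> pairs the bound on \<open>l\<close> with the threshold on the
    number of vertices; \<open>max 1 c1\<close> since the induction hypothesis wants at least one
    colour.\<close>
  have "\<forall>c1. \<exists>z. \<forall>(X::'a set) q. finite X \<longrightarrow> snd z \<le> card X \<longrightarrow> (\<forall>e\<in>ksets r X. q e < max 1 c1) \<longrightarrow>
    (\<exists>l. l1 \<le> l \<and> 1 \<le> l \<and> l \<le> fst z \<and> approximable r X q l (\<delta> l) (\<epsilon> / (4 * Suc r)))"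
  proof
    fix c1
    obtain m N where "\<forall>(X::'a set) q. finite X \<longrightarrow> N \<le> card X \<longrightarrow> (\<forall>e\<in>ksets r X. q e < max 1 c1) \<longrightarrow>
        (\<exists>l. l1 \<le> l \<and> 1 \<le> l \<and> l \<le> m \<and> approximable r X q l (\<delta> l) (\<epsilon> / (4 * Suc r)))"
      using Suc.IH[of "max 1 c1" "\<epsilon> / (4 * Suc r)" l1] Suc.prems by auto
    thus "\<exists>z. \<forall>(X::'a set) q. finite X \<longrightarrow> snd z \<le> card X \<longrightarrow> (\<forall>e\<in>ksets r X. q e < max 1 c1) \<longrightarrow>
      (\<exists>l. l1 \<le> l \<and> 1 \<le> l \<and> l \<le> fst z \<and> approximable r X q l (\<delta> l) (\<epsilon> / (4 * Suc r)))"
      by (intro exI[of _ "(m, N)"]) simp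
  qed
  from choice[OF this] obtain z where z: "\<And>c1 (X::'a set) q. finite X \<Longrightarrow> snd (z c1) \<le> card X \<Longrightarrow>
      (\<forall>e\<in>ksets r X. q e < max 1 c1) \<Longrightarrow>
      (\<exists>l. l1 \<le> l \<and> 1 \<le> l \<and> l \<le> fst (z c1) \<and> approximable r X q l (\<delta> l) (\<epsilon> / (4 * Suc r)))"
    by blast
  \<comment> \<open>Small enough for every \<open>l\<close> that the induction may return for
    \<open>c1\<close>.\<close>
  define \<theta> where "\<theta> c1 = Min (insert 1 (insert (\<epsilon> / 4) ((\<lambda>l. \<delta> l / 2) ` {..fst (z c1)})))" for c1
  have \<theta>_pos: "\<theta> c1 > 0" for c1 using Suc.prems by (simp add: \<theta>_def)
  have \<theta>_le: "\<theta> c1 \<le> 1" "\<theta> c1 \<le> \<epsilon> / 4" for c1 by (simp_all add: \<theta>_def Min_le_iff)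
  have \<theta>_\<delta>: "2 * \<theta> c1 \<le> \<delta> l" if "l \<le> fst (z c1)" for c1 l
  proof -
    have "\<theta> c1 \<le> \<delta> l / 2" unfolding \<theta>_def using that by (intro Min_le) auto
    thus ?thesis by simp
  qed
  have "\<theta> c1 / c > 0" for c1 using \<theta>_pos Suc.prems(1) by simp
  from strong_regularization[of "\<lambda>c1. \<theta> c1 / c", OF this \<kappa>, where 'a='a and r=r and c=c]
  obtain S :: "nat set" where finS: "finite S" and
    S: "\<forall>(X::'a set) q. finite X \<longrightarrow> (\<forall>e\<in>ksets (Suc r) X. q e < c) \<longrightarrow>
      (\<exists>c1\<in>S. \<exists>Q1 Q'. (\<forall>s\<in>ksets r X. Q1 s < c1) \<and> refines r X Q' Q1 \<and>
        weak_regular (Suc r) X q c Q' (\<theta> c1 / c) \<and>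
        facet_energy (Suc r) X q c Q' \<le> facet_energy (Suc r) X q c Q1 + \<kappa> * card (ksets (Suc r) X))"
    by (elim exE conjE)
  have "\<forall>c1. \<exists>N. \<forall>n\<ge>N. \<forall>l\<le>fst (z c1).
      2 * (real l * 2 ^ (Suc r * (n choose r)) + 1) \<le> exp ((\<theta> c1)\<^sup>2 / 4 * (n choose Suc r))"
    using exponentially_few_cylinders[OF \<theta>_pos] by blast
  from choice[OF this] obtain N where N: "\<And>c1 n l. N c1 \<le> n \<Longrightarrow> l \<le> fst (z c1) \<Longrightarrow>
      2 * (real l * 2 ^ (Suc r * (n choose r)) + 1) \<le> exp ((\<theta> c1)\<^sup>2 / 4 * (n choose Suc r))"
    by blast
  show ?case
  proof (rule exI, rule exI, intro allI impI)
    fix X :: "'a set" and q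
    assume X: "finite X" and n: "r + (\<Sum>c1\<in>S. snd (z c1) + N c1) \<le> card X"
      and q: "\<forall>e\<in>ksets (Suc r) X. q e < c"
    obtain c1 Q1 Q' where c1: "c1 \<in> S" and Q1: "\<forall>s\<in>ksets r X. Q1 s < c1"
      and ref: "refines r X Q' Q1" and reg: "weak_regular (Suc r) X q c Q' (\<theta> c1 / c)"
      and en: "facet_energy (Suc r) X q c Q' \<le> facet_energy (Suc r) X q c Q1 + \<kappa> * card (ksets (Suc r) X)"
      using S[rule_format, OF X] q by meson
    have mem: "snd (z c1) + N c1 \<le> (\<Sum>c1\<in>S. snd (z c1) + N c1)"
      using c1 finS by (intro member_le_sum) auto
    have mem': "fst (z c1) \<le> (\<Sum>c1\<in>S. fst (z c1))"
      using c1 finS by (intro member_le_sum) auto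
    have "\<forall>e\<in>ksets r X. Q1 e < max 1 c1" using Q1 by (auto intro: less_le_trans)
    moreover have "snd (z c1) \<le> card X" using n mem by linarith
    ultimately obtain l where l: "l1 \<le> l" "1 \<le> l" "l \<le> fst (z c1)"
      and IH: "approximable r X Q1 l (\<delta> l) (\<epsilon> / (4 * Suc r))"
      using z[OF X] by blast
    have cl: "4 * c / \<epsilon> \<le> l"
    proof -
      have "4 * c / \<epsilon> \<le> nat \<lceil>4 * c / \<epsilon>\<rceil>" by (rule real_nat_ceiling_ge)
      also have "\<dots> \<le> l" using l(1) by (simp add: l1_def)
      finally show ?thesis .
    qed
    have few: "2 * (real l * 2 ^ (Suc r * (card X choose r)) + 1)
        \<le> exp ((\<theta> c1)\<^sup>2 / 4 * card (ksets (Suc r) X))"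
      using N[OF _ l(3), of "card X"] n mem card_ksets[OF X, of "Suc r"] by simp
    have "approximable (Suc r) X q l (\<delta> l) \<epsilon>"
      by (rule approximable_Suc[OF X _ q ref reg en \<theta>_pos \<theta>_le \<theta>_\<delta>[OF l(3)] \<kappa>_def Suc.prems(1) l(2) cl
            Suc.prems(2) few IH]) (use n in simp)
    moreover have "l0 \<le> l" using l(1) by (simp add: l1_def)
    ultimately show "\<exists>l. l0 \<le> l \<and> 1 \<le> l \<and> l \<le> (\<Sum>c1\<in>S. fst (z c1)) \<and> approximable (Suc r) X q l (\<delta> l) \<epsilon>"
      using l mem' by (intro exI[of _ l]) simp
  qed
qed

subsection \<open>Hypergraphs of tuples\<close>

text \<open>Each \<open>r\<close>-set underlies exactly \<open>fact r\<close> tuples, so ratios of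
  cardinalities are the same for sets and for tuples.\<close>

definition tuples_over :: "nat \<Rightarrow> 'a set \<Rightarrow> 'a set set \<Rightarrow> (nat \<Rightarrow> 'a) set" where
  "tuples_over r X F = {x \<in> inj_tuples r X. x ` {1..r} \<in> F}"

lemma inj_tuplesD:
  assumes "x \<in> inj_tuples r X"
  shows "inj_on x {1..r}" "x ` {1..r} \<subseteq> X" "\<And>i. i \<notin> {1..r} \<Longrightarrow> x i = undefined"
  using assms by (auto simp: inj_tuples_def PiE_def extensional_def)

lemma image_in_ksets:
  assumes "x \<in> inj_tuples k X" "S \<subseteq> {1..k}"
  shows "x ` S \<in> ksets (card S) X"
proof -
  have "inj_on x S" using inj_on_subset[OF inj_tuplesD(1)[OF assms(1)] assms(2)] .
  thus ?thesis using inj_tuplesD(2)[OF assms(1)] assms(2) by (auto simp: ksets_def card_image)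
qed

lemma inj_tuples_comp:
  assumes "x \<in> inj_tuples r X" "\<pi> permutes {1..r}"
  shows "x \<circ> \<pi> \<in> inj_tuples r X" "(x \<circ> \<pi>) ` {1..r} = x ` {1..r}"
proof -
  have im: "\<pi> ` {1..r} = {1..r}" using assms(2) by (rule permutes_image)
  show "(x \<circ> \<pi>) ` {1..r} = x ` {1..r}" unfolding image_comp[symmetric] im ..
  have "inj_on (x \<circ> \<pi>) {1..r}"
    using inj_tuplesD(1)[OF assms(1)] im permutes_inj_on[OF assms(2)] by (intro comp_inj_on) simp_all
  moreover have "x \<circ> \<pi> \<in> {1..r} \<rightarrow>\<^sub>E X"
  proof (rule PiE_I)
    fix i assume "i \<in> {1..r}"
    hence "\<pi> i \<in> {1..r}" using im by blast
    thus "(x \<circ> \<pi>) i \<in> X" using inj_tuplesD(2)[OF assms(1)] by auto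
  next
    fix i assume i: "i \<notin> {1..r}"
    hence "\<pi> i = i" using assms(2) by (rule permutes_not_in[rotated])
    thus "(x \<circ> \<pi>) i = undefined" using inj_tuplesD(3)[OF assms(1) i] by simp
  qed
  ultimately show "x \<circ> \<pi> \<in> inj_tuples r X" by (simp add: inj_tuples_def)
qed

lemma same_image_permutes:
  assumes x: "x \<in> inj_tuples r X" and y: "y \<in> inj_tuples r X" and im: "x ` {1..r} = y ` {1..r}"
  obtains \<pi> where "\<pi> permutes {1..r}" "x = y \<circ> \<pi>"
proof -
  have bx: "bij_betw x {1..r} (y ` {1..r})" and by': "bij_betw y {1..r} (y ` {1..r})"
    using inj_tuplesD(1)[OF x] inj_tuplesD(1)[OF y] im by (auto simp: bij_betw_def)
  define \<pi> where "\<pi> i = (if i \<in> {1..r} then inv_into {1..r} y (x i) else i)" for i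
  have "bij_betw (inv_into {1..r} y \<circ> x) {1..r} {1..r}"
    using bij_betw_trans[OF bx bij_betw_inv_into[OF by']] .
  hence "bij_betw \<pi> {1..r} {1..r}" by (rule bij_betw_cong[THEN iffD1, rotated]) (simp add: \<pi>_def)
  hence perm: "\<pi> permutes {1..r}" by (rule bij_imp_permutes) (auto simp: \<pi>_def)
  have "x i = (y \<circ> \<pi>) i" for i
  proof (cases "i \<in> {1..r}")
    case True
    have "x i \<in> y ` {1..r}" using True im by blast
    thus ?thesis using True by (simp add: \<pi>_def f_inv_into_f)
  next
    case False
    thus ?thesis using inj_tuplesD(3)[OF x False] inj_tuplesD(3)[OF y False] by (auto simp: \<pi>_def)
  qed
  thus ?thesis using that perm by blast
qed

lemma tuple_exists:
  assumes "finite X" "e \<in> ksets r X"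
  obtains x where "x \<in> inj_tuples r X" "x ` {1..r} = e"
proof -
  obtain h where h: "bij_betw h {1..r} e"
    using finite_same_card_bij[of "{1..r}" e] finite_in_ksets[OF assms] assms(2) by (auto simp: ksets_def)
  let ?x = "restrict h {1..r}"
  have "?x ` {1..r} = e" "inj_on ?x {1..r}"
    using bij_betw_imp_surj_on[OF h] bij_betw_imp_inj_on[OF h]
    by (simp_all only: image_restrict_eq inj_on_restrict_eq)
  moreover have "?x \<in> {1..r} \<rightarrow>\<^sub>E X" using bij_betwE[OF h] assms(2) by (auto simp: ksets_def)
  ultimately show ?thesis by (intro that[of ?x]) (simp_all only: inj_tuples_def mem_Collect_eq simp_thms)
qed

lemma card_fibre:
  assumes "finite X" "e \<in> ksets r X"
  shows "card {x \<in> inj_tuples r X. x ` {1..r} = e} = fact r"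
proof -
  obtain y where y: "y \<in> inj_tuples r X" "y ` {1..r} = e" using tuple_exists[OF assms] .
  have "{x \<in> inj_tuples r X. x ` {1..r} = e} = (\<lambda>\<pi>. y \<circ> \<pi>) ` {\<pi>. \<pi> permutes {1..r}}"
  proof (intro equalityI subsetI)
    fix x assume "x \<in> {x \<in> inj_tuples r X. x ` {1..r} = e}"
    hence "x \<in> inj_tuples r X" "x ` {1..r} = y ` {1..r}" using y by auto
    then obtain \<pi> where "\<pi> permutes {1..r}" "x = y \<circ> \<pi>" using same_image_permutes[OF _ y(1)] by blast
    thus "x \<in> (\<lambda>\<pi>. y \<circ> \<pi>) ` {\<pi>. \<pi> permutes {1..r}}" by simp
  next
    fix x assume "x \<in> (\<lambda>\<pi>. y \<circ> \<pi>) ` {\<pi>. \<pi> permutes {1..r}}"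
    then obtain \<pi> where \<pi>: "\<pi> permutes {1..r}" "x = y \<circ> \<pi>" by auto
    show "x \<in> {x \<in> inj_tuples r X. x ` {1..r} = e}"
      unfolding \<pi>(2) using inj_tuples_comp[OF y(1) \<pi>(1)] y(2) by simp
  qed
  moreover have "inj_on (\<lambda>\<pi>. y \<circ> \<pi>) {\<pi>. \<pi> permutes {1..r}}"
  proof (rule inj_onI)
    fix \<pi> \<pi>' assume p: "\<pi> \<in> {\<pi>. \<pi> permutes {1..r}}" "\<pi>' \<in> {\<pi>. \<pi> permutes {1..r}}" "y \<circ> \<pi> = y \<circ> \<pi>'"
    show "\<pi> = \<pi>'"
    proof
      fix i
      show "\<pi> i = \<pi>' i"
      proof (cases "i \<in> {1..r}")
        case True
        have "\<pi> i \<in> {1..r}" "\<pi>' i \<in> {1..r}"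
          using p(1,2) True permutes_in_image[of \<pi> "{1..r}" i] permutes_in_image[of \<pi>' "{1..r}" i]
          by simp_all
        moreover have "y (\<pi> i) = y (\<pi>' i)" using fun_cong[OF p(3), of i] by simp
        ultimately show ?thesis using inj_onD[OF inj_tuplesD(1)[OF y(1)]] by blast
      next
        case False
        thus ?thesis
          using p(1,2) permutes_not_in[of \<pi> "{1..r}" i] permutes_not_in[of \<pi>' "{1..r}" i] by simp
      qed
    qed
  qed
  ultimately show ?thesis by (simp add: card_image card_permutations)
qed

lemma finite_inj_tuples: "finite X \<Longrightarrow> finite (inj_tuples r X)"
  unfolding inj_tuples_def by (rule finite_subset[of _ "{1..r} \<rightarrow>\<^sub>E X"]) (auto intro: finite_PiE)

lemma tuples_over_subset: "tuples_over r X F \<subseteq> inj_tuples r X"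
  by (auto simp: tuples_over_def)

lemma finite_tuples_over: "finite X \<Longrightarrow> finite (tuples_over r X F)"
  using finite_subset[OF tuples_over_subset finite_inj_tuples] .

lemma card_tuples_over:
  assumes "finite X"
  shows "card (tuples_over r X F) = fact r * card (ksets r X \<inter> F)"
proof -
  have img: "x ` {1..r} \<in> ksets r X" if "x \<in> inj_tuples r X" for x
    using image_in_ksets[OF that, of "{1..r}"] by simp
  have "tuples_over r X F = (\<Union>e\<in>ksets r X \<inter> F. {x \<in> inj_tuples r X. x ` {1..r} = e})"
    using img by (auto simp: tuples_over_def)
  also have "card \<dots> = (\<Sum>e\<in>ksets r X \<inter> F. card {x \<in> inj_tuples r X. x ` {1..r} = e})"
    using assms finite_inj_tuples[OF assms] by (intro card_UN_disjoint) auto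
  also have "\<dots> = (\<Sum>e\<in>ksets r X \<inter> F. fact r)"
    using card_fibre[OF assms] by (intro sum.cong) auto
  finally show ?thesis by (simp add: mult.commute)
qed

lemma tuples_over_UNIV: "tuples_over r X UNIV = inj_tuples r X"
  by (simp add: tuples_over_def)

lemma card_inj_tuples: "finite X \<Longrightarrow> card (inj_tuples r X) = fact r * card (ksets r X)"
  using card_tuples_over[of X r UNIV] by (simp add: tuples_over_UNIV)

lemma uniform_hypergraph_tuples_over:
  "uniform_hypergraph r X (tuples_over r X F)"
  unfolding uniform_hypergraph_def
proof (intro conjI ballI allI impI)
  fix x \<pi> assume x: "x \<in> tuples_over r X F" and \<pi>: "\<pi> permutes {1..r}"
  have "x \<in> inj_tuples r X" using x by (simp add: tuples_over_def)
  from inj_tuples_comp[OF this \<pi>] x show "x \<circ> \<pi> \<in> tuples_over r X F"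
    unfolding tuples_over_def mem_Collect_eq by metis
qed (rule tuples_over_subset)

lemma edge_sets_tuples_over:
  assumes "finite X"
  shows "edge_sets r (tuples_over r X F) = ksets r X \<inter> F"
proof (intro equalityI subsetI)
  fix e assume "e \<in> edge_sets r (tuples_over r X F)"
  thus "e \<in> ksets r X \<inter> F"
    using image_in_ksets[of _ r X "{1..r}"] by (auto simp: edge_sets_def tuples_over_def)
next
  fix e assume e: "e \<in> ksets r X \<inter> F"
  then obtain x where "x \<in> inj_tuples r X" "x ` {1..r} = e" using tuple_exists[OF assms] by blast
  thus "e \<in> edge_sets r (tuples_over r X F)" using e by (auto simp: edge_sets_def tuples_over_def)
qed

lemma tuples_over_edge_sets:
  assumes "uniform_hypergraph r X H"
  shows "tuples_over r X (edge_sets r H) = H"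
proof (intro equalityI subsetI)
  fix x assume x: "x \<in> tuples_over r X (edge_sets r H)"
  then obtain y where y: "y \<in> H" "x ` {1..r} = y ` {1..r}" and xi: "x \<in> inj_tuples r X"
    by (auto simp: tuples_over_def edge_sets_def)
  have "y \<in> inj_tuples r X" using assms y(1) by (auto simp: uniform_hypergraph_def)
  then obtain \<pi> where "\<pi> permutes {1..r}" "x = y \<circ> \<pi>" using same_image_permutes[OF xi _ y(2)] by blast
  thus "x \<in> H" using assms y(1) by (simp add: uniform_hypergraph_def)
next
  fix x assume "x \<in> H"
  thus "x \<in> tuples_over r X (edge_sets r H)"
    using assms by (auto simp: tuples_over_def edge_sets_def uniform_hypergraph_def)
qed

text \<open>For an injective tuple \<open>a\<close>, permutations \<sigma> of the coordinates
  correspond to numberings \<open>a \<circ> \<sigma>\<close> of its vertex set.\<close>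

lemma cylinder_intersection_eq:
  assumes "cylinder_intersection r X L"
  obtains B where "L = tuples_over r X (cyl r X B)"
proof -
  obtain B where L: "L = {a \<in> inj_tuples r X. \<exists>\<sigma>. \<sigma> permutes {1..r} \<and>
               (\<forall>i\<in>{1..r}. a ` {1..r} - {a (\<sigma> i)} \<in> edge_sets (r - 1) (B i))}"
    using assms unfolding cylinder_intersection_def by blast
  define B' where "B' i = edge_sets (r - 1) (B i)" for i
  have "(\<exists>\<sigma>. \<sigma> permutes {1..r} \<and> (\<forall>i\<in>{1..r}. a ` {1..r} - {a (\<sigma> i)} \<in> B' i)) \<longleftrightarrow>
      a ` {1..r} \<in> cyl r X B'" if a: "a \<in> inj_tuples r X" for a
  proof
    assume "\<exists>\<sigma>. \<sigma> permutes {1..r} \<and> (\<forall>i\<in>{1..r}. a ` {1..r} - {a (\<sigma> i)} \<in> B' i)"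
    then obtain \<sigma> where \<sigma>: "\<sigma> permutes {1..r}" "\<forall>i\<in>{1..r}. a ` {1..r} - {a (\<sigma> i)} \<in> B' i" by blast
    have "bij_betw (a \<circ> \<sigma>) {1..r} (a ` {1..r})"
      using bij_betw_trans[OF permutes_imp_bij[OF \<sigma>(1)] inj_on_imp_bij_betw[OF inj_tuplesD(1)[OF a]]] .
    moreover have "\<forall>i\<in>{1..r}. a ` {1..r} - {(a \<circ> \<sigma>) i} \<in> B' i" using \<sigma>(2) by simp
    moreover have "a ` {1..r} \<in> ksets r X" using image_in_ksets[OF a, of "{1..r}"] by simp
    ultimately show "a ` {1..r} \<in> cyl r X B'" unfolding cyl_def by blast
  next
    assume "a ` {1..r} \<in> cyl r X B'"
    then obtain \<tau> where \<tau>: "bij_betw \<tau> {1..r} (a ` {1..r})" "\<forall>i\<in>{1..r}. a ` {1..r} - {\<tau> i} \<in> B' i"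
      unfolding cyl_def by blast
    let ?x = "restrict \<tau> {1..r}"
    have im: "?x ` {1..r} = a ` {1..r}" and "inj_on ?x {1..r}"
      using bij_betw_imp_surj_on[OF \<tau>(1)] bij_betw_imp_inj_on[OF \<tau>(1)]
      by (simp_all only: image_restrict_eq inj_on_restrict_eq)
    moreover have "?x \<in> {1..r} \<rightarrow>\<^sub>E X" using bij_betwE[OF \<tau>(1)] inj_tuplesD(2)[OF a] by auto
    ultimately have "?x \<in> inj_tuples r X" by (simp add: inj_tuples_def)
    then obtain \<pi> where \<pi>: "\<pi> permutes {1..r}" "?x = a \<circ> \<pi>" using same_image_permutes[OF _ a im] by blast
    have "a (\<pi> i) = \<tau> i" if "i \<in> {1..r}" for i using fun_cong[OF \<pi>(2), of i] that by simp
    thus "\<exists>\<sigma>. \<sigma> permutes {1..r} \<and> (\<forall>i\<in>{1..r}. a ` {1..r} - {a (\<sigma> i)} \<in> B' i)"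
      using \<pi>(1) \<tau>(2) by (intro exI[of _ \<pi>]) simp
  qed
  hence "L = tuples_over r X (cyl r X B')" unfolding L tuples_over_def B'_def by blast
  thus ?thesis by (rule that)
qed

section \<open>Regularity and equitability of colour classes\<close>

definition colour_classes :: "'a set \<Rightarrow> ('a set \<Rightarrow> nat) \<Rightarrow> nat \<Rightarrow> nat \<Rightarrow> (nat \<Rightarrow> 'a) set" where
  "colour_classes X col r j = tuples_over r X {e. col e = j}"

lemma hyperpartition_colour_classes:
  assumes "\<forall>s. col s \<in> {1..l}"
  shows "hyperpartition k l X (colour_classes X col)"
  unfolding hyperpartition_def colour_classes_def
proof (intro ballI conjI)
  fix r
  show "uniform_hypergraph r X (tuples_over r X {e. col e = j})" for j
    by (rule uniform_hypergraph_tuples_over)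
  show "disjoint_family_on (\<lambda>j. tuples_over r X {e. col e = j}) {1..l}"
    by (auto simp: disjoint_family_on_def tuples_over_def)
  show "(\<Union>j\<in>{1..l}. tuples_over r X {e. col e = j}) = inj_tuples r X"
    using assms by (auto simp: tuples_over_def)
qed

text \<open>For \<delta> above 1 the size threshold is met only if there are no tuples at all, and
  then both quotients are 0.\<close>

lemma regular_hypergraph_trivial:
  assumes "finite X" "G \<subseteq> inj_tuples r X" "\<delta> > 1"
  shows "regular_hypergraph r X \<delta> G"
  unfolding regular_hypergraph_def
proof (intro allI impI, elim conjE)
  fix L assume L: "cylinder_intersection r X L" "\<delta> * real (card (inj_tuples r X)) \<le> real (card L)"
  let ?K = "inj_tuples r X"
  have fin: "finite ?K" using finite_inj_tuples[OF assms(1)] .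
  have "L \<subseteq> ?K" using L(1) by (auto simp: cylinder_intersection_def)
  hence "card L \<le> card ?K" by (rule card_mono[OF fin])
  have K0: "card ?K = 0"
  proof (rule ccontr)
    assume "card ?K \<noteq> 0"
    hence "1 * real (card ?K) < \<delta> * real (card ?K)" using assms(3) by (intro mult_strict_right_mono) simp_all
    thus False using L(2) \<open>card L \<le> card ?K\<close> by simp
  qed
  moreover have "card L = 0" using \<open>card L \<le> card ?K\<close> K0 by simp
  ultimately show "\<bar>real (card G) / real (card ?K) - real (card (G \<inter> L)) / real (card L)\<bar> \<le> \<delta>"
    using assms(3) by simp
qed

lemma regular_hypergraph_mono:
  assumes "regular_hypergraph r X \<delta> G" "\<delta> \<le> \<delta>'"
  shows "regular_hypergraph r X \<delta>' G"
  unfolding regular_hypergraph_def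
proof (intro allI impI, elim conjE)
  fix L assume L: "cylinder_intersection r X L" "\<delta>' * real (card (inj_tuples r X)) \<le> real (card L)"
  have "\<delta> * real (card (inj_tuples r X)) \<le> \<delta>' * real (card (inj_tuples r X))"
    using assms(2) by (intro mult_right_mono) simp_all
  hence "\<delta> * real (card (inj_tuples r X)) \<le> real (card L)" using L(2) by linarith
  thus "\<bar>real (card G) / real (card (inj_tuples r X)) - real (card (G \<inter> L)) / real (card L)\<bar> \<le> \<delta>'"
    using assms L(1) unfolding regular_hypergraph_def by fastforce
qed

lemma equitable_mono:
  assumes "equitable k l X \<delta> P" "\<delta> \<le> \<delta>'"
  shows "equitable k l X \<delta>' P"
  using assms unfolding equitable_def by (meson less_le_trans)

lemma card_colour_class_bounds:
  assumes "finite X" "level_regular r X l \<eta> col" "j \<in> {1..l}"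
  shows "\<bar>real (card {e\<in>ksets r X. col e = j}) - real (card (ksets r X)) / real l\<bar>
    \<le> \<eta> * real (card (ksets r X))"
proof -
  have "\<bar>real (card {e\<in>cyl r X (\<lambda>_. UNIV). col e = j}) - real (card (cyl r X (\<lambda>_. UNIV))) / real l\<bar>
      \<le> \<eta> * real (card (ksets r X))"
    using assms(2,3) unfolding level_regular_def by blast
  thus ?thesis unfolding cyl_UNIV[OF assms(1)] .
qed

lemma card_colour_classes:
  assumes "finite X"
  shows "card (colour_classes X col r j) = fact r * card {e\<in>ksets r X. col e = j}"
  using card_tuples_over[OF assms, of r "{e. col e = j}"]
  by (simp add: colour_classes_def Int_def)

text \<open>Both densities are compared with \<open>1 / l\<close>. As \<open>L\<close> has at least
  the share \<delta> of all tuples, an error \<eta> relative to all tuples is at most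
  \<open>\<eta> / \<delta>\<close> relative to \<open>L\<close>, hence the quadratic bound on
  \<eta>.\<close>

lemma regular_colour_classes:
  assumes X: "finite X" and lr: "level_regular r X l \<eta> col" and j: "j \<in> {1..l}"
    and \<delta>: "0 < \<delta>" "\<delta> \<le> 1" "\<eta> \<le> \<delta>\<^sup>2 / 8"
  shows "regular_hypergraph r X \<delta> (colour_classes X col r j)"
  unfolding regular_hypergraph_def
proof (intro allI impI, elim conjE)
  fix L assume L: "cylinder_intersection r X L" "\<delta> * real (card (inj_tuples r X)) \<le> real (card L)"
  obtain B where B: "L = tuples_over r X (cyl r X B)" using cylinder_intersection_eq[OF L(1)] .
  let ?F = "real (fact r)"
  define N n g h where "N = real (card (ksets r X))" and "n = real (card (cyl r X B))"
    and "g = real (card {e\<in>ksets r X. col e = j})" and "h = real (card {e\<in>cyl r X B. col e = j})"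
  have F: "?F > 0" by simp
  have K: "real (card (inj_tuples r X)) = ?F * N" using card_inj_tuples[OF X, of r] by (simp add: N_def)
  have "ksets r X \<inter> cyl r X B = cyl r X B" using cyl_subset by blast
  hence cL: "real (card L) = ?F * n" using card_tuples_over[OF X, of r "cyl r X B"] by (simp add: B n_def)
  have cG: "real (card (colour_classes X col r j)) = ?F * g" using card_colour_classes[OF X] by (simp add: g_def)
  have "colour_classes X col r j \<inter> L = tuples_over r X {e\<in>cyl r X B. col e = j}"
    by (auto simp: colour_classes_def B tuples_over_def)
  moreover have "ksets r X \<inter> {e\<in>cyl r X B. col e = j} = {e\<in>cyl r X B. col e = j}" using cyl_subset by blast
  ultimately have cGL: "real (card (colour_classes X col r j \<inter> L)) = ?F * h"
    using card_tuples_over[OF X, of r "{e\<in>cyl r X B. col e = j}"] by (simp add: h_def)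
  have "\<bar>g / N - h / n\<bar> \<le> \<delta>"
  proof (cases "N = 0")
    case True
    hence "ksets r X = {}" using X by (simp add: N_def)
    hence "n = 0" using cyl_subset[of r X B] by (simp add: n_def)
    thus ?thesis using True \<delta> by simp
  next
    case False
    hence N: "N > 0" by (simp add: N_def)
    have n: "\<delta> * N \<le> n"
    proof -
      have "?F * (\<delta> * N) \<le> ?F * n" using L(2) unfolding K cL by (simp add: mult_ac)
      thus ?thesis using F by (rule mult_left_le_imp_le)
    qed
    hence npos: "n > 0" using N \<delta>(1) by (meson less_le_trans mult_pos_pos)
    have 1: "\<bar>g - N / l\<bar> \<le> \<eta> * N" using card_colour_class_bounds[OF X lr j] by (simp add: g_def N_def)
    have 2: "\<bar>h - n / l\<bar> \<le> \<eta> * N" using lr j unfolding level_regular_def h_def n_def N_def by blast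
    have "0 \<le> \<eta> * N" using 1 by linarith
    hence \<eta>: "\<eta> \<ge> 0" using N by (simp add: zero_le_mult_iff)
    have "g / N - 1 / l = (g - N / l) / N" using N by (simp add: diff_divide_distrib)
    hence "\<bar>g / N - 1 / l\<bar> = \<bar>g - N / l\<bar> / N" using N by (simp only: abs_divide abs_of_pos)
    also have "\<dots> \<le> \<eta>" using 1 N by (simp add: divide_le_eq)
    finally have 3: "\<bar>g / N - 1 / l\<bar> \<le> \<eta>" .
    have "h / n - 1 / l = (h - n / l) / n" using npos by (simp add: diff_divide_distrib)
    hence "\<bar>h / n - 1 / l\<bar> = \<bar>h - n / l\<bar> / n" using npos by (simp only: abs_divide abs_of_pos)
    also have "\<dots> \<le> \<eta> * N / n" using 2 npos by (intro divide_right_mono) simp_all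
    also have "\<dots> \<le> \<eta> * N / (\<delta> * N)"
      using n N \<delta>(1) \<eta> npos by (intro divide_left_mono mult_pos_pos) simp_all
    also have "\<dots> = \<eta> / \<delta>" using N by simp
    also have "\<dots> \<le> \<delta> / 8" using \<delta> by (simp add: divide_le_eq power2_eq_square)
    finally have 4: "\<bar>h / n - 1 / l\<bar> \<le> \<delta> / 8" .
    have "\<delta>\<^sup>2 \<le> \<delta> * 1" unfolding power2_eq_square using \<delta> by (intro mult_left_mono) simp_all
    hence "\<eta> \<le> \<delta> / 8" using \<delta>(3) by simp
    thus ?thesis using 3 4 \<delta>(1) by linarith
  qed
  moreover have "?F * g / (?F * N) = g / N" "?F * h / (?F * n) = h / n" using F by simp_all
  ultimately show "\<bar>real (card (colour_classes X col r j)) / real (card (inj_tuples r X))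
      - real (card (colour_classes X col r j \<inter> L)) / real (card L)\<bar> \<le> \<delta>"
    unfolding K cL cG cGL by simp
qed

lemma equitable_colour_classes:
  assumes X: "finite X" and lr: "\<forall>r\<in>{1..k}. level_regular r X l \<eta> col"
    and \<delta>: "0 < \<delta>" "2 * \<eta> < \<delta>"
  shows "equitable k l X \<delta> (colour_classes X col)"
  unfolding equitable_def
proof (intro ballI impI)
  fix r i j assume r: "r \<in> {1..k}" and i: "i \<in> {1..l}" and j: "j \<in> {1..l}"
  let ?F = "real (fact r)"
  define N where "N = real (card (ksets r X))"
  define g where "g j = real (card {e\<in>ksets r X. col e = j})" for j
  have K: "real (card (inj_tuples r X)) = ?F * N" using card_inj_tuples[OF X, of r] by (simp add: N_def)
  have G: "real (card (colour_classes X col r j)) = ?F * g j" for j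
    using card_colour_classes[OF X] by (simp add: g_def)
  have "\<bar>g i - N / l\<bar> \<le> \<eta> * N" "\<bar>g j - N / l\<bar> \<le> \<eta> * N"
    using card_colour_class_bounds[OF X lr[rule_format, OF r]] i j by (simp_all add: g_def N_def)
  hence gij: "\<bar>g i - g j\<bar> \<le> 2 * \<eta> * N" by linarith
  show "\<bar>real (card (colour_classes X col r i)) - real (card (colour_classes X col r j))\<bar>
      / real (card (inj_tuples r X)) < \<delta>"
  proof (cases "N = 0")
    case True
    thus ?thesis unfolding K using \<delta>(1) by simp
  next
    case False
    hence N: "N > 0" by (simp add: N_def)
    have "\<bar>?F * g i - ?F * g j\<bar> / (?F * N) = \<bar>g i - g j\<bar> / N"
      by (simp add: right_diff_distrib[symmetric] abs_mult)
    also have "\<dots> \<le> 2 * \<eta>" using gij N by (simp add: divide_le_eq)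
    finally show ?thesis unfolding K G using \<delta>(2) by linarith
  qed
qed

subsection \<open>Cells and combinatorial structures\<close>

definition coordinate :: "nat \<Rightarrow> ('a set \<Rightarrow> nat) \<Rightarrow> (nat \<Rightarrow> 'a) \<Rightarrow> nat set \<Rightarrow> nat" where
  "coordinate k col x = (\<lambda>S\<in>nonempty_subsets k. col (x ` S))"

lemma directed_cell_colour_classes:
  assumes "finite X" "f \<in> extensional (nonempty_subsets k)"
  shows "directed_cell k X (colour_classes X col) f = {x \<in> inj_tuples k X. coordinate k col x = f}"
proof -
  have "(\<forall>S\<in>nonempty_subsets k. x ` S \<in> edge_sets (card S) (colour_classes X col (card S) (f S))) \<longleftrightarrow>
      coordinate k col x = f" if x: "x \<in> inj_tuples k X" for x
  proof -
    have "x ` S \<in> edge_sets (card S) (colour_classes X col (card S) (f S)) \<longleftrightarrow> coordinate k col x S = f S"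
      if S: "S \<in> nonempty_subsets k" for S
    proof -
      have "x ` S \<in> ksets (card S) X" using S by (intro image_in_ksets[OF x]) (simp add: nonempty_subsets_def)
      thus ?thesis using S
        by (simp add: colour_classes_def edge_sets_tuples_over[OF assms(1)] coordinate_def)
    qed
    hence "(\<forall>S\<in>nonempty_subsets k. x ` S \<in> edge_sets (card S) (colour_classes X col (card S) (f S))) \<longleftrightarrow>
        (\<forall>S\<in>nonempty_subsets k. coordinate k col x S = f S)" by simp
    also have "\<dots> \<longleftrightarrow> coordinate k col x = f"
      using assms(2) extensionalityI[of "coordinate k col x" "nonempty_subsets k" f]
      by (auto simp: coordinate_def)
    finally show ?thesis .
  qed
  thus ?thesis unfolding directed_cell_def by blast
qed

lemma union_of_cells:
  assumes "finite X" "C \<subseteq> nonempty_subsets k \<rightarrow>\<^sub>E {1..l}"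
  shows "(\<Union>f\<in>C. directed_cell k X (colour_classes X col) f) = {x \<in> inj_tuples k X. coordinate k col x \<in> C}"
proof -
  have "f \<in> extensional (nonempty_subsets k)" if "f \<in> C" for f
    using assms(2) that by (auto simp: PiE_def)
  hence "(\<Union>f\<in>C. directed_cell k X (colour_classes X col) f)
      = (\<Union>f\<in>C. {x \<in> inj_tuples k X. coordinate k col x = f})"
    using directed_cell_colour_classes[OF assms(1)] by (intro SUP_cong) auto
  thus ?thesis by auto
qed

lemma permuted_nonempty_subset:
  assumes "\<pi> permutes {1..k}" "S \<in> nonempty_subsets k"
  shows "\<pi> ` S \<in> nonempty_subsets k"
  using assms permutes_image[OF assms(1)] by (auto simp: nonempty_subsets_def)

lemma perm_action_coordinate:
  assumes "\<pi> permutes {1..k}"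
  shows "perm_action k \<pi> (coordinate k col x) = coordinate k col (x \<circ> inv \<pi>)"
proof
  fix S
  show "perm_action k \<pi> (coordinate k col x) S = coordinate k col (x \<circ> inv \<pi>) S"
    using permuted_nonempty_subset[OF permutes_inv[OF assms], of S]
    by (simp add: perm_action_def coordinate_def image_comp)
qed

lemma coordinate_PiE:
  "\<forall>s. col s \<in> {1..l} \<Longrightarrow> coordinate k col x \<in> nonempty_subsets k \<rightarrow>\<^sub>E {1..l}"
  by (auto simp: coordinate_def)

text \<open>Strong convergence asks for one combinatorial structure that serves all members of the
  sequence, including the finitely many small ones to which the regularity argument does not apply.
  Cells all of whose vertices have colour 1 or 2 make up a small part of a large hypergraph; they are
  sacrificed so that every hypergraph can be represented exactly by putting all edges and all
  non-edges in two such cells.\<close>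

definition absorbing :: "nat \<Rightarrow> nat \<Rightarrow> (nat set \<Rightarrow> nat) set \<Rightarrow> (nat set \<Rightarrow> nat) set" where
  "absorbing k l C = {f \<in> nonempty_subsets k \<rightarrow>\<^sub>E {1..l}.
     if \<forall>i\<in>{1..k}. f {i} \<in> {1, 2} then f {1..k} = 1 else f \<in> C}"

text \<open>Permuting coordinates permutes the singletons and fixes \<open>{1..k}\<close>, so the
  choice between the two clauses and the first clause are invariant.\<close>

lemma combinatorial_structure_absorbing:
  assumes "k \<ge> 1" "\<And>f \<pi>. f \<in> C \<Longrightarrow> \<pi> permutes {1..k} \<Longrightarrow> perm_action k \<pi> f \<in> C"
  shows "combinatorial_structure k l (absorbing k l C)"
  unfolding combinatorial_structure_def
proof (intro conjI ballI allI impI)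
  show "absorbing k l C \<subseteq> nonempty_subsets k \<rightarrow>\<^sub>E {1..l}" by (auto simp: absorbing_def)
  fix f \<pi> assume f: "f \<in> absorbing k l C" and \<pi>: "\<pi> permutes {1..k}"
  have inv: "inv \<pi> permutes {1..k}" using permutes_inv[OF \<pi>] .
  have sing: "{i} \<in> nonempty_subsets k" if "i \<in> {1..k}" for i using that by (simp add: nonempty_subsets_def)
  have full: "{1..k} \<in> nonempty_subsets k" using assms(1) by (simp add: nonempty_subsets_def)
  have "perm_action k \<pi> f \<in> nonempty_subsets k \<rightarrow>\<^sub>E {1..l}"
  proof (rule PiE_I)
    fix S assume S: "S \<in> nonempty_subsets k"
    hence "inv \<pi> ` S \<in> nonempty_subsets k" by (rule permuted_nonempty_subset[OF inv])
    hence "f (inv \<pi> ` S) \<in> {1..l}" using f unfolding absorbing_def by blast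
    thus "perm_action k \<pi> f S \<in> {1..l}" using S by (simp add: perm_action_def)
  qed (simp add: perm_action_def)
  moreover have "perm_action k \<pi> f {1..k} = f {1..k}"
    using full permutes_image[OF inv] by (simp add: perm_action_def del: atLeastAtMost_iff)
  moreover have "(\<forall>i\<in>{1..k}. perm_action k \<pi> f {i} \<in> {1, 2}) \<longleftrightarrow> (\<forall>i\<in>{1..k}. f {i} \<in> {1, 2})"
  proof -
    have "(\<forall>i\<in>{1..k}. perm_action k \<pi> f {i} \<in> {1, 2}) \<longleftrightarrow> (\<forall>i\<in>{1..k}. f {inv \<pi> i} \<in> {1, 2})"
      using sing by (intro ball_cong refl) (simp add: perm_action_def)
    also have "\<dots> \<longleftrightarrow> (\<forall>i\<in>inv \<pi> ` {1..k}. f {i} \<in> {1, 2})" by blast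
    also have "inv \<pi> ` {1..k} = {1..k}" by (rule permutes_image[OF inv])
    finally show ?thesis .
  qed
  moreover have "f \<in> C \<Longrightarrow> perm_action k \<pi> f \<in> C" using assms(2) \<pi> by blast
  ultimately show "perm_action k \<pi> f \<in> absorbing k l C"
    using f unfolding absorbing_def mem_Collect_eq by (metis (full_types))
qed

section \<open>Approximating a single hypergraph by cells\<close>

definition well_approximated ::
    "nat \<Rightarrow> 'a set \<Rightarrow> (nat \<Rightarrow> 'a) set \<Rightarrow> real \<Rightarrow> nat \<Rightarrow> (nat set \<Rightarrow> nat) set \<Rightarrow> real \<Rightarrow> bool" where
  "well_approximated k X H \<epsilon> l C \<delta> \<longleftrightarrow> (\<exists>P. hyperpartition k l X P \<and>
     regular_hyperpartition k l X \<delta> P \<and> equitable k l X \<delta> P \<and>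
     (\<exists>T. has_combinatorial_structure k X P C T \<and>
       real (card (sym_diff H T)) \<le> \<epsilon> * real (card X choose k)))"

lemma well_approximated_mono:
  assumes "well_approximated k X H \<epsilon> l C \<delta>" "\<epsilon> \<le> \<epsilon>'" "\<delta> \<le> \<delta>'"
  shows "well_approximated k X H \<epsilon>' l C \<delta>'"
proof -
  have "\<epsilon> * real (card X choose k) \<le> \<epsilon>' * real (card X choose k)"
    using assms(2) by (intro mult_right_mono) simp_all
  thus ?thesis using assms(1,3) regular_hypergraph_mono[OF _ assms(3)] equitable_mono[OF _ assms(3)]
    unfolding well_approximated_def regular_hyperpartition_def by (meson order_trans)
qed

text \<open>Edges get colour 1, other \<open>k\<close>-sets colour 2, sets of other sizes colour 1.
  All vertices then have colour 1 or 2, so the colour of the whole set decides. Tolerance 2 makes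
  regularity trivial and exceeds any difference of densities.\<close>

lemma well_approximated_exactly:
  assumes "k \<ge> 1" "l \<ge> 2" "finite X" "uniform_hypergraph k X H" "\<epsilon> \<ge> 0"
  shows "well_approximated k X H \<epsilon> l (absorbing k l C) 2"
proof -
  define col where "col s = (if card s = k \<and> s \<notin> edge_sets k H then 2 else 1 :: nat)" for s :: "'a set"
  let ?P = "colour_classes X col"
  have col: "\<forall>s. col s \<in> {1..l}" using assms(2) by (simp add: col_def)
  have full: "{1..k} \<in> nonempty_subsets k" using assms(1) by (simp add: nonempty_subsets_def)
  have "regular_hyperpartition k l X 2 ?P"
    unfolding regular_hyperpartition_def colour_classes_def
    using regular_hypergraph_trivial[OF assms(3) tuples_over_subset] by auto
  moreover have "equitable k l X 2 ?P"
    unfolding equitable_def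
  proof (intro ballI impI)
    fix r i j
    let ?K = "card (inj_tuples r X)"
    have le: "real (card (?P r i)) \<le> ?K" for i
      unfolding colour_classes_def
      by (intro of_nat_mono card_mono finite_inj_tuples assms(3) tuples_over_subset)
    have "\<bar>real (card (?P r i)) - real (card (?P r j))\<bar> \<le> ?K"
      using le[of i] le[of j] by linarith
    hence "\<bar>real (card (?P r i)) - real (card (?P r j))\<bar> / ?K \<le> 1"
      by (cases "?K = 0") (simp_all add: divide_le_eq_1 neq0_conv)
    thus "\<bar>real (card (?P r i)) - real (card (?P r j))\<bar> / ?K < 2" by simp
  qed
  moreover have "(\<Union>f\<in>absorbing k l C. directed_cell k X ?P f) = H"
  proof -
    have "coordinate k col x \<in> absorbing k l C \<longleftrightarrow> x ` {1..k} \<in> edge_sets k H"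
      if x: "x \<in> inj_tuples k X" for x
    proof -
      have "card (x ` {1..k}) = k" using image_in_ksets[OF x, of "{1..k}"] by (simp add: ksets_def)
      moreover have "\<forall>i\<in>{1..k}. coordinate k col x {i} \<in> {1, 2}"
        by (simp add: coordinate_def col_def nonempty_subsets_def)
      hence "coordinate k col x \<in> absorbing k l C \<longleftrightarrow> coordinate k col x {1..k} = 1"
        using coordinate_PiE[OF col, of k x] unfolding absorbing_def mem_Collect_eq by simp
      moreover have "coordinate k col x {1..k} = col (x ` {1..k})" using full by (simp add: coordinate_def)
      ultimately show ?thesis by (simp add: col_def)
    qed
    hence "{x \<in> inj_tuples k X. coordinate k col x \<in> absorbing k l C} = tuples_over k X (edge_sets k H)"
      unfolding tuples_over_def by (intro Collect_cong conj_cong refl)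
    moreover have "(\<Union>f\<in>absorbing k l C. directed_cell k X ?P f)
        = {x \<in> inj_tuples k X. coordinate k col x \<in> absorbing k l C}"
      by (rule union_of_cells[OF assms(3)]) (auto simp: absorbing_def)
    ultimately show ?thesis using tuples_over_edge_sets[OF assms(4)] by simp
  qed
  ultimately show ?thesis
    unfolding well_approximated_def has_combinatorial_structure_def
    using hyperpartition_colour_classes[OF col] assms(5)
    by (intro exI[of _ ?P] conjI exI[of _ H]) simp_all
qed

text \<open>From \<open>k * (m choose k) = m * ((m - 1) choose (k - 1))\<close>. It bounds the share
  of \<open>k\<close>-sets inside a part of the vertices by the share of that part.\<close>

lemma choose_mult_le:
  assumes "m \<le> n" "k \<ge> 1"
  shows "n * (m choose k) \<le> m * (n choose k)"
proof (cases "m = 0")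
  case False
  then obtain m' where m': "m = Suc m'" by (cases m) simp_all
  obtain n' where n': "n = Suc n'" using False assms(1) by (cases n) simp_all
  obtain k' where k': "k = Suc k'" using assms(2) by (cases k) simp_all
  note eqs = m' n' k'
  have km: "k * (m choose k) = m * (m' choose k')" and kn: "k * (n choose k) = n * (n' choose k')"
    unfolding eqs by (rule Suc_times_binomial)+
  have "k * (n * (m choose k)) = n * (m * (m' choose k'))"
    unfolding km[symmetric] by (rule mult.left_commute)
  also have "\<dots> \<le> n * (m * (n' choose k'))"
    using assms(1) eqs by (intro mult_left_mono binomial_right_mono) simp_all
  also have "\<dots> = k * (m * (n choose k))"
    unfolding mult.left_commute[of k m] kn by (rule mult.left_commute)
  finally show ?thesis using assms(2) by simp
qed (use assms in simp)

text \<open>The inverse of \<open>x\<close> followed by \<open>y\<close> is a bijection of the two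
  edges, and equal coordinates say that it preserves the colours of all nonempty subsets.\<close>

lemma coordinate_eq_iff_invariant:
  assumes "isomorphism_invariant k X col q" "x \<in> inj_tuples k X" "y \<in> inj_tuples k X"
    and eq: "coordinate k col x = coordinate k col y"
  shows "q (x ` {1..k}) = q (y ` {1..k})"
proof -
  have ix: "inj_on x {1..k}" and iy: "inj_on y {1..k}" using assms(2,3) by (auto dest: inj_tuplesD)
  let ?\<beta> = "y \<circ> inv_into {1..k} x"
  have "bij_betw ?\<beta> (x ` {1..k}) (y ` {1..k})"
    using bij_betw_trans[OF bij_betw_inv_into[OF inj_on_imp_bij_betw[OF ix]] inj_on_imp_bij_betw[OF iy]] .
  moreover have "col (?\<beta> ` s) = col s" if s: "s \<subseteq> x ` {1..k}" "s \<noteq> {}" for s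
  proof -
    define S where "S = inv_into {1..k} x ` s"
    have "x ` S = s" unfolding S_def by (rule image_inv_into_cancel[OF refl s(1)])
    moreover have "S \<subseteq> {1..k}"
      unfolding S_def by (intro image_subsetI inv_into_into) (use s(1) in blast)
    moreover have "?\<beta> ` s = y ` S" by (simp add: S_def image_comp)
    moreover have "S \<noteq> {}" using s(2) by (simp add: S_def)
    ultimately show ?thesis
      using fun_cong[OF eq, of S] by (simp add: coordinate_def nonempty_subsets_def)
  qed
  moreover have "x ` {1..k} \<in> ksets k X" "y ` {1..k} \<in> ksets k X"
    using image_in_ksets[OF assms(2), of "{1..k}"] image_in_ksets[OF assms(3), of "{1..k}"] by simp_all
  ultimately show ?thesis
    using assms(1)[unfolded isomorphism_invariant_def, rule_format, of "x ` {1..k}" "y ` {1..k}" ?\<beta>] by simp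
qed

text \<open>Regularity at level 1 leaves about \<open>2 / l\<close> of the vertices in the two
  colours, so a large \<open>l\<close> pays for the sacrificed cells.\<close>

lemma card_low_colour_sets:
  assumes X: "finite X" and lr: "level_regular 1 X l \<eta> col" and "l \<ge> 2" "k \<ge> 1"
  shows "real (card {e\<in>ksets k X. \<forall>v\<in>e. col {v} \<in> {1, 2}}) \<le> (2 / l + 2 * \<eta>) * real (card X choose k)"
proof -
  define V where "V j = {v\<in>X. col {v} = j}" for j
  let ?n = "real (card X)"
  have "card {e\<in>ksets 1 X. col e = j} = card (V j)" for j
  proof -
    have "{e\<in>ksets 1 X. col e = j} = (\<lambda>v. {v}) ` V j"
      by (auto simp: ksets_def V_def card_1_singleton_iff)
    thus ?thesis by (simp add: card_image)
  qed
  hence Vj: "real (card (V j)) \<le> ?n / l + \<eta> * ?n" if "j \<in> {1..l}" for j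
    using card_colour_class_bounds[OF X lr that] card_ksets[OF X, of 1] by (simp add: abs_le_iff)
  have "card (V 1 \<union> V 2) \<le> card (V 1) + card (V 2)" by (rule card_Un_le)
  hence "real (card (V 1 \<union> V 2)) \<le> real (card (V 1)) + real (card (V 2))" by linarith
  also have "\<dots> \<le> (?n / l + \<eta> * ?n) + (?n / l + \<eta> * ?n)" using assms(3) by (intro add_mono Vj) simp_all
  finally have V: "real (card (V 1 \<union> V 2)) \<le> (2 / l + 2 * \<eta>) * ?n" by (simp add: algebra_simps)
  have "{e\<in>ksets k X. \<forall>v\<in>e. col {v} \<in> {1, 2}} = ksets k (V 1 \<union> V 2)"
    by (auto simp: ksets_def V_def)
  moreover have finV: "finite (V 1 \<union> V 2)" using X by (simp add: V_def)
  ultimately have card_eq: "card {e\<in>ksets k X. \<forall>v\<in>e. col {v} \<in> {1, 2}} = (card (V 1 \<union> V 2) choose k)"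
    using card_ksets[OF finV, of k] by simp
  show ?thesis
  proof (cases "card X = 0")
    case True
    hence "X = {}" using X by simp
    hence "V 1 \<union> V 2 = {}" by (simp add: V_def)
    thus ?thesis unfolding card_eq using assms(4) True by (simp add: binomial_eq_0)
  next
    case False
    have "card (V 1 \<union> V 2) \<le> card X" by (rule card_mono[OF X]) (auto simp: V_def)
    from choose_mult_le[OF this assms(4)]
    have "?n * real (card (V 1 \<union> V 2) choose k) \<le> real (card (V 1 \<union> V 2)) * real (card X choose k)"
      by (simp flip: of_nat_mult)
    also have "\<dots> \<le> (2 / l + 2 * \<eta>) * ?n * real (card X choose k)" by (rule mult_right_mono[OF V]) simp
    also have "\<dots> = ?n * ((2 / l + 2 * \<eta>) * real (card X choose k))" by simp
    finally show ?thesis unfolding card_eq using False by simp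
  qed
qed

text \<open>\<open>H\<close> and \<open>T\<close> differ only on edges where \<open>q'\<close> errs
  and on edges with all vertices of colour 1 or 2. The factor \<open>fact k\<close> arises since
  tuples are counted on one side and \<open>k\<close>-sets on the other.\<close>

lemma approximable_imp_well_approximated:
  fixes \<eta> \<delta> \<epsilon> \<epsilon>' :: real
  assumes X: "finite X" and H: "uniform_hypergraph k X H" and "k \<ge> 1" "l \<ge> 2"
    and appr: "approximable k X (\<lambda>e. of_bool (e \<in> edge_sets k H)) l \<eta> \<epsilon>'"
    and \<delta>: "0 < \<delta>" "\<delta> \<le> 1" "\<eta> \<le> \<delta>\<^sup>2 / 8"
    and \<epsilon>: "fact k * (\<epsilon>' + 2 / l + 2 * \<eta>) \<le> \<epsilon>"
  shows "\<exists>C. combinatorial_structure k l (absorbing k l C) \<and>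
    C \<subseteq> nonempty_subsets k \<rightarrow>\<^sub>E {1..l} \<and> well_approximated k X H \<epsilon> l (absorbing k l C) \<delta>"
proof -
  let ?q = "\<lambda>e. of_bool (e \<in> edge_sets k H) :: nat"
  obtain col q' where col: "\<forall>s. col s \<in> {1..l}" and lr: "\<forall>s\<in>{1..k}. level_regular s X l \<eta> col"
    and inv: "isomorphism_invariant k X col q'"
    and err: "real (card {e\<in>ksets k X. q' e \<noteq> ?q e}) \<le> \<epsilon>' * real (card (ksets k X))"
    using appr unfolding approximable_def by blast
  let ?P = "colour_classes X col"
  \<comment> \<open>By invariance of \<open>q'\<close>, a coordinate occurring on one tuple with
    \<open>q' = 1\<close> occurs on such tuples only, so \<open>C\<close> decides whether
    \<open>q' = 1\<close>.\<close>
  define C where "C = coordinate k col ` {x \<in> inj_tuples k X. q' (x ` {1..k}) = 1}"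
  define T where "T = (\<Union>f\<in>absorbing k l C. directed_cell k X ?P f)"
  have C_sub: "C \<subseteq> nonempty_subsets k \<rightarrow>\<^sub>E {1..l}" using coordinate_PiE[OF col] by (auto simp: C_def)
  have comb: "combinatorial_structure k l (absorbing k l C)"
  proof (rule combinatorial_structure_absorbing[OF assms(3)])
    fix f \<pi> assume "f \<in> C" and \<pi>: "\<pi> permutes {1..k}"
    then obtain x where x: "x \<in> inj_tuples k X" "q' (x ` {1..k}) = 1" "f = coordinate k col x"
      by (auto simp: C_def)
    have "perm_action k \<pi> f = coordinate k col (x \<circ> inv \<pi>)" using perm_action_coordinate[OF \<pi>] x(3) by simp
    moreover have "x \<circ> inv \<pi> \<in> {x \<in> inj_tuples k X. q' (x ` {1..k}) = 1}"
      unfolding mem_Collect_eq inj_tuples_comp(2)[OF x(1) permutes_inv[OF \<pi>]]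
      using inj_tuples_comp(1)[OF x(1) permutes_inv[OF \<pi>]] x(2) by (rule conjI)
    ultimately show "perm_action k \<pi> f \<in> C" unfolding C_def by blast
  qed
  have T: "T = {x \<in> inj_tuples k X. coordinate k col x \<in> absorbing k l C}"
    unfolding T_def by (rule union_of_cells[OF X]) (auto simp: absorbing_def)
  have C_iff: "coordinate k col x \<in> C \<longleftrightarrow> q' (x ` {1..k}) = 1" if x: "x \<in> inj_tuples k X" for x
  proof
    assume "coordinate k col x \<in> C"
    then obtain y where "y \<in> inj_tuples k X" "q' (y ` {1..k}) = 1" "coordinate k col x = coordinate k col y"
      unfolding C_def by blast
    thus "q' (x ` {1..k}) = 1" using coordinate_eq_iff_invariant[OF inv x] by simp
  qed (use x in \<open>simp add: C_def\<close>)
  let ?F = "{e. q' e \<noteq> ?q e}" and ?G = "{e. \<forall>v\<in>e. col {v} \<in> {1, 2}}"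
  have "sym_diff H T \<subseteq> tuples_over k X ?F \<union> tuples_over k X ?G"
  proof
    fix x assume x: "x \<in> sym_diff H T"
    have xi: "x \<in> inj_tuples k X" using x H T by (auto simp: uniform_hypergraph_def)
    have Hx: "x \<in> H \<longleftrightarrow> x ` {1..k} \<in> edge_sets k H"
      using tuples_over_edge_sets[OF H] xi unfolding tuples_over_def by blast
    show "x \<in> tuples_over k X ?F \<union> tuples_over k X ?G"
    proof (cases "x ` {1..k} \<in> ?G")
      case False
      have sing: "coordinate k col x {i} = col {x i}" if "i \<in> {1..k}" for i
        using that by (simp add: coordinate_def nonempty_subsets_def)
      have "\<not> (\<forall>i\<in>{1..k}. coordinate k col x {i} \<in> {1, 2})" using False sing by fastforce
      hence "coordinate k col x \<in> absorbing k l C \<longleftrightarrow> q' (x ` {1..k}) = 1"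
        using C_iff[OF xi] coordinate_PiE[OF col, of k x] unfolding absorbing_def mem_Collect_eq by argo
      hence "x \<in> T \<longleftrightarrow> q' (x ` {1..k}) = 1" using xi by (simp add: T)
      hence "q' (x ` {1..k}) \<noteq> ?q (x ` {1..k})" using x Hx by auto
      thus ?thesis using xi by (simp add: tuples_over_def)
    qed (use xi in \<open>simp add: tuples_over_def\<close>)
  qed
  hence "card (sym_diff H T) \<le> card (tuples_over k X ?F \<union> tuples_over k X ?G)"
    by (intro card_mono finite_UnI finite_tuples_over X)
  also have "\<dots> \<le> card (tuples_over k X ?F) + card (tuples_over k X ?G)" by (rule card_Un_le)
  also have "\<dots> = fact k * (card (ksets k X \<inter> ?F) + card (ksets k X \<inter> ?G))"
    using card_tuples_over[OF X] by (simp add: distrib_left)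
  finally have "real (card (sym_diff H T)) \<le> real (fact k * (card (ksets k X \<inter> ?F) + card (ksets k X \<inter> ?G)))"
    by (rule of_nat_mono)
  also have "\<dots> = fact k * (real (card (ksets k X \<inter> ?F)) + real (card (ksets k X \<inter> ?G)))" by simp
  also have "\<dots> \<le> fact k * (\<epsilon>' * real (card X choose k) + (2 / l + 2 * \<eta>) * real (card X choose k))"
  proof (intro mult_left_mono add_mono)
    show "real (card (ksets k X \<inter> ?F)) \<le> \<epsilon>' * real (card X choose k)"
      using err card_ksets[OF X, of k] by (simp add: Int_def)
    have "level_regular 1 X l \<eta> col" using lr assms(3) by simp
    from card_low_colour_sets[OF X this assms(4,3)]
    show "real (card (ksets k X \<inter> ?G)) \<le> (2 / l + 2 * \<eta>) * real (card X choose k)" by (simp add: Int_def)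
  qed simp
  also have "\<dots> = fact k * (\<epsilon>' + 2 / l + 2 * \<eta>) * real (card X choose k)" by (simp add: algebra_simps)
  also have "\<dots> \<le> \<epsilon> * real (card X choose k)" by (rule mult_right_mono[OF \<epsilon>]) simp
  finally have "real (card (sym_diff H T)) \<le> \<epsilon> * real (card X choose k)" .
  moreover have "has_combinatorial_structure k X ?P (absorbing k l C) T"
    by (simp add: has_combinatorial_structure_def T_def)
  moreover have "regular_hyperpartition k l X \<delta> ?P"
    unfolding regular_hyperpartition_def using regular_colour_classes[OF X _ _ \<delta>] lr by blast
  moreover have "equitable k l X \<delta> ?P"
  proof (rule equitable_colour_classes[OF X lr \<delta>(1)])
    have "\<delta>\<^sup>2 \<le> \<delta> * 1" unfolding power2_eq_square using \<delta> by (intro mult_left_mono) simp_all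
    thus "2 * \<eta> < \<delta>" using \<delta> by simp
  qed
  ultimately show ?thesis
    using hyperpartition_colour_classes[OF col] comb C_sub unfolding well_approximated_def by blast
qed

subsection \<open>Convergent subsequences\<close>

text \<open>\<delta> may be any positive function of \<open>l\<close>: the pigeonhole over
  structures will insert a tolerance depending on all structures with \<open>l\<close>
  colours.\<close>

lemma finitary_hypergraph_regularity:
  fixes \<delta> :: "nat \<Rightarrow> real" and \<epsilon> :: real
  assumes k: "k \<ge> 1" and \<epsilon>: "\<epsilon> > 0" and \<delta>: "\<And>l. \<delta> l > 0"
  shows "\<exists>m N. \<forall>(X::'a set) H. finite X \<longrightarrow> N \<le> card X \<longrightarrow> uniform_hypergraph k X H \<longrightarrow>
    (\<exists>l C. 2 \<le> l \<and> l \<le> m \<and> C \<subseteq> nonempty_subsets k \<rightarrow>\<^sub>E {1..l} \<and>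
      combinatorial_structure k l (absorbing k l C) \<and>
      well_approximated k X H \<epsilon> l (absorbing k l C) (\<delta> l))"
proof -
  define F :: real where "F = fact k"
  have F: "F > 0" by (simp add: F_def)
  define d where "d l = min 1 (\<delta> l)" for l
  \<comment> \<open>The budget is \<open>\<epsilon> / F\<close>: half for the approximation, a
    quarter for \<open>2 / l\<close> through \<open>l0\<close>, a quarter for
    \<open>2 * \<eta> l\<close>. The term with \<open>d l\<close> is what regularity of the colour
    classes asks for.\<close>
  define \<eta> where "\<eta> l = min ((d l)\<^sup>2 / 8) (\<epsilon> / (8 * F))" for l
  define l0 where "l0 = max 2 (nat \<lceil>8 * F / \<epsilon>\<rceil>)"
  have d: "0 < d l" "d l \<le> 1" "d l \<le> \<delta> l" for l using \<delta>[of l] by (simp_all add: d_def)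
  have \<eta>: "0 < \<eta> l" for l using d(1)[of l] \<epsilon> F by (simp add: \<eta>_def)
  have "\<epsilon> / (2 * F) > 0" using \<epsilon> F by simp
  from regular_approximation[of 2 "\<epsilon> / (2 * F)" \<eta> k l0, OF _ this \<eta>, where 'a='a]
  obtain m N where mN: "\<forall>(X::'a set) q. finite X \<longrightarrow> N \<le> card X \<longrightarrow> (\<forall>e\<in>ksets k X. q e < 2) \<longrightarrow>
      (\<exists>l. l0 \<le> l \<and> 1 \<le> l \<and> l \<le> m \<and> approximable k X q l (\<eta> l) (\<epsilon> / (2 * F)))"
    by auto
  show ?thesis
  proof (rule exI, rule exI, intro allI impI)
    fix X :: "'a set" and H
    assume X: "finite X" "N \<le> card X" and H: "uniform_hypergraph k X H"
    obtain l where l: "l0 \<le> l" "l \<le> m"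
      and appr: "approximable k X (\<lambda>e. of_bool (e \<in> edge_sets k H)) l (\<eta> l) (\<epsilon> / (2 * F))"
    proof -
      have "\<forall>e\<in>ksets k X. of_bool (e \<in> edge_sets k H) < (2 :: nat)" by simp
      thus ?thesis using mN X that by meson
    qed
    have l2: "2 \<le> l" using l(1) by (simp add: l0_def)
    have "8 * F / \<epsilon> \<le> nat \<lceil>8 * F / \<epsilon>\<rceil>" by (rule real_nat_ceiling_ge)
    also have "\<dots> \<le> l" using l(1) by (simp add: l0_def)
    finally have "2 / l \<le> \<epsilon> / (4 * F)" using \<epsilon> F l2 by (simp add: field_simps)
    moreover have "2 * \<eta> l \<le> \<epsilon> / (4 * F)" by (simp add: \<eta>_def min_def)
    ultimately have "\<epsilon> / (2 * F) + 2 / l + 2 * \<eta> l \<le> \<epsilon> / (2 * F) + \<epsilon> / (4 * F) + \<epsilon> / (4 * F)" by linarith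
    hence "F * (\<epsilon> / (2 * F) + 2 / l + 2 * \<eta> l) \<le> F * (\<epsilon> / (2 * F) + \<epsilon> / (4 * F) + \<epsilon> / (4 * F))"
      using F by (intro mult_left_mono) simp_all
    also have "\<dots> = \<epsilon>" using F by (simp add: field_simps)
    finally have err: "fact k * (\<epsilon> / (2 * F) + 2 / l + 2 * \<eta> l) \<le> \<epsilon>" by (simp add: F_def)
    have "\<eta> l \<le> (d l)\<^sup>2 / 8" by (simp add: \<eta>_def)
    from approximable_imp_well_approximated[OF X(1) H k l2 appr d(1,2) this err]
    obtain C where C: "combinatorial_structure k l (absorbing k l C)"
      "C \<subseteq> nonempty_subsets k \<rightarrow>\<^sub>E {1..l}" "well_approximated k X H \<epsilon> l (absorbing k l C) (d l)" by blast
    show "\<exists>l C. 2 \<le> l \<and> l \<le> m \<and> C \<subseteq> nonempty_subsets k \<rightarrow>\<^sub>E {1..l} \<and>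
      combinatorial_structure k l (absorbing k l C) \<and>
      well_approximated k X H \<epsilon> l (absorbing k l C) (\<delta> l)"
      using l2 l(2) C(1,2) well_approximated_mono[OF C(3) order_refl d(3)] by blast
  qed
qed

lemma increasing_hypergraph_seq_subseq:
  assumes "increasing_hypergraph_seq k X H" "strict_mono \<phi>"
  shows "increasing_hypergraph_seq k (X \<circ> \<phi>) (H \<circ> \<phi>)"
proof -
  have "card (X i) < card (X j)" if "i < j" for i j
    using assms(1) that lift_Suc_mono_less[of "\<lambda>i. card (X i)"] by (auto simp: increasing_hypergraph_seq_def)
  thus ?thesis using assms strict_monoD[OF assms(2)] by (simp add: increasing_hypergraph_seq_def)
qed

lemma increasing_hypergraph_seq_card:
  assumes "increasing_hypergraph_seq k X H"
  shows "i \<le> card (X i)"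
proof -
  have "strict_mono (\<lambda>i. card (X i))"
    using assms by (simp add: increasing_hypergraph_seq_def strict_mono_Suc_iff)
  thus ?thesis by (rule strict_mono_imp_increasing)
qed

text \<open>Otherwise each admissible structure fails at some tolerance \<open>D l C\<close> for all
  but finitely many members. Apply the finitary theorem with \<open>\<delta> l\<close> the minimum
  of \<open>D l C\<close> over the finitely many \<open>C\<close>: every large member is
  approximated by one of finitely many structures at its own tolerance, so finitely many finite sets
  of indices cover a tail.\<close>

lemma infinitely_often_well_approximated:
  fixes X :: "nat \<Rightarrow> 'a set"
  assumes k: "k \<ge> 1" and \<epsilon>: "\<epsilon> > 0" and seq: "increasing_hypergraph_seq k X H"
  shows "\<exists>l C. 2 \<le> l \<and> combinatorial_structure k l (absorbing k l C) \<and>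
    (\<forall>\<delta>>0. infinite {i. well_approximated k (X i) (H i) \<epsilon> l (absorbing k l C) \<delta>})"
proof (rule ccontr)
  assume none: "\<not> ?thesis"
  have neg: "\<exists>\<delta>>0. 2 \<le> l \<and> combinatorial_structure k l (absorbing k l C) \<longrightarrow>
      finite {i. well_approximated k (X i) (H i) \<epsilon> l (absorbing k l C) \<delta>}" for l C
  proof (cases "2 \<le> l \<and> combinatorial_structure k l (absorbing k l C)")
    case True
    thus ?thesis using none by blast
  next
    case False
    thus ?thesis by (intro exI[of _ 1] conjI zero_less_one impI) (rule notE)
  qed
  define D where "D l C = (SOME \<delta>. \<delta> > 0 \<and> (2 \<le> l \<and> combinatorial_structure k l (absorbing k l C) \<longrightarrow>
      finite {i. well_approximated k (X i) (H i) \<epsilon> l (absorbing k l C) \<delta>}))" for l C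
  have D: "D l C > 0" "2 \<le> l \<Longrightarrow> combinatorial_structure k l (absorbing k l C) \<Longrightarrow>
      finite {i. well_approximated k (X i) (H i) \<epsilon> l (absorbing k l C) (D l C)}" for l C
    using someI_ex[OF neg[of l C]] unfolding D_def by blast+
  define S where "S l = Pow (nonempty_subsets k \<rightarrow>\<^sub>E {1..l})" for l :: nat
  have "finite (nonempty_subsets k)"
    unfolding nonempty_subsets_def by (rule finite_subset[of _ "Pow {1..k}"]) auto
  hence finS: "finite (S l)" for l unfolding S_def by (intro finite_Pow_iff[THEN iffD2] finite_PiE) auto
  define \<delta> where "\<delta> l = Min (D l ` S l)" for l
  have neS: "S l \<noteq> {}" for l by (auto simp: S_def)
  have \<delta>_pos: "\<delta> l > 0" for l unfolding \<delta>_def using finS neS D(1) by (subst Min_gr_iff) auto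
  have \<delta>_le: "\<delta> l \<le> D l C" if "C \<in> S l" for l C unfolding \<delta>_def using finS that by (intro Min_le) auto
  from finitary_hypergraph_regularity[where \<delta>=\<delta> and 'a='a, OF k \<epsilon> \<delta>_pos]
  obtain m N where mN: "\<forall>(X::'a set) H. finite X \<longrightarrow> N \<le> card X \<longrightarrow> uniform_hypergraph k X H \<longrightarrow>
    (\<exists>l C. 2 \<le> l \<and> l \<le> m \<and> C \<subseteq> nonempty_subsets k \<rightarrow>\<^sub>E {1..l} \<and>
      combinatorial_structure k l (absorbing k l C) \<and>
      well_approximated k X H \<epsilon> l (absorbing k l C) (\<delta> l))" by (elim exE)
  define Z where "Z = {(l, C). 2 \<le> l \<and> l \<le> m \<and> C \<in> S l \<and> combinatorial_structure k l (absorbing k l C)}"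
  have "Z \<subseteq> (SIGMA l:{..m}. S l)" by (auto simp: Z_def)
  hence finZ: "finite Z" using finS by (rule finite_subset[OF _ finite_SigmaI[OF finite_atMost]])
  define R where "R = (\<Union>(l, C)\<in>Z. {i. well_approximated k (X i) (H i) \<epsilon> l (absorbing k l C) (D l C)})"
  have "finite R" unfolding R_def using finZ D(2) by (intro finite_UN_I) (auto simp: Z_def)
  moreover have "{N..} \<subseteq> R"
  proof
    fix i assume "i \<in> {N..}"
    hence N: "N \<le> card (X i)" using increasing_hypergraph_seq_card[OF seq, of i] by simp
    have "finite (X i)" "uniform_hypergraph k (X i) (H i)" using seq by (auto simp: increasing_hypergraph_seq_def)
    then obtain l C where lC: "2 \<le> l" "l \<le> m" "C \<in> S l" "combinatorial_structure k l (absorbing k l C)"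
      and w: "well_approximated k (X i) (H i) \<epsilon> l (absorbing k l C) (\<delta> l)"
      using mN[rule_format, of "X i" "H i"] N unfolding S_def by auto
    have "well_approximated k (X i) (H i) \<epsilon> l (absorbing k l C) (D l C)"
      by (rule well_approximated_mono[OF w order_refl \<delta>_le[OF lC(3)]])
    moreover have "(l, C) \<in> Z" using lC by (simp add: Z_def)
    ultimately show "i \<in> R" unfolding R_def by blast
  qed
  ultimately have "finite {N..}" using finite_subset by blast
  thus False by (simp add: infinite_Ici)
qed

section \<open>Diagonal subsequence and choice of the tolerances\<close>

lemma subsequence_of_infinitely_often:
  fixes P :: "nat \<Rightarrow> nat \<Rightarrow> bool"
  assumes "\<And>n. infinite {i. P n i}"
  shows "\<exists>\<phi>. strict_mono \<phi> \<and> (\<forall>n. P n (\<phi> n))"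
proof -
  have "\<exists>i>m. P n i" for n m
    using assms[of n] unfolding infinite_nat_iff_unbounded mem_Collect_eq by blast
  hence "\<exists>\<phi>. \<forall>n. P n (\<phi> n) \<and> \<phi> n < \<phi> (Suc n)"
    by (intro dependent_nat_choice) blast+
  thus ?thesis by (auto simp: strict_mono_Suc_iff)
qed

text \<open>Being eventual for each \<delta>, the property passes to subsequences and ignores
  finitely many members; a diagonal sequence is a subsequence of each stage only from some index
  on.\<close>

definition eventually_structured ::
    "nat \<Rightarrow> (nat \<Rightarrow> 'a set) \<Rightarrow> (nat \<Rightarrow> (nat \<Rightarrow> 'a) set) \<Rightarrow> real \<Rightarrow> (nat \<Rightarrow> nat) \<Rightarrow> bool" where
  "eventually_structured k X H \<epsilon> s \<longleftrightarrow>
    (\<exists>l C. 2 \<le> l \<and> combinatorial_structure k l (absorbing k l C) \<and>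
      (\<forall>\<delta>>0. \<forall>\<^sub>F i in sequentially. well_approximated k (X (s i)) (H (s i)) \<epsilon> l (absorbing k l C) \<delta>))"

lemma eventually_structured_subseq:
  fixes r :: "nat \<Rightarrow> nat"
  assumes "eventually_structured k X H \<epsilon> s" "strict_mono r"
  shows "eventually_structured k X H \<epsilon> (s \<circ> r)"
  using assms eventually_subseq[OF assms(2)] unfolding eventually_structured_def comp_def by blast

text \<open>The \<open>n\<close>-th member is taken at tolerance \<open>1 / Suc n\<close>, and
  larger tolerances are easier.\<close>

lemma exists_structured_subseq:
  fixes X :: "nat \<Rightarrow> 'a set" and s :: "nat \<Rightarrow> nat"
  assumes k: "k \<ge> 1" and \<epsilon>: "\<epsilon> > 0" and seq: "increasing_hypergraph_seq k X H" and s: "strict_mono s"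
  shows "\<exists>r. strict_mono r \<and> eventually_structured k X H \<epsilon> (s \<circ> r)"
proof -
  obtain l C where lC: "2 \<le> l" "combinatorial_structure k l (absorbing k l C)" and
    inf: "\<And>\<delta>. \<delta> > 0 \<Longrightarrow> infinite {i. well_approximated k (X (s i)) (H (s i)) \<epsilon> l (absorbing k l C) \<delta>}"
    using infinitely_often_well_approximated[OF k \<epsilon> increasing_hypergraph_seq_subseq[OF seq s]]
    unfolding comp_def by blast
  have "infinite {i. well_approximated k (X (s i)) (H (s i)) \<epsilon> l (absorbing k l C) (1 / Suc n)}" for n
    by (rule inf) simp
  from subsequence_of_infinitely_often[of "\<lambda>n i. well_approximated k (X (s i)) (H (s i)) \<epsilon> l (absorbing k l C) (1 / Suc n)", OF this]
  obtain r where r: "strict_mono r"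
    "\<And>n. well_approximated k (X (s (r n))) (H (s (r n))) \<epsilon> l (absorbing k l C) (1 / Suc n)" by blast
  have "\<forall>\<^sub>F i in sequentially. well_approximated k (X ((s \<circ> r) i)) (H ((s \<circ> r) i)) \<epsilon> l (absorbing k l C) \<delta>"
    if \<delta>: "\<delta> > 0" for \<delta> :: real
  proof -
    have "(\<lambda>n. 1 / real (Suc n)) \<longlonglongrightarrow> 0" by (rule LIMSEQ_Suc[OF lim_1_over_n])
    hence "\<forall>\<^sub>F n in sequentially. 1 / real (Suc n) < \<delta>" using \<delta> by (rule order_tendstoD(2))
    thus ?thesis
    proof eventually_elim
      case (elim n)
      show ?case unfolding comp_def by (rule well_approximated_mono[OF r(2) order_refl]) (use elim in simp)
    qed
  qed
  hence "eventually_structured k X H \<epsilon> (s \<circ> r)" unfolding eventually_structured_def using lC by blast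
  thus ?thesis using r(1) by blast
qed

text \<open>\<open>M i\<close> is the largest \<open>m \<le> i\<close> such that tolerance
  \<open>2 / Suc m\<close> is attained at \<open>i\<close>; \<open>m = 0\<close> is always available
  by \<open>P i 2\<close>. Each fixed \<open>m\<close> is eventually admissible, so
  \<open>M i\<close> tends to infinity.\<close>

lemma null_sequence_of_eventually:
  fixes P :: "nat \<Rightarrow> real \<Rightarrow> bool"
  assumes "\<And>\<delta>. \<delta> > 0 \<Longrightarrow> \<forall>\<^sub>F i in sequentially. P i \<delta>" "\<And>i. P i 2"
  shows "\<exists>\<delta>. (\<forall>i. \<delta> i > 0 \<and> P i (\<delta> i)) \<and> \<delta> \<longlonglongrightarrow> 0"
proof -
  define S where "S i = {m. m \<le> i \<and> P i (2 / Suc m)}" for i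
  define M where "M i = Max (S i)" for i
  have finS: "finite (S i)" for i unfolding S_def by (rule finite_subset[of _ "{..i}"]) auto
  have "0 \<in> S i" for i using assms(2) by (simp add: S_def)
  hence "M i \<in> S i" for i unfolding M_def using finS by (intro Max_in) auto
  hence M: "P i (2 / Suc (M i))" for i by (simp add: S_def)
  have "(\<lambda>i. 2 / real (Suc (M i))) \<longlonglongrightarrow> 0"
  proof (rule LIMSEQ_I)
    fix e :: real assume e: "e > 0"
    obtain m where m: "inverse (real (Suc m)) < e / 2" using reals_Archimedean[of "e / 2"] e by auto
    have "\<forall>\<^sub>F i in sequentially. P i (2 / Suc m)" by (rule assms(1)) simp
    then obtain n where n: "\<And>i. i \<ge> n \<Longrightarrow> P i (2 / Suc m)" unfolding eventually_sequentially by blast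
    have "norm (2 / real (Suc (M i)) - 0) < e" if i: "i \<ge> max m n" for i
    proof -
      have "m \<in> S i" using n i by (simp add: S_def)
      hence "m \<le> M i" unfolding M_def using finS by (intro Max_ge) auto
      hence "2 / real (Suc (M i)) \<le> 2 / real (Suc m)" by (intro divide_left_mono) simp_all
      also have "\<dots> < e" using m by (simp add: inverse_eq_divide)
      finally show ?thesis by simp
    qed
    thus "\<exists>no. \<forall>i\<ge>no. norm (2 / real (Suc (M i)) - 0) < e" by blast
  qed
  with M show ?thesis by (intro exI[of _ "\<lambda>i. 2 / real (Suc (M i))"]) simp
qed

theorem mainTheorem3:
  fixes k :: nat
    and X :: "nat \<Rightarrow> 'a set"
    and H :: "nat \<Rightarrow> (nat \<Rightarrow> 'a) set"
  assumes "k \<ge> 1"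
    and "increasing_hypergraph_seq k X H"
  shows "\<exists>\<phi> :: nat \<Rightarrow> nat. strict_mono \<phi> \<and> strongly_convergent k (X \<circ> \<phi>) (H \<circ> \<phi>)"
proof -
  \<comment> \<open>Stage \<open>n\<close> settles the error \<open>1 / Suc n\<close>.\<close>
  interpret subseqs "\<lambda>n s. eventually_structured k X H (1 / Suc n) s"
    by unfold_locales (rule exists_structured_subseq[OF assms(1) _ assms(2)]; simp)
  have sub: "strict_mono diagseq" by (rule subseq_diagseq)
  have seq: "increasing_hypergraph_seq k (X \<circ> diagseq) (H \<circ> diagseq)"
    by (rule increasing_hypergraph_seq_subseq[OF assms(2) sub])
  have "strongly_convergent k (X \<circ> diagseq) (H \<circ> diagseq)"
    unfolding strongly_convergent_def
  proof (intro conjI seq allI impI)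
    fix \<epsilon> :: real assume \<epsilon>: "\<epsilon> > 0"
    obtain n where "inverse (real (Suc n)) < \<epsilon>" using reals_Archimedean[OF \<epsilon>] by blast
    hence n: "1 / Suc n \<le> \<epsilon>" by (simp add: inverse_eq_divide)
    \<comment> \<open>From index \<open>Suc n\<close> on, the diagonal sequence is a subsequence of
      stage \<open>n\<close>. Eventual statements do not notice the shift, which is undone
      below.\<close>
    have "eventually_structured k X H (1 / Suc n) (diagseq \<circ> (+) (Suc n))"
      by (rule diagseq_holds) (rule eventually_structured_subseq)
    then obtain l C where l: "2 \<le> l" and comb: "combinatorial_structure k l (absorbing k l C)" and
      ev: "\<And>\<delta>. \<delta> > 0 \<Longrightarrow> \<forall>\<^sub>F i in sequentially.
        well_approximated k (X (diagseq (Suc n + i))) (H (diagseq (Suc n + i))) (1 / Suc n) l (absorbing k l C) \<delta>"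
      unfolding eventually_structured_def comp_def by blast
    let ?W = "\<lambda>i. well_approximated k (X (diagseq i)) (H (diagseq i)) \<epsilon> l (absorbing k l C)"
    have "\<forall>\<^sub>F i in sequentially. ?W i \<delta>" if "\<delta> > 0" for \<delta>
    proof -
      have "\<forall>\<^sub>F i in sequentially. ?W (i + Suc n) \<delta>"
        using ev[OF that]
        by eventually_elim (simp only: add.commute[of _ "Suc n"], erule well_approximated_mono[OF _ n order_refl])
      thus ?thesis by (rule eventually_sequentially_seg[THEN iffD1])
    qed
    \<comment> \<open>The same structure represents every member exactly at tolerance 2, so the
      early members fit as well.\<close>
    moreover have "?W i 2" for i
      using assms \<epsilon> l by (intro well_approximated_exactly) (auto simp: increasing_hypergraph_seq_def)
    ultimately obtain \<delta> where \<delta>: "\<forall>i. \<delta> i > 0 \<and> ?W i (\<delta> i)" "\<delta> \<longlonglongrightarrow> 0"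
      using null_sequence_of_eventually[of ?W] by blast
    have "\<forall>i. \<exists>P. hyperpartition k l (X (diagseq i)) P \<and>
        regular_hyperpartition k l (X (diagseq i)) (\<delta> i) P \<and> equitable k l (X (diagseq i)) (\<delta> i) P \<and>
        (\<exists>T. has_combinatorial_structure k (X (diagseq i)) P (absorbing k l C) T \<and>
          real (card (sym_diff (H (diagseq i)) T)) \<le> \<epsilon> * real (card (X (diagseq i)) choose k))"
      using \<delta>(1) unfolding well_approximated_def by blast
    from choice[OF this] obtain P where "\<forall>i. hyperpartition k l (X (diagseq i)) (P i) \<and>
        regular_hyperpartition k l (X (diagseq i)) (\<delta> i) (P i) \<and> equitable k l (X (diagseq i)) (\<delta> i) (P i) \<and>
        (\<exists>T. has_combinatorial_structure k (X (diagseq i)) (P i) (absorbing k l C) T \<and>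
          real (card (sym_diff (H (diagseq i)) T)) \<le> \<epsilon> * real (card (X (diagseq i)) choose k))" by (rule exE)
    thus "\<exists>l C P \<delta>. 1 \<le> l \<and> combinatorial_structure k l C \<and> (\<forall>i. 0 < \<delta> i) \<and> \<delta> \<longlonglongrightarrow> 0 \<and>
        (\<forall>i. hyperpartition k l ((X \<circ> diagseq) i) (P i) \<and>
             regular_hyperpartition k l ((X \<circ> diagseq) i) (\<delta> i) (P i) \<and>
             equitable k l ((X \<circ> diagseq) i) (\<delta> i) (P i) \<and>
             (\<exists>T. has_combinatorial_structure k ((X \<circ> diagseq) i) (P i) C T \<and>
                  real (card (sym_diff ((H \<circ> diagseq) i) T)) \<le> \<epsilon> * real (card ((X \<circ> diagseq) i) choose k)))"
      using l comb \<delta> unfolding comp_def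
      by (intro exI[of _ l] exI[of _ "absorbing k l C"] exI[of _ P] exI[of _ \<delta>] conjI) simp_all
  qed
  with sub show ?thesis by blast
qed

end
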